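(* Let $k\in\{3,4,5,7\}$ and put $N(3)=6$, $N(4)=7$, $N(5)=24$, $N(7)=93$. If $n\ge N(k)$ and $\pi=(d_1,\ldots,d_n)$ is a graphic sequence with $\sigma(\pi)>(k-1)(n-1)$, then $\pi$ has a realization containing every 2-tree on $k$ vertices as a subgraph. Moreover, the lower bound $(k-1)(n-1)$ is best possible: (for infinitely many $n$) there exist graphic sequences $\pi$ of length $n$ with $\sigma(\pi)=(k-1)(n-1)$ having no realization that contains every 2-tree on $k$ vertices.
   Context: A simple graph $G$ is a 2-tree if $G=K_3$, or $G$ has a vertex $v$ of degree 2 whose two neighbors are adjacent and $G-v$ is a 2-tree. A non-increasing sequence $\pi=(d_1,\ldots,d_n)$ of nonnegative integers is graphic if it is the degree sequence of some simple graph on $n$ vertices, called a realization of $\pi$. We write $\sigma(\pi)=d_1+\cdots+d_n$. *)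

theory Defs
  imports
    "HOL-Library.Multiset"
    "Graph_Theory.Digraph_Isomorphism"
    "Graph_Theory.Kuratowski"
begin

text \<open>
  A simple graph is the symmetric loop-free finite digraph of the library (\<open>graph\<close>, or
  \<open>pair_graph\<close> when the arcs are pairs of vertices). Each edge is a pair of opposite
  arcs, so the degree of a vertex is its out-degree.
\<close>

inductive two_tree :: "('a, 'b) pre_digraph \<Rightarrow> bool" where
  triangle: "complete_digraph 3 G \<Longrightarrow> two_tree G"
| attach: "\<lbrakk>graph G; v \<in> verts G; out_degree G v = 2;
     v \<rightarrow>\<^bsub>G\<^esub> u; v \<rightarrow>\<^bsub>G\<^esub> w; u \<noteq> w; u \<rightarrow>\<^bsub>G\<^esub> w;
     two_tree (pre_digraph.del_vert G v)\<rbrakk> \<Longrightarrow> two_tree G"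

text \<open>Subgraph containment is meant up to isomorphism.\<close>

definition contains :: "'a pair_pre_digraph \<Rightarrow> 'b pair_pre_digraph \<Rightarrow> bool" where
  "contains G T \<longleftrightarrow>
     (\<exists>S. subgraph (with_proj S) (with_proj G) \<and> digraph_iso (with_proj S) (with_proj T))"

text \<open>
  Every finite graph has a copy with vertices in \<open>nat\<close>, so quantifying over 2-trees with
  natural-number vertices covers all of them.
\<close>

definition contains_all_two_trees :: "nat \<Rightarrow> 'a pair_pre_digraph \<Rightarrow> bool" where
  "contains_all_two_trees k G \<longleftrightarrow>
     (\<forall>T :: nat pair_pre_digraph.
        two_tree (with_proj T) \<and> card (pverts T) = k \<longrightarrow> contains G T)"

text \<open>
  The degrees are compared as multisets; the monotonicity of the sequence is part of
  \<open>graphic\<close>. A realization has exactly \<open>length d\<close> vertices.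
\<close>

definition realization :: "nat pair_pre_digraph \<Rightarrow> nat list \<Rightarrow> bool" where
  "realization G d \<longleftrightarrow>
     pair_graph G \<and>
     image_mset (out_degree (with_proj G)) (mset_set (pverts G)) = mset d"

definition graphic :: "nat list \<Rightarrow> bool" where
  "graphic d \<longleftrightarrow> sorted_wrt (\<ge>) d \<and> (\<exists>G. realization G d)"

end

theory Submission
  imports Defs
begin

text \<open>
  Fix the degrees of the vertices \<open>0, \<dots>, n - 1\<close> (non-increasing) and a set \<open>H\<close> of wanted edges, and
  take a realization \<open>E\<close> for which \<open>E \<inter> H\<close> is maximal under inclusion. Suppose that \<open>uv \<in> H\<close> is
  missing and that \<open>ux\<close>, \<open>vy\<close> are unwanted edges of \<open>E\<close>. Exchanging two edges shows that \<open>x = y\<close> or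
  \<open>xy \<in> E\<close>; exchanging three shows that every unwanted edge \<open>ab\<close> has \<open>a \<in> N[x]\<close> or \<open>b \<in> N[y]\<close>. When
  \<open>x\<close>, \<open>y\<close> and their neighbours have small degree, this leaves room for too few edges to reach the
  required degree sum.

  Deleting a vertex of degree two shows that every 2-tree on \<open>k\<close> vertices lies in the complete graph
  on \<open>k - 1\<close> vertices plus a vertex joined to two of them, and for \<open>k \<le> 5\<close> this is the graph to be
  realized. For \<open>k = 7\<close> three vertices of degree \<open>n - 1\<close> may absorb almost the whole degree sum; then
  one realizes instead a triangle joined to two disjoint edges, or a \<open>K\<^sub>4\<close> joined to three vertices.
  These also contain all 2-trees on seven vertices, because the complement of such a 2-tree contains
  a 4-cycle and a triangle.

  The bound is attained by the windmill sequence \<open>n - 1, k - 2, \<dots>, k - 2\<close>: the 2-tree in which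
  \<open>k - 2\<close> vertices are joined to both ends of one edge needs two vertices of degree \<open>k - 1\<close>.
\<close>

section \<open>Exchanging edges in a realization\<close>

text \<open>The obstacle is a vertex of degree close to \<open>n - 1\<close>. A realization has more
  than (k - 1)(n - 1)/2 edges, so an edge count tolerates one unbounded degree for k = 5 and two for
  k = 7, provided that the next degree is at most 3k - 7, that is 8 or 14. For k = 7 a third regime
  remains, \<open>d 5 \<le> 4\<close>. Then no six vertices form a clique, so
  \<open>clique_plus 7\<close> is out of reach and the other targets are needed although
  \<open>d 2\<close> is bounded. The values N(3) = 6 and N(4) = 7 exclude the degree sequences of
  the 5-cycle and of the triangular prism, which exceed the bound but have no suitable realization.
  The values 24 and 93 are what the edge counts ask for.\<close>

definition nb :: "'a set set \<Rightarrow> 'a \<Rightarrow> 'a set" where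
  "nb E u = {w. {u, w} \<in> E}"

lemma in_nb_iff: "w \<in> nb E u \<longleftrightarrow> {u, w} \<in> E"
  by (simp add: nb_def)

lemma nb_sym: "w \<in> nb E u \<longleftrightarrow> u \<in> nb E w"
  by (simp add: nb_def insert_commute)

definition clique :: "'a set set \<Rightarrow> 'a set \<Rightarrow> bool" where
  "clique E C \<longleftrightarrow> (\<forall>a\<in>C. \<forall>b\<in>C. a \<noteq> b \<longrightarrow> {a, b} \<in> E)"

definition edges_on :: "'a set \<Rightarrow> 'a set set" where
  "edges_on V = {{a, b} |a b. a \<in> V \<and> b \<in> V \<and> a \<noteq> b}"

lemma edges_on_iff [simp]: "{a, b} \<in> edges_on V \<longleftrightarrow> a \<in> V \<and> b \<in> V \<and> a \<noteq> b"
  by (auto simp: edges_on_def doubleton_eq_iff)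

lemma edges_on_cases:
  assumes "e \<in> edges_on V"
  obtains a b where "e = {a, b}" "a \<in> V" "b \<in> V" "a \<noteq> b"
  using assms by (auto simp: edges_on_def)

lemma edges_on_mono: "A \<subseteq> B \<Longrightarrow> edges_on A \<subseteq> edges_on B"
  by (auto simp: edges_on_def)

lemma finite_edges_on: "finite V \<Longrightarrow> finite (edges_on V)"
  by (rule finite_subset[of _ "Pow V"]) (auto simp: edges_on_def)

lemma card_edges_on: "finite V \<Longrightarrow> card (edges_on V) = card V choose 2"
proof -
  assume V: "finite V"
  have "edges_on V = {e. e \<subseteq> V \<and> card e = 2}"
    by (auto simp: edges_on_def card_2_iff)
  then show ?thesis using n_subsets[OF V, of 2] by simp
qed

lemma bij_betw_nb:
  assumes "E \<subseteq> edges_on V"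
  shows "bij_betw (\<lambda>w. {u, w}) (nb E u) {e \<in> E. u \<in> e}"
proof (rule bij_betwI')
  fix x y assume "x \<in> nb E u" "y \<in> nb E u"
  then show "({u, x} = {u, y}) = (x = y)" by (auto simp: doubleton_eq_iff)
next
  fix x assume "x \<in> nb E u"
  then show "{u, x} \<in> {e \<in> E. u \<in> e}" by (auto simp: nb_def)
next
  fix e assume e: "e \<in> {e \<in> E. u \<in> e}"
  then have "e \<in> edges_on V" using assms by auto
  then obtain a b where "e = {a, b}" "a \<noteq> b" by (rule edges_on_cases)
  with e show "\<exists>x\<in>nb E u. e = {u, x}" by (auto simp: nb_def insert_commute)
qed

lemma card_nb_eq:
  assumes "E \<subseteq> edges_on V"
  shows "card (nb E u) = card {e \<in> E. u \<in> e}"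
  using bij_betw_same_card[OF bij_betw_nb[OF assms]] .

lemma nb_subset: "E \<subseteq> edges_on V \<Longrightarrow> nb E u \<subseteq> V - {u}"
  by (auto simp: nb_def edges_on_def doubleton_eq_iff dest!: subsetD)

lemma sum_of_bool_eq_card:
  "finite S \<Longrightarrow> (\<Sum>x\<in>S. of_bool (P x)) = card {x \<in> S. P x}"
  by (simp add: of_bool_def flip: sum.inter_filter)

lemma sum_card_nb:
  assumes E: "E \<subseteq> edges_on V" and V: "finite V" and S: "finite S"
  shows "(\<Sum>i\<in>S. card (nb E i)) = (\<Sum>e\<in>E. card (e \<inter> S))"
proof -
  have fE: "finite E" using E finite_edges_on[OF V] finite_subset by blast
  have "(\<Sum>i\<in>S. card (nb E i)) = (\<Sum>i\<in>S. \<Sum>e\<in>E. of_bool (i \<in> e))"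
    by (rule sum.cong[OF refl]) (unfold card_nb_eq[OF E] sum_of_bool_eq_card[OF fE], rule refl)
  also have "\<dots> = (\<Sum>e\<in>E. \<Sum>i\<in>S. of_bool (i \<in> e))"
    by (rule sum.swap)
  also have "\<dots> = (\<Sum>e\<in>E. card (e \<inter> S))"
  proof (rule sum.cong[OF refl])
    fix e
    have "{i \<in> S. i \<in> e} = e \<inter> S" by blast
    then show "(\<Sum>i\<in>S. of_bool (i \<in> e)) = card (e \<inter> S)"
      by (simp only: sum_of_bool_eq_card[OF S])
  qed
  finally show ?thesis .
qed

section \<open>Exchanges between realizations of one degree sequence\<close>

locale deg_seq =
  fixes n :: nat and d :: "nat \<Rightarrow> nat"
  assumes mono: "i \<le> j \<Longrightarrow> j < n \<Longrightarrow> d j \<le> d i"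
begin

definition realizes :: "nat set set \<Rightarrow> bool" where
  "realizes E \<longleftrightarrow> E \<subseteq> edges_on {..<n} \<and> (\<forall>i<n. card (nb E i) = d i)"

lemma realizes_edges: "realizes E \<Longrightarrow> E \<subseteq> edges_on {..<n}"
  by (simp add: realizes_def)

lemma realizes_finite: "realizes E \<Longrightarrow> finite E"
  using finite_subset finite_edges_on realizes_edges by blast

lemma realizes_deg: "realizes E \<Longrightarrow> i < n \<Longrightarrow> card (nb E i) = d i"
  by (simp add: realizes_def)

lemma realizes_edgeD:
  assumes "realizes E" "{a, b} \<in> E"
  shows "a < n" "b < n" "a \<noteq> b"
  using subsetD[OF realizes_edges[OF assms(1)] assms(2)] by auto

lemma realizes_nb: "realizes E \<Longrightarrow> nb E u \<subseteq> {..<n} - {u}"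
  by (rule nb_subset[OF realizes_edges])

lemma realizes_finite_nb: "realizes E \<Longrightarrow> finite (nb E u)"
  by (rule finite_subset[OF realizes_nb]) auto

text \<open>A degree is the sum of incidence indicators over the edge set. Equal indicator sums over
  removed and added edges therefore preserve all degrees, with no case distinction on coinciding
  endpoints.\<close>

lemma realizes_exchange:
  assumes E: "realizes E" and D: "D \<subseteq> E" and A: "A \<inter> E = {}" "A \<subseteq> edges_on {..<n}"
    and deg: "\<And>w. (\<Sum>e\<in>D. of_bool (w \<in> e)) = (\<Sum>e\<in>A. of_bool (w \<in> e) :: nat)"
  shows "realizes ((E - D) \<union> A)"
  unfolding realizes_def
proof (intro conjI allI impI)
  show sub: "E - D \<union> A \<subseteq> edges_on {..<n}" using realizes_edges[OF E] A(2) by blast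
  fix i assume i: "i < n"
  have fin: "finite E" "finite D" "finite A"
    using realizes_finite[OF E] D A(2) finite_edges_on[of "{..<n}"] finite_subset by auto
  note c = sum_of_bool_eq_card[symmetric]
  have "card (nb (E - D \<union> A) i) = card {e \<in> E - D \<union> A. i \<in> e}"
    by (rule card_nb_eq[OF sub])
  also have "\<dots> = (\<Sum>e\<in>E - D. of_bool (i \<in> e)) + (\<Sum>e\<in>A. of_bool (i \<in> e))"
    unfolding c[OF finite_UnI[OF finite_Diff[OF fin(1)] fin(3)]]
    by (rule sum.union_disjoint) (use fin A(1) in auto)
  also have "\<dots> = (\<Sum>e\<in>E - D. of_bool (i \<in> e)) + (\<Sum>e\<in>D. of_bool (i \<in> e))"
    using deg by simp
  also have "\<dots> = (\<Sum>e\<in>E. of_bool (i \<in> e))"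
    using sum.subset_diff[OF D fin(1)] by metis
  also have "\<dots> = d i"
    using c[OF fin(1), of "\<lambda>e. i \<in> e"] card_nb_eq[OF realizes_edges[OF E], of i] realizes_deg[OF E i] by simp
  finally show "card (nb (E - D \<union> A) i) = d i" .
qed

definition maximal :: "nat set set \<Rightarrow> nat set set \<Rightarrow> bool" where
  "maximal H E \<longleftrightarrow> realizes E \<and> (\<forall>E'. realizes E' \<longrightarrow> E \<inter> H \<subseteq> E' \<longrightarrow> E' \<inter> H \<subseteq> E)"

lemma maximal_realizes: "maximal H E \<Longrightarrow> realizes E"
  by (simp add: maximal_def)

text \<open>Among the realizations containing \<open>E \<inter> H\<close>, one with the most wanted
  edges is maximal. The second conclusion allows several rounds: when \<open>H\<close> is enlarged,
  the wanted edges gained so far survive.\<close>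

lemma maximal_exists:
  assumes "realizes E"
  obtains E' where "maximal H E'" "E \<inter> H \<subseteq> E'"
proof -
  let ?S = "{E'. realizes E' \<and> E \<inter> H \<subseteq> E'}"
  have "finite ?S"
    using realizes_edges finite_edges_on[of "{..<n}"]
    by (intro finite_subset[of ?S "Pow (edges_on {..<n})"]) auto
  moreover have "?S \<noteq> {}" using assms by auto
  ultimately obtain E' where E': "E' \<in> ?S"
      and mx: "\<And>F. F \<in> ?S \<Longrightarrow> card (F \<inter> H) \<le> card (E' \<inter> H)"
    using Max_in[of "(\<lambda>F. card (F \<inter> H)) ` ?S"] Max_ge[of "(\<lambda>F. card (F \<inter> H)) ` ?S"]
    by (smt (verit) finite_imageI image_iff image_is_empty)
  have "F \<inter> H \<subseteq> E'" if F: "realizes F" "E' \<inter> H \<subseteq> F" for F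
  proof -
    have "F \<in> ?S" using E' F by auto
    then have "card (F \<inter> H) \<le> card (E' \<inter> H)" by (rule mx)
    moreover have "E' \<inter> H \<subseteq> F \<inter> H" "finite (F \<inter> H)"
      using F realizes_finite by auto
    ultimately have "E' \<inter> H = F \<inter> H" by (metis card_seteq)
    then show ?thesis by blast
  qed
  then show ?thesis using that[of E'] E' by (auto simp: maximal_def)
qed

text \<open>An exchange that removes only unwanted edges keeps \<open>E \<inter> H\<close>, so by
  maximality it cannot add a wanted edge.\<close>

lemma maximal_no_exchange:
  assumes "maximal H E" "D \<subseteq> E" "D \<inter> H = {}" "A \<inter> E = {}" "A \<subseteq> edges_on {..<n}"
    and deg: "\<And>w. (\<Sum>e\<in>D. of_bool (w \<in> e)) = (\<Sum>e\<in>A. of_bool (w \<in> e) :: nat)"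
  shows "A \<inter> H = {}"
  using assms realizes_exchange[of E D A] unfolding maximal_def by blast

lemma of_bool_doubleton:
  "a \<noteq> b \<Longrightarrow> of_bool (w \<in> {a, b}) = (of_bool (w = a) + of_bool (w = b) :: nat)"
  by auto

lemma sum_doubleton: "a \<noteq> b \<Longrightarrow> sum f {a, b} = (f a + f b :: nat)"
  by simp

lemma sum_tripleton:
  "a \<noteq> b \<Longrightarrow> a \<noteq> c \<Longrightarrow> b \<noteq> c \<Longrightarrow> sum f {a, b, c} = (f a + f b + f c :: nat)"
  by simp

lemma maximal_two_swap:
  assumes M: "maximal H E" and uv: "{u, v} \<in> H" "{u, v} \<notin> E" "u \<noteq> v"
    and ux: "{u, x} \<in> E" "{u, x} \<notin> H" and vy: "{v, y} \<in> E" "{v, y} \<notin> H"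
  shows "x = y \<or> {x, y} \<in> E"
proof (rule ccontr)
  assume neg: "\<not> ?thesis"
  note E = maximal_realizes[OF M]
  have ne: "u \<noteq> x" "v \<noteq> y" "x \<noteq> v" "y \<noteq> u" and lt: "u < n" "v < n" "x < n" "y < n"
    using realizes_edgeD[OF E ux(1)] realizes_edgeD[OF E vy(1)] uv ux(1) vy(1)
    by (auto simp: insert_commute)
  have dist: "{u, x} \<noteq> {v, y}" "{u, v} \<noteq> {x, y}"
    using ne uv(3) neg by (auto simp: doubleton_eq_iff)
  have "{{u, v}, {x, y}} \<inter> H = {}"
  proof (rule maximal_no_exchange[OF M, of "{{u, x}, {v, y}}"])
    show "(\<Sum>e\<in>{{u, x}, {v, y}}. of_bool (w \<in> e)) = (\<Sum>e\<in>{{u, v}, {x, y}}. of_bool (w \<in> e) :: nat)" for w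
      using dist neg ne uv(3)
      by (simp only: sum_doubleton of_bool_doubleton not_False_eq_True de_Morgan_disj ac_simps)
  qed (use ux vy uv(2,3) neg ne lt in simp_all)
  then show False using uv(1) by auto
qed

lemma maximal_three_swap:
  assumes M: "maximal H E" and uv: "{u, v} \<in> H" "{u, v} \<notin> E" "u \<noteq> v"
    and ux: "{u, x} \<in> E" "{u, x} \<notin> H" and vy: "{v, y} \<in> E" "{v, y} \<notin> H"
    and ab: "{a, b} \<in> E" "{a, b} \<notin> H" and a: "a \<noteq> x" "{x, a} \<notin> E"
  shows "b = y \<or> {y, b} \<in> E"
proof (rule ccontr)
  assume neg: "\<not> ?thesis"
  \<comment> \<open>The exchange of two edges excludes the coincidences \<open>a = y\<close> and
    \<open>b = x\<close>, which would make added pairs coincide or be present already. The case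
    \<open>a = v\<close> stays admissible and is used for k = 3 and k = 4.\<close>
  have xy: "x = y \<or> {x, y} \<in> E" by (rule maximal_two_swap[OF M uv ux vy])
  note E = maximal_realizes[OF M]
  have ne: "u \<noteq> x" "v \<noteq> y" "x \<noteq> v" "y \<noteq> u" "a \<noteq> b"
    and lt: "u < n" "v < n" "x < n" "y < n" "a < n" "b < n"
    using realizes_edgeD[OF E ux(1)] realizes_edgeD[OF E vy(1)] realizes_edgeD[OF E ab(1)]
      uv ux(1) vy(1) by (auto simp: insert_commute)
  have ne2: "a \<noteq> u" "b \<noteq> v" "a \<noteq> y" "b \<noteq> x"
    using a neg ux(1) vy(1) xy by (auto simp: insert_commute)
  have dist: "{u, x} \<noteq> {v, y}" "{u, x} \<noteq> {a, b}" "{v, y} \<noteq> {a, b}"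
    "{u, v} \<noteq> {x, a}" "{u, v} \<noteq> {y, b}" "{x, a} \<noteq> {y, b}"
    using ne ne2 uv(3) neg a by (auto simp: doubleton_eq_iff)
  have yb: "y \<noteq> b" using neg by auto
  have "{{u, v}, {x, a}, {y, b}} \<inter> H = {}"
  proof (rule maximal_no_exchange[OF M, of "{{u, x}, {v, y}, {a, b}}"])
    show "(\<Sum>e\<in>{{u, x}, {v, y}, {a, b}}. of_bool (w \<in> e)) =
        (\<Sum>e\<in>{{u, v}, {x, a}, {y, b}}. of_bool (w \<in> e) :: nat)" for w
      using dist neg ne ne2 uv(3) a not_sym[OF a(1)] yb
      by (simp only: sum_tripleton of_bool_doubleton not_False_eq_True de_Morgan_disj ac_simps)
  qed (use ux vy ab uv(2,3) neg ne lt a in simp_all)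
  then show False using uv(1) by auto
qed

end

section \<open>Counting edges around a missing edge\<close>

definition clique_plus :: "nat \<Rightarrow> 'a set set \<Rightarrow> bool" where
  "clique_plus k E \<longleftrightarrow> (\<exists>C t a b. finite C \<and> card C = k - 1 \<and> clique E C \<and> t \<notin> C \<and>
     a \<in> C \<and> b \<in> C \<and> a \<noteq> b \<and> {t, a} \<in> E \<and> {t, b} \<in> E)"

lemma clique_plusI:
  assumes "finite C" "card C = k - 1" "clique E C" "t \<notin> C"
    and "a \<in> C" "b \<in> C" "a \<noteq> b" "{t, a} \<in> E" "{t, b} \<in> E"
  shows "clique_plus k E"
  using assms unfolding clique_plus_def by blast

text \<open>Take k - 2 vertices of \<open>X\<close> together with \<open>u\<close> as the clique. If
  \<open>Y\<close> lies among the chosen vertices, \<open>v\<close> itself is the additional vertex;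
  otherwise a vertex of \<open>Y\<close> is. Both cases need two attachment points among k - 2
  vertices, hence \<open>4 \<le> k\<close>.\<close>

lemma clique_plus_of_clique_nbhd:
  assumes E: "E \<subseteq> edges_on V" and k: "4 \<le> k" and uv: "{u, v} \<notin> E" "u \<noteq> v"
    and X: "X \<subseteq> nb E u" "k - 2 \<le> card X" "clique E X"
    and Y: "Y \<subseteq> nb E v" "k - 2 \<le> card Y"
    and XY: "\<And>x y. x \<in> X \<Longrightarrow> y \<in> Y \<Longrightarrow> x = y \<or> {x, y} \<in> E"
  shows "clique_plus k E"
proof -
  have irr: "{a} \<notin> E" for a using E by (auto simp: edges_on_def)
  obtain X' where X': "X' \<subseteq> X" "card X' = k - 2" "finite X'"
    using obtain_subset_with_card_n[OF X(2)] by blast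
  have uX: "u \<notin> X'" using X' X(1) irr by (auto simp: nb_def)
  let ?C = "insert u X'"
  have C: "finite ?C" "card ?C = k - 1" using X' uX k by auto
  have cl: "clique E ?C" using X(1,3) X'(1)
    by (auto simp: clique_def nb_def insert_commute)
  show ?thesis
  proof (cases "Y \<subseteq> X'")
    case True
    have "2 \<le> card Y" using Y(2) k by simp
    then obtain a b where ab: "a \<in> Y" "b \<in> Y" "a \<noteq> b"
      by (metis card_le_Suc0_iff_eq card.infinite not_less_eq_eq numeral_2_eq_2 zero_le)
    have "v \<notin> ?C" using uv X(1) X'(1) by (auto simp: nb_def)
    then show ?thesis
      using ab True Y(1) by (intro clique_plusI[OF C cl, of v a b]) (auto simp: nb_def)
  next
    case False
    then obtain y where y: "y \<in> Y" "y \<notin> X'" by blast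
    have "2 \<le> card X'" using X'(2) k by simp
    then obtain a b where ab: "a \<in> X'" "b \<in> X'" "a \<noteq> b"
      by (metis card_le_Suc0_iff_eq card.infinite not_less_eq_eq numeral_2_eq_2 zero_le)
    have "y \<notin> ?C" using y uv(1) Y(1) by (auto simp: nb_def insert_commute)
    moreover have "{y, z} \<in> E" if "z \<in> X'" for z
      using XY[of z y] that y X'(1) by (auto simp: insert_commute)
    ultimately show ?thesis
      using ab by (intro clique_plusI[OF C cl, of y a b]) auto
  qed
qed

text \<open>
  The number \<open>m\<close> of edges if each of them meets \<open>N[x] \<inter> N[y]\<close> or lies inside \<open>N[x]\<close> or inside \<open>N[y]\<close>,
  where \<open>x\<close> and \<open>y\<close> have degrees at most \<open>a\<close> and \<open>b\<close> and all degrees are at most \<open>c\<close>. The first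
  alternative is \<open>x = y\<close>, with degree at most \<open>a'\<close>; in the second \<open>q\<close> is the size of \<open>N[x] \<inter> N[y]\<close>.
\<close>

definition nbhd_bound :: "nat \<Rightarrow> nat \<Rightarrow> nat \<Rightarrow> nat \<Rightarrow> nat \<Rightarrow> bool" where
  "nbhd_bound a' a b c m \<longleftrightarrow> m \<le> a' * c \<or> (\<exists>q\<ge>2. q \<le> a + 1 \<and> q \<le> b + 1 \<and>
    m \<le> a + b - 1 + (q - 2) * (c - 2) + ((a + 1 - q) choose 2) + ((b + 1 - q) choose 2))"

text \<open>Applying \<open>cover\<close> to both orientations of an edge shows that one end lies in
  both closed neighbourhoods or both ends lie in the same one. The summands are \<open>a\<close>
  edges at \<open>x\<close>, \<open>b - 1\<close> further ones at \<open>y\<close>,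
  \<open>c - 2\<close> at each other common vertex (its edges to \<open>x\<close> and
  \<open>y\<close> are already counted), and the pairs inside the two remainders.\<close>

lemma card_edges_within_closed_nbhds:
  assumes F: "F \<subseteq> edges_on P" and P: "finite P" and xy: "{x, y} \<in> F"
    and deg: "\<And>v. v \<in> P \<Longrightarrow> card (nb F v) \<le> c"
    and a: "card (nb F x) \<le> a" and b: "card (nb F y) \<le> b"
    and cover: "\<And>p q. {p, q} \<in> F \<Longrightarrow> p \<in> insert x (nb F x) \<or> q \<in> insert y (nb F y)"
  shows "\<exists>q\<ge>2. q \<le> a + 1 \<and> q \<le> b + 1 \<and>
    card F \<le> a + b - 1 + (q - 2) * (c - 2) + ((a + 1 - q) choose 2) + ((b + 1 - q) choose 2)"
proof -
  let ?Nx = "insert x (nb F x)" and ?Ny = "insert y (nb F y)"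
  define Q where "Q = ?Nx \<inter> ?Ny"
  define q where "q = card Q"
  have finF: "finite F" using F finite_edges_on[OF P] finite_subset by blast
  have nbP: "nb F v \<subseteq> P" for v using nb_subset[OF F, of v] by blast
  have fnb: "finite (nb F v)" for v using nbP P finite_subset by blast
  have xyP: "x \<in> P" "y \<in> P" "x \<noteq> y" using subsetD[OF F xy] by auto
  have xyQ: "x \<in> Q" "y \<in> Q" using xy by (auto simp: Q_def nb_def insert_commute)
  have finQ: "finite Q" using fnb by (auto simp: Q_def)
  have QP: "Q \<subseteq> P" using nbP xyP by (auto simp: Q_def)
  have "card {x, y} \<le> q" unfolding q_def using xyQ finQ by (intro card_mono) auto
  then have q2: "2 \<le> q" using xyP by simp
  have Nx: "card ?Nx \<le> a + 1" and Ny: "card ?Ny \<le> b + 1"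
    using a b fnb by (auto simp: card_insert_if)
  have qa: "q \<le> a + 1" and qb: "q \<le> b + 1"
    using card_mono[of ?Nx Q] card_mono[of ?Ny Q] Nx Ny fnb by (auto simp: q_def Q_def)
  have dx: "card (?Nx - Q) \<le> a + 1 - q" "card (?Ny - Q) \<le> b + 1 - q"
    using Nx Ny fnb finQ card_Diff_subset[of Q ?Nx] card_Diff_subset[of Q ?Ny]
    by (auto simp: q_def Q_def)
  have inc: "card {e \<in> F. v \<in> e} = card (nb F v)" for v
    using card_nb_eq[OF F] by simp
  define A1 where "A1 = {e \<in> F. x \<in> e}"
  define A2 where "A2 = {e \<in> F. y \<in> e} - {{x, y}}"
  define A3 where "A3 = (\<Union>t\<in>Q - {x, y}. {e \<in> F. t \<in> e} - {{t, x}, {t, y}})"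
  define A4 where "A4 = edges_on (?Nx - Q)"
  define A5 where "A5 = edges_on (?Ny - Q)"
  have fin: "finite A1" "finite A2" "finite A3" "finite A4" "finite A5"
    using finF finQ fnb by (auto simp: A1_def A2_def A3_def A4_def A5_def intro!: finite_edges_on)
  have c1: "card A1 \<le> a" using a inc by (simp add: A1_def)
  have c2: "card A2 \<le> b - 1"
    using b inc[of y] xy finF by (simp add: A2_def)
  have "card A3 \<le> (\<Sum>t\<in>Q - {x, y}. card ({e \<in> F. t \<in> e} - {{t, x}, {t, y}}))"
    unfolding A3_def using finQ by (intro card_UN_le) auto
  also have "\<dots> \<le> (\<Sum>t\<in>Q - {x, y}. c - 2)"
  proof (rule sum_mono)
    fix t assume t: "t \<in> Q - {x, y}"
    then have e: "{t, x} \<in> F" "{t, y} \<in> F" by (auto simp: Q_def nb_def insert_commute)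
    have "{t, x} \<noteq> {t, y}" using xyP by (auto simp: doubleton_eq_iff)
    then have "card ({e \<in> F. t \<in> e} - {{t, x}, {t, y}}) = card (nb F t) - 2"
      using e inc[of t] finF by (subst card_Diff_subset) auto
    then show "card ({e \<in> F. t \<in> e} - {{t, x}, {t, y}}) \<le> c - 2"
      using deg[of t] t QP by auto
  qed
  also have "\<dots> = (q - 2) * (c - 2)"
    using xyQ xyP finQ by (simp add: q_def card_Diff_subset numeral_2_eq_2)
  finally have c3: "card A3 \<le> (q - 2) * (c - 2)" .
  have c4: "card A4 \<le> (a + 1 - q) choose 2"
    unfolding A4_def using dx(1) fnb by (subst card_edges_on) (auto intro: binomial_right_mono)
  have c5: "card A5 \<le> (b + 1 - q) choose 2"
    unfolding A5_def using dx(2) fnb by (subst card_edges_on) (auto intro: binomial_right_mono)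
  have "F \<subseteq> A1 \<union> A2 \<union> A3 \<union> A4 \<union> A5"
  proof
    fix e assume e: "e \<in> F"
    then have "e \<in> edges_on P" using F by blast
    then obtain p r where pr: "e = {p, r}" "p \<noteq> r" by (rule edges_on_cases)
    have "p \<in> ?Nx \<or> r \<in> ?Ny" "r \<in> ?Nx \<or> p \<in> ?Ny"
      using cover[of p r] cover[of r p] e pr by (auto simp: insert_commute)
    then consider "p \<in> Q \<or> r \<in> Q" | "p \<in> ?Nx - Q" "r \<in> ?Nx - Q" | "p \<in> ?Ny - Q" "r \<in> ?Ny - Q"
      unfolding Q_def by blast
    then show "e \<in> A1 \<union> A2 \<union> A3 \<union> A4 \<union> A5"
    proof cases
      case 1
      then obtain t where t: "t \<in> Q" "t \<in> e" using pr by auto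
      then show ?thesis using e unfolding A1_def A2_def A3_def by blast
    qed (use pr in \<open>auto simp: A4_def A5_def\<close>)
  qed
  then have "card F \<le> card (A1 \<union> A2 \<union> A3 \<union> A4 \<union> A5)"
    using fin by (intro card_mono) auto
  also have "\<dots> \<le> card A1 + card A2 + card A3 + card A4 + card A5"
    by (meson card_Un_le add_le_mono1 le_trans)
  finally have F: "card F \<le> card A1 + card A2 + card A3 + card A4 + card A5" .
  have "b \<ge> 1" using qb q2 by simp
  then have "card F \<le> a + b - 1 + (q - 2) * (c - 2) + ((a + 1 - q) choose 2) + ((b + 1 - q) choose 2)"
    using F c1 c2 c3 c4 c5 by linarith
  then show ?thesis using q2 qa qb by blast
qed

lemma card_edges_touching:
  assumes F: "F \<subseteq> edges_on P" and P: "finite P" and S: "finite S" "S \<subseteq> P"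
    and deg: "\<And>v. v \<in> P \<Longrightarrow> card (nb F v) \<le> c"
  shows "card {e \<in> F. e \<inter> S \<noteq> {}} \<le> card S * c"
proof -
  have "{e \<in> F. e \<inter> S \<noteq> {}} = (\<Union>t\<in>S. {e \<in> F. t \<in> e})" by blast
  then have "card {e \<in> F. e \<inter> S \<noteq> {}} \<le> (\<Sum>t\<in>S. card {e \<in> F. t \<in> e})"
    using S by (simp add: card_UN_le)
  also have "\<dots> \<le> (\<Sum>t\<in>S. c)"
    using S deg by (intro sum_mono) (auto simp flip: card_nb_eq[OF F])
  finally show ?thesis by simp
qed

lemma card_edges_within:
  assumes F: "F \<subseteq> edges_on P" and P: "finite P" and S: "finite S" "S \<subseteq> P"
    and deg: "\<And>v. v \<in> P \<Longrightarrow> card (nb F v) \<le> c"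
  shows "2 * card (F \<inter> edges_on S) \<le> card S * c"
proof -
  have finF: "finite F" using F finite_edges_on[OF P] finite_subset by blast
  have "2 * card (F \<inter> edges_on S) = (\<Sum>e\<in>F \<inter> edges_on S. card (e \<inter> S))"
  proof -
    have "card (e \<inter> S) = 2" if "e \<in> F \<inter> edges_on S" for e
    proof -
      from that have "e \<in> edges_on S" by simp
      then obtain a b where "e = {a, b}" "a \<in> S" "b \<in> S" "a \<noteq> b" by (rule edges_on_cases)
      then show ?thesis by (simp add: Int_absorb2)
    qed
    then show ?thesis by simp
  qed
  also have "\<dots> \<le> (\<Sum>e\<in>F. card (e \<inter> S))"
    using finF by (intro sum_mono2) auto
  also have "\<dots> = (\<Sum>i\<in>S. card (nb F i))"
    using sum_card_nb[OF F P S(1)] by simp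
  also have "\<dots> \<le> (\<Sum>i\<in>S. c)" using S deg by (intro sum_mono) auto
  finally show ?thesis by simp
qed

lemma nb_induced: "v \<in> P \<Longrightarrow> nb (E \<inter> edges_on P) v = nb E v \<inter> P - {v}"
  by (auto simp: nb_def)

section \<open>Consequences of one missing wanted edge\<close>

context deg_seq begin

text \<open>
  If neither \<open>X\<close> nor \<open>Y\<close> is a clique, a non-adjacent pair in each yields an exchange of three edges.
  If \<open>X\<close> is a clique, it forms a larger one with \<open>u\<close>, and every vertex of \<open>Y - X\<close> is adjacent to all of \<open>X\<close>.
\<close>

lemma maximal_clique_plus:
  assumes M: "maximal H E" and k: "4 \<le> k" and uv: "{u, v} \<in> H" "{u, v} \<notin> E" "u \<noteq> v"
    and X: "X \<subseteq> nb E u" "\<And>x. x \<in> X \<Longrightarrow> {u, x} \<notin> H" "k - 2 \<le> card X"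
    and Y: "Y \<subseteq> nb E v" "\<And>y. y \<in> Y \<Longrightarrow> {v, y} \<notin> H" "k - 2 \<le> card Y"
    and XY: "\<And>x y. x \<in> X \<Longrightarrow> y \<in> Y \<Longrightarrow> {x, y} \<notin> H"
  shows "clique_plus k E"
proof -
  note E = realizes_edges[OF maximal_realizes[OF M]]
  have S1: "x = y \<or> {x, y} \<in> E" if "x \<in> X" "y \<in> Y" for x y
    using maximal_two_swap[OF M uv, of x y] that X Y by (auto simp: nb_def)
  have "clique E X \<or> clique E Y"
  proof (rule ccontr)
    assume "\<not> ?thesis"
    then obtain x1 x2 y1 y2 where
      x: "x1 \<in> X" "x2 \<in> X" "x1 \<noteq> x2" "{x1, x2} \<notin> E" and
      y: "y1 \<in> Y" "y2 \<in> Y" "y1 \<noteq> y2" "{y1, y2} \<notin> E"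
      unfolding clique_def by blast
    have "{x2, y2} \<in> E" using S1[of x1 x2] S1[of x2 y2] x y by auto
    moreover have "{x2, y2} \<notin> H" using XY x y by auto
    ultimately show False
      using maximal_three_swap[OF M uv, of x1 y1 x2 y2] x y X Y by (auto simp: nb_def)
  qed
  then show ?thesis
  proof
    assume "clique E X"
    then show ?thesis
      using clique_plus_of_clique_nbhd[OF E k uv(2,3) X(1,3) _ Y(1,3)] S1 by blast
  next
    assume cl: "clique E Y"
    have "{v, u} \<notin> E" "v \<noteq> u" using uv by (auto simp: insert_commute)
    then show ?thesis
      using clique_plus_of_clique_nbhd[OF E k _ _ Y(1,3) cl X(1,3)] S1
      by (metis insert_commute)
  qed
qed

lemma deg_le_outside:
  assumes E: "realizes E" and u: "u < n" and S: "finite S" "nb E u \<inter> W \<subseteq> S"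
  shows "d u \<le> card (nb E u - W) + card S"
proof -
  have "d u = card (nb E u - W) + card (nb E u \<inter> W)"
    using realizes_deg[OF E u] realizes_finite_nb[OF E, of u]
    by (metis Un_Diff_Int card_Un_disjoint finite_Diff finite_Int Diff_Int_distrib2 Diff_disjoint
        Int_commute Int_Diff inf_bot_left)
  then show ?thesis using card_mono[OF S] by linarith
qed

lemma deg_le_outside_self:
  assumes "realizes E" "u < m" "m \<le> n"
  shows "d u \<le> card (nb E u - {..<m}) + (m - 1)"
proof -
  have "nb E u \<inter> {..<m} \<subseteq> {..<m} - {u}" using realizes_nb[OF assms(1), of u] by auto
  moreover have "card ({..<m} - {u}) = m - 1" using assms by simp
  ultimately show ?thesis using deg_le_outside[OF assms(1), of u "{..<m} - {u}" "{..<m}"] assms by simp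
qed

lemma deg_le_outside_missing:
  assumes "realizes E" "u < m" "v < m" "u \<noteq> v" "{u, v} \<notin> E" "m \<le> n"
  shows "d u \<le> card (nb E u - {..<m}) + (m - 2)"
proof -
  have "nb E u \<inter> {..<m} \<subseteq> {..<m} - {u, v}"
    using assms realizes_nb[OF assms(1), of u] by (auto simp: nb_def)
  moreover have "card ({..<m} - {u, v}) = m - 2" using assms by (simp add: card_Diff_subset)
  ultimately show ?thesis using deg_le_outside[OF assms(1), of u "{..<m} - {u, v}" "{..<m}"] assms by simp
qed

text \<open>2k - 4 = (k - 2) + (k - 2): an end of a missing edge has at most k - 2 neighbours among
  the first k vertices, hence at least k - 2 outside, as many as \<open>maximal_clique_plus\<close>
  asks for. Its main use is by contraposition, as the bound 2k - 5 on
  \<open>d (k - 1)\<close>.\<close>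

lemma clique_plus_of_high_degrees:
  assumes E: "realizes E\<^sub>0" and k: "4 \<le> k" "k \<le> n" and dk: "2 * k - 4 \<le> d (k - 1)"
  shows "\<exists>E. realizes E \<and> clique_plus k E"
proof -
  let ?H = "edges_on {..<k}"
  obtain E where M: "maximal ?H E" using maximal_exists[OF E] by blast
  note R = maximal_realizes[OF M]
  have "clique_plus k E"
  proof (cases "clique E {..<k}")
    case True
    then show ?thesis using k
      by (intro clique_plusI[of "{..<k - 1}" k E "k - 1" 0 1]) (auto simp: clique_def)
  next
    case False
    then obtain u v where uv: "u < k" "v < k" "u \<noteq> v" "{u, v} \<notin> E" by (auto simp: clique_def)
    have big: "k - 2 \<le> card (nb E a - {..<k})" if "a < k" "b < k" "a \<noteq> b" "{a, b} \<notin> E" for a b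
    proof -
      have "d a \<le> card (nb E a - {..<k}) + (k - 2)"
        by (rule deg_le_outside_missing[OF R that k(2)])
      moreover have "2 * k - 4 \<le> d a" using dk mono[of a "k - 1"] that k by linarith
      ultimately show ?thesis using k by linarith
    qed
    show ?thesis
      using big[of u v] big[of v u] uv
      by (intro maximal_clique_plus[OF M k(1), of u v "nb E u - {..<k}" "nb E v - {..<k}"])
         (auto simp: insert_commute)
  qed
  then show ?thesis using R by blast
qed

text \<open>No wanted edge lies inside \<open>P\<close>, so the exchange of three edges applies to
  every edge of \<open>E\<close> there. If \<open>x = y\<close>, the two orientations force each
  such edge to meet the neighbourhood of \<open>x\<close>, which accounts for the product in
  \<open>nbhd_bound\<close>.\<close>

lemma maximal_edge_bound:
  assumes M: "maximal H E" and uv: "{u, v} \<in> H" "{u, v} \<notin> E" "u \<noteq> v"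
    and ux: "{u, x} \<in> E" "{u, x} \<notin> H" and vy: "{v, y} \<in> E" "{v, y} \<notin> H"
    and P: "finite P" "x \<in> P" "y \<in> P" "edges_on P \<inter> H = {}"
    and deg: "\<And>z. z \<in> P \<Longrightarrow> card (nb E z \<inter> P) \<le> c"
    and a: "card (nb E x \<inter> P) \<le> a" and b: "card (nb E y \<inter> P) \<le> b"
    and a': "x = y \<Longrightarrow> card (nb E x \<inter> P) \<le> a'"
  shows "nbhd_bound a' a b c (card (E \<inter> edges_on P))"
proof -
  note R = maximal_realizes[OF M]
  define F where "F = E \<inter> edges_on P"
  have F: "F \<subseteq> edges_on P" by (simp add: F_def)
  have nbF: "nb F z = nb E z \<inter> P" if "z \<in> P" for z
    using nb_induced[OF that] realizes_nb[OF R, of z] by (auto simp: F_def)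
  have cover: "p \<in> insert x (nb F x) \<or> q \<in> insert y (nb F y)" if "{p, q} \<in> F" for p q
  proof -
    have e: "{p, q} \<in> edges_on P" "{p, q} \<in> E" using that by (auto simp: F_def)
    have "{p, q} \<notin> H" using e(1) P(4) by blast
    then have pq: "p \<in> P" "q \<in> P" "{p, q} \<in> E" "{p, q} \<notin> H"
      using e by auto
    show ?thesis
      using maximal_three_swap[OF M uv ux vy pq(3,4)] pq P(2,3)
      by (auto simp: nb_def F_def)
  qed
  show ?thesis
  proof (cases "x = y")
    case True
    have "e \<inter> nb F x \<noteq> {}" if "e \<in> F" for e
    proof -
      from that have "e \<in> edges_on P" using F by blast
      then obtain p q where pq: "e = {p, q}" "p \<noteq> q" by (rule edges_on_cases)
      then show ?thesis using cover[of p q] True that by (auto simp: nb_def insert_commute)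
    qed
    then have "F = {e \<in> F. e \<inter> nb F x \<noteq> {}}" by blast
    moreover have "nb F x \<subseteq> P" "finite (nb F x)" using nbF P by auto
    ultimately have "card F \<le> card (nb F x) * c"
      using card_edges_touching[OF F P(1), of "nb F x" c] deg nbF by auto
    also have "\<dots> \<le> a' * c" using a' True nbF P by simp
    finally show ?thesis by (simp add: F_def nbhd_bound_def)
  next
    case False
    then have "{x, y} \<in> F"
      using maximal_two_swap[OF M uv ux vy] P by (auto simp: F_def)
    then show ?thesis
      using card_edges_within_closed_nbhds[OF F P(1), of x y c a b] deg a b cover nbF P
      by (simp add: F_def nbhd_bound_def)
  qed
qed

lemma sum_degrees: "realizes E \<Longrightarrow> (\<Sum>i<n. d i) = 2 * card E"
proof -
  assume E: "realizes E"
  have "card (e \<inter> {..<n}) = 2" if "e \<in> E" for e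
  proof -
    from that have "e \<in> edges_on {..<n}" using realizes_edges[OF E] by blast
    then obtain a b where "e = {a, b}" "a \<in> {..<n}" "b \<in> {..<n}" "a \<noteq> b" by (rule edges_on_cases)
    then show ?thesis by (simp add: Int_absorb2)
  qed
  then show ?thesis
    using sum_card_nb[OF realizes_edges[OF E], of "{..<n}"] realizes_deg[OF E] by simp
qed

text \<open>An edge adds 0, 1 or 2 to the degree sum over \<open>W\<close>. Counting the edges that
  avoid \<open>W\<close> once more lifts 0 to 1, so only the edges inside \<open>W\<close> exceed 1.
  In the counts below, a wanted edge that is present thus pays for one unit of degree.\<close>

lemma sum_degrees_split:
  assumes E: "realizes E" and W: "W \<subseteq> {..<n}"
  shows "(\<Sum>i\<in>W. d i) + card (E \<inter> edges_on ({..<n} - W)) = card E + card (E \<inter> edges_on W)"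
proof -
  have W': "finite W" using W finite_subset by blast
  have fE: "finite E" by (rule realizes_finite[OF E])
  have "(\<Sum>i\<in>W. d i) = (\<Sum>i\<in>W. card (nb E i))"
    using realizes_deg[OF E] W by (intro sum.cong) auto
  also have "\<dots> = (\<Sum>e\<in>E. card (e \<inter> W))"
    by (rule sum_card_nb[OF realizes_edges[OF E] _ W']) simp
  finally have 1: "(\<Sum>i\<in>W. d i) = (\<Sum>e\<in>E. card (e \<inter> W))" .
  have card: "card (E \<inter> S) = (\<Sum>e\<in>E. of_bool (e \<in> S))" for S
    using fE sum_of_bool_eq_card[of E "\<lambda>e. e \<in> S"] by (simp add: Int_def)
  have "(\<Sum>e\<in>E. card (e \<inter> W) + of_bool (e \<in> edges_on ({..<n} - W))) =
      (\<Sum>e\<in>E. 1 + of_bool (e \<in> edges_on W))"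
  proof (rule sum.cong[OF refl])
    fix e assume "e \<in> E"
    then have "e \<in> edges_on {..<n}" using realizes_edges[OF E] by blast
    then obtain a b where ab: "e = {a, b}" "a \<in> {..<n}" "b \<in> {..<n}" "a \<noteq> b" by (rule edges_on_cases)
    show "card (e \<inter> W) + of_bool (e \<in> edges_on ({..<n} - W)) = 1 + of_bool (e \<in> edges_on W)"
      using ab by (cases "a \<in> W"; cases "b \<in> W") (auto simp: Int_insert_left)
  qed
  then show ?thesis
    unfolding 1 card sum.distrib by simp
qed

text \<open>The edges leaving the first k - 1 vertices are paid for by the small degrees at their
  other ends. For k = 3, 5, 7 and m = (k - 1)/2 the right-hand side is exactly (k - 1)(n - 1), so a
  larger degree sum gives \<open>d (k - 1)\<close> at least (k + 1)/2.\<close>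

lemma sum_degrees_le:
  assumes E: "realizes E" and k: "1 \<le> k" "k \<le> n" and dk: "d (k - 1) \<le> m"
  shows "(\<Sum>i<n. d i) \<le> (k - 1) * (k - 2) + 2 * m * (n - (k - 1))"
proof -
  let ?W = "{..<k - 1}" and ?P = "{k - 1..<n}"
  have un: "{..<n} = ?W \<union> ?P" "?W \<inter> ?P = {}" "{..<n} - ?W = ?P" using k by auto
  have sP: "(\<Sum>i\<in>?P. d i) \<le> m * (n - (k - 1))"
  proof -
    have "(\<Sum>i\<in>?P. d i) \<le> (\<Sum>i\<in>?P. m)"
      by (rule sum_mono) (use mono[of "k - 1"] dk in \<open>auto intro: le_trans\<close>)
    then show ?thesis by (simp add: mult.commute)
  qed
  have "(\<Sum>i<n. d i) = (\<Sum>i\<in>?W. d i) + (\<Sum>i\<in>?P. d i)"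
    unfolding un(1) using un(2) by (intro sum.union_disjoint) auto
  moreover have "2 * card (E \<inter> edges_on ?W) \<le> (k - 1) * (k - 2)"
  proof -
    have "card (E \<inter> edges_on ?W) \<le> card (edges_on ?W)"
      by (intro card_mono finite_edges_on) auto
    also have "\<dots> = (k - 1) * (k - 2) div 2"
      by (simp only: card_edges_on finite_lessThan card_lessThan choose_two diff_diff_left one_add_one)
    finally show ?thesis by linarith
  qed
  moreover have "(\<Sum>i\<in>?W. d i) \<le> (\<Sum>i\<in>?P. d i) + 2 * card (E \<inter> edges_on ?W)"
  proof -
    have "(\<Sum>i\<in>?W. d i) + card (E \<inter> edges_on ?P) = card E + card (E \<inter> edges_on ?W)"
      using sum_degrees_split[OF E, of ?W] un(3) k(2) by simp
    moreover have "(\<Sum>i\<in>?P. d i) + card (E \<inter> edges_on ?W) = card E + card (E \<inter> edges_on ?P)"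
    proof -
      have "{..<n} - ?P = ?W" "?P \<subseteq> {..<n}" using k by auto
      then show ?thesis using sum_degrees_split[OF E, of ?P] by simp
    qed
    ultimately show ?thesis by linarith
  qed
  moreover have "2 * m * (n - (k - 1)) = 2 * (m * (n - (k - 1)))" by simp
  ultimately show ?thesis using sP by linarith
qed

lemma card_nb_remove:
  assumes "realizes E" "z < n" "{a, z} \<in> E"
  shows "card (nb E z - {a}) = d z - 1"
proof -
  have "a \<in> nb E z" using assms(3) by (simp add: nb_def insert_commute)
  then show ?thesis using realizes_deg[OF assms(1,2)] by (simp add: card_Diff_singleton)
qed

lemma deg_le: "realizes E \<Longrightarrow> i < n \<Longrightarrow> d i \<le> n - 1"
  using card_mono[OF _ realizes_nb[of E i]] realizes_deg[of E i] by simp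

section \<open>A clique with one more vertex, when few degrees are large\<close>

text \<open>Each end of the missing edge has at most k - 3 neighbours in the block, so a degree
  above 2k - 6 means k - 2 outer neighbours; at both ends this would give
  \<open>clique_plus\<close>. As the degrees are sorted, every vertex behind the block then has
  degree at most 2k - 6.\<close>

lemma missing_clique_edge:
  assumes M: "maximal (edges_on {..<k - 1}) E" and k: "4 \<le> k" "k \<le> n" and dk: "k - 2 \<le> d (k - 2)"
    and no: "\<not> clique_plus k E" and uv: "u < k - 1" "v < k - 1" "u \<noteq> v" "{u, v} \<notin> E"
  shows "d u \<le> 2 * k - 6 \<or> d v \<le> 2 * k - 6"
    and "d u \<le> 3 * k - 9"
    and "nbhd_bound (2 * k - 8) (2 * k - 7) (2 * k - 7) (2 * k - 6) (card (E \<inter> edges_on {k - 1..<n}))"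
proof -
  note R = maximal_realizes[OF M]
  let ?H = "edges_on {..<k - 1}" and ?P = "{k - 1..<n}"
  define X where "X a = nb E a - {..<k - 1}" for a
  have vu: "{v, u} \<notin> E" using uv(4) by (simp add: insert_commute)
  have X: "d a \<le> card (X a) + (k - 3)" if "a < k - 1" "b < k - 1" "a \<noteq> b" "{a, b} \<notin> E" for a b
  proof -
    have "d a \<le> card (X a) + (k - 1 - 2)"
      unfolding X_def by (rule deg_le_outside_missing[OF R that]) (use k in simp)
    then show ?thesis by simp
  qed
  note Xu = X[OF uv] and Xv = X[OF uv(2,1) uv(3)[symmetric] vu]
  have dge: "k - 2 \<le> d a" if "a < k - 1" for a
    using dk mono[of a "k - 2"] that k by linarith
  have Xsub: "x \<in> X a \<Longrightarrow> {a, x} \<in> E \<and> {a, x} \<notin> ?H \<and> x \<in> ?P" for a x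
    using realizes_nb[OF R, of a] by (auto simp: X_def nb_def)
  have "card (X u) \<noteq> 0" "card (X v) \<noteq> 0" using Xu Xv dge[OF uv(1)] dge[OF uv(2)] k by linarith+
  then obtain x y where xy: "x \<in> X u" "y \<in> X v" by (metis card.empty ex_in_conv)
  show small: "d u \<le> 2 * k - 6 \<or> d v \<le> 2 * k - 6"
  proof (rule ccontr)
    assume neg: "\<not> ?thesis"
    then have "k - 2 \<le> card (X u)" "k - 2 \<le> card (X v)" using Xu Xv k by linarith+
    moreover have "X u \<subseteq> nb E u" "X v \<subseteq> nb E v" by (auto simp: X_def)
    moreover have "{u, v} \<in> ?H" using uv by simp
    moreover have "{x, y} \<notin> ?H" if "x \<in> X u" for x y using Xsub[OF that] by simp
    ultimately have "clique_plus k E"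
      using Xsub by (intro maximal_clique_plus[OF M k(1) _ uv(4,3), of "X u" "X v"]) blast+
    then show False using no by simp
  qed
  have dP: "d z \<le> 2 * k - 6" if "z \<in> ?P" for z
    using small mono[of u z] mono[of v z] that uv by auto
  have y: "y \<in> ?P" "{v, y} \<in> E" "{v, y} \<notin> ?H" and x: "x \<in> ?P" "{u, x} \<in> E" "{u, x} \<notin> ?H"
    using Xsub xy by auto
  have cy: "card (nb E y - {v}) = d y - 1" and cx: "card (nb E x - {u}) = d x - 1"
    using y x card_nb_remove[OF R] by auto
  have dy: "d y \<ge> 1"
    using realizes_deg[OF R, of y] y realizes_finite_nb[OF R, of y]
    by (metis One_nat_def Suc_leI atLeastLessThan_iff card_gt_0_iff empty_iff in_nb_iff insert_commute)
  \<comment> \<open>All outer neighbours of \<open>u\<close> lie in the closed neighbourhood of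
    \<open>y\<close> without \<open>v\<close>. This has \<open>d y\<close> elements, and 3k - 9 =
    (2k - 6) + (k - 3).\<close>
  have "X u \<subseteq> insert y (nb E y - {v})"
  proof
    fix z assume "z \<in> X u"
    then show "z \<in> insert y (nb E y - {v})"
      using maximal_two_swap[OF M _ uv(4,3), of z y] Xsub[of z u] y uv
      by (auto simp: nb_def insert_commute)
  qed
  then have "card (X u) \<le> card (insert y (nb E y - {v}))"
    using realizes_finite_nb[OF R] by (intro card_mono) auto
  also have "\<dots> \<le> Suc (card (nb E y - {v}))"
    using realizes_finite_nb[OF R] by (simp add: card_insert_if)
  finally have "card (X u) \<le> d y" using cy dy by simp
  then show "d u \<le> 3 * k - 9" using Xu dP[OF y(1)] k by linarith
  have deg: "card (nb E z \<inter> ?P) \<le> 2 * k - 6" if "z \<in> ?P" for z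
    using dP[OF that] realizes_deg[OF R, of z] that card_mono[of "nb E z" "nb E z \<inter> ?P"]
      realizes_finite_nb[OF R] by auto
  \<comment> \<open>Inside the outer set \<open>x\<close> loses its neighbour \<open>u\<close> and
    \<open>y\<close> loses \<open>v\<close>; if they coincide, both are lost. Hence 2k - 7 and 2k -
    8.\<close>
  have a: "card (nb E x \<inter> ?P) \<le> 2 * k - 7"
    using card_mono[of "nb E x - {u}" "nb E x \<inter> ?P"] cx dP[OF x(1)] realizes_finite_nb[OF R] uv
    by fastforce
  have b: "card (nb E y \<inter> ?P) \<le> 2 * k - 7"
    using card_mono[of "nb E y - {v}" "nb E y \<inter> ?P"] cy dP[OF y(1)] realizes_finite_nb[OF R] uv
    by fastforce
  have a': "card (nb E x \<inter> ?P) \<le> 2 * k - 8" if "x = y"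
  proof -
    have "card (nb E x - {u} - {v}) = d x - 1 - 1"
      using cx that y(2) uv(3) realizes_finite_nb[OF R]
      by (subst card_Diff_singleton) (auto simp: in_nb_iff insert_commute)
    moreover have "card (nb E x \<inter> ?P) \<le> card (nb E x - {u} - {v})"
      using realizes_finite_nb[OF R] uv by (intro card_mono) auto
    ultimately show ?thesis using dP[OF x(1)] by linarith
  qed
  have disj: "edges_on ?P \<inter> ?H = {}" by (auto simp: edges_on_def doubleton_eq_iff)
  have "{u, v} \<in> ?H" using uv by simp
  then show "nbhd_bound (2 * k - 8) (2 * k - 7) (2 * k - 7) (2 * k - 6) (card (E \<inter> edges_on ?P))"
    using maximal_edge_bound[OF M _ uv(4,3) x(2,3) y(2,3) _ x(1) y(1) disj deg a b a'] by simp
qed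

text \<open>By \<open>one\<close> the outer neighbourhoods of the clique vertices are disjoint, so
  at most \<open>n - m\<close> edges cross. When m = k - 1, \<open>one\<close> holds as soon as
  \<open>clique_plus\<close> fails, since an outer vertex with two neighbours in the clique would
  complete it.\<close>

lemma edges_outside_clique:
  assumes E: "realizes E" and W: "m \<le> n" "clique E {..<m}"
    and one: "\<And>z. z \<in> {m..<n} \<Longrightarrow> card (nb E z \<inter> {..<m}) \<le> 1"
  shows "card E \<le> card (E \<inter> edges_on {m..<n}) + (m choose 2) + (n - m)"
    and "(\<Sum>i<m. d i) \<le> m * (m - 1) + (n - m)"
proof -
  note fin = realizes_finite_nb[OF E]
  have dis: "nb E i \<inter> {m..<n} \<inter> (nb E j \<inter> {m..<n}) = {}" if "i < m" "j < m" "i \<noteq> j" for i j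
  proof -
    have False if z: "z \<in> nb E i" "z \<in> nb E j" "z \<in> {m..<n}" for z
    proof -
      have "i \<in> nb E z" "j \<in> nb E z"
        using z(1,2) by (simp_all only: nb_sym[of i E z] nb_sym[of j E z])
      then have "card {i, j} \<le> card (nb E z \<inter> {..<m})"
        using \<open>i < m\<close> \<open>j < m\<close> fin by (intro card_mono) auto
      then show False using one[OF z(3)] \<open>i \<noteq> j\<close> by simp
    qed
    then show ?thesis by blast
  qed
  have "(\<Sum>i<m. card (nb E i \<inter> {m..<n})) = card (\<Union>i<m. nb E i \<inter> {m..<n})"
    using dis fin by (intro card_UN_disjoint[symmetric]) auto
  also have "\<dots> \<le> card {m..<n}" by (intro card_mono) auto
  finally have 1: "(\<Sum>i<m. card (nb E i \<inter> {m..<n})) \<le> n - m" by simp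
  have 2: "d i = (m - 1) + card (nb E i \<inter> {m..<n})" if "i < m" for i
  proof -
    have "nb E i = ({..<m} - {i}) \<union> (nb E i \<inter> {m..<n})"
      using W that realizes_nb[OF E, of i] by (auto simp: clique_def nb_def)
    moreover have "card (({..<m} - {i}) \<union> (nb E i \<inter> {m..<n})) = card ({..<m} - {i}) + card (nb E i \<inter> {m..<n})"
      using fin by (intro card_Un_disjoint) auto
    ultimately have "card (nb E i) = card ({..<m} - {i}) + card (nb E i \<inter> {m..<n})" by metis
    then show ?thesis using realizes_deg[OF E, of i] that W(1) by simp
  qed
  have "(\<Sum>i<m. d i) = (\<Sum>i<m. (m - 1) + card (nb E i \<inter> {m..<n}))"
    using 2 by (intro sum.cong) auto
  also have "\<dots> = m * (m - 1) + (\<Sum>i<m. card (nb E i \<inter> {m..<n}))"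
    by (simp only: sum.distrib sum_constant card_lessThan of_nat_id)
  finally have 3: "(\<Sum>i<m. d i) = m * (m - 1) + (\<Sum>i<m. card (nb E i \<inter> {m..<n}))" .
  then show s: "(\<Sum>i<m. d i) \<le> m * (m - 1) + (n - m)" using 1 by simp
  have "E \<inter> edges_on {..<m} = edges_on {..<m}"
    using W(2) by (auto simp: clique_def edges_on_def)
  then have e: "card (E \<inter> edges_on {..<m}) = m choose 2" by (simp add: card_edges_on)
  have "{..<m} \<subseteq> {..<n}" "{..<n} - {..<m} = {m..<n}" using W(1) by auto
  then have "(\<Sum>i<m. d i) + card (E \<inter> edges_on {m..<n}) = card E + (m choose 2)"
    using sum_degrees_split[OF E, of "{..<m}"] e by simp
  moreover have "m * (m - 1) = 2 * (m choose 2)" 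
  proof -
    have "even (m * (m - 1))" by (cases m) auto
    then show ?thesis by (simp add: choose_two)
  qed
  ultimately show "card E \<le> card (E \<inter> edges_on {m..<n}) + (m choose 2) + (n - m)"
    using s by linarith
qed

text \<open>Only the edges from 0 and 1 to \<open>k - 1\<close> are still wanted, and one of them is
  missing. In the outer set \<open>x\<close> loses its neighbour \<open>u\<close>, but the other end
  \<open>k - 1\<close> of the missing edge belongs to the outer set, so \<open>y\<close> need not
  lose a neighbour. Hence the asymmetric parameters.\<close>

lemma clique_extend:
  assumes E\<^sub>0: "realizes E\<^sub>0" "clique E\<^sub>0 {..<k - 1}" and k: "4 \<le> k" "k \<le> n"
    and d1: "k - 1 \<le> d 1" and dk: "3 \<le> d (k - 1)"
    and no: "\<And>E. realizes E \<Longrightarrow> \<not> clique_plus k E"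
  shows "\<exists>e. card E\<^sub>0 \<le> e + ((k - 1) choose 2) + (n - (k - 1)) \<and>
    nbhd_bound (2 * k - 6) (2 * k - 6) (2 * k - 5) (2 * k - 5) e"
proof -
  let ?t = "k - 1" and ?W = "{..<k - 1}" and ?P = "{k - 1..<n}"
  let ?H = "edges_on ?W \<union> {{0, ?t}, {1, ?t}}"
  obtain E where M: "maximal ?H E" and sub: "E\<^sub>0 \<inter> ?H \<subseteq> E"
    using maximal_exists[OF E\<^sub>0(1)] by blast
  note R = maximal_realizes[OF M] and fin = realizes_finite_nb[OF maximal_realizes[OF M]]
  have cl: "clique E ?W"
    using E\<^sub>0(2) sub unfolding clique_def by auto
  have one: "card (nb E z \<inter> ?W) \<le> 1" if z: "z \<in> ?P" for z
  proof (rule ccontr)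
    assume "\<not> ?thesis"
    then obtain a b where "a \<in> nb E z \<inter> ?W" "b \<in> nb E z \<inter> ?W" "a \<noteq> b"
      by (metis One_nat_def card_le_Suc0_iff_eq fin finite_Int)
    then have "clique_plus k E"
      using z cl by (intro clique_plusI[of ?W k E z a b]) (auto simp: nb_def)
    then show False using no R by blast
  qed
  have "card E = card E\<^sub>0"
    using sum_degrees[OF R] sum_degrees[OF E\<^sub>0(1)] by simp
  then have e1: "card E\<^sub>0 \<le> card (E \<inter> edges_on ?P) + ((k - 1) choose 2) + (n - (k - 1))"
    using edges_outside_clique(1)[OF R _ cl one] k by simp
  have tP: "?t \<in> ?P" using k by simp
  have "\<not> {0, 1} \<subseteq> nb E ?t \<inter> ?W"
    using one[OF tP] card_mono[of "nb E ?t \<inter> ?W" "{0, 1}"] fin by fastforce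
  then have "{0, ?t} \<notin> E \<or> {1, ?t} \<notin> E"
    using k by (auto simp: nb_def insert_commute)
  then obtain u :: nat where u: "u < 2" "{u, ?t} \<notin> E"
    using that[of 0] that[of 1] by auto
  have uW: "u < k - 1" "u \<noteq> ?t" using u k by auto
  have uH: "{u, ?t} \<in> ?H" using u by (auto simp: less_2_cases_iff)
  have "d u \<ge> k - 1" using d1 mono[of u 1] u k by linarith
  moreover have "d u \<le> card (nb E u - ?W) + (k - 1 - 1)"
    by (rule deg_le_outside_self[OF R uW(1)]) (use k in simp)
  ultimately have "card (nb E u - ?W) \<noteq> 0" using k by linarith
  then obtain x where "x \<in> nb E u - ?W" by (metis card.empty ex_in_conv)
  then have x: "{u, x} \<in> E" "{u, x} \<notin> ?H" "x \<in> ?P"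
    using u(2) uW realizes_nb[OF R, of u] by (auto simp: nb_def doubleton_eq_iff)
  have "d ?t \<le> card (nb E ?t - ?W) + card (nb E ?t \<inter> ?W)"
    using k fin by (intro deg_le_outside[OF R]) auto
  then have "card (nb E ?t - ?W) \<noteq> 0" using dk one[OF tP] by linarith
  then obtain y where "y \<in> nb E ?t - ?W" by (metis card.empty ex_in_conv)
  then have y: "{?t, y} \<in> E" "{?t, y} \<notin> ?H" "y \<in> ?P"
    using k realizes_nb[OF R, of ?t] by (auto simp: nb_def doubleton_eq_iff)
  have dt: "d ?t \<le> 2 * k - 5"
  proof (rule ccontr)
    assume "\<not> ?thesis"
    then have "2 * k - 4 \<le> d ?t" by linarith
    then show False using clique_plus_of_high_degrees[OF E\<^sub>0(1) k] no by blast
  qed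
  have dP: "d z \<le> 2 * k - 5" if "z \<in> ?P" for z
    using dt mono[of ?t z] that by auto
  have deg: "card (nb E z \<inter> ?P) \<le> 2 * k - 5" if "z \<in> ?P" for z
    using dP[OF that] realizes_deg[OF R, of z] that card_mono[of "nb E z" "nb E z \<inter> ?P"]
      fin by auto
  have "card (nb E x - {u}) = d x - 1"
    using x card_nb_remove[OF R] by auto
  then have a: "card (nb E x \<inter> ?P) \<le> 2 * k - 6"
    using card_mono[of "nb E x - {u}" "nb E x \<inter> ?P"] dP[OF x(3)] fin uW
    by fastforce
  have disj: "edges_on ?P \<inter> ?H = {}" using k by (auto simp: edges_on_def doubleton_eq_iff)
  have "nbhd_bound (2 * k - 6) (2 * k - 6) (2 * k - 5) (2 * k - 5) (card (E \<inter> edges_on ?P))"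
    using maximal_edge_bound[OF M uH u(2) uW(2) x(1,2) y(1,2) _ x(3) y(3) disj deg a deg[OF y(3)] a]
    by simp
  then show ?thesis using e1 by blast
qed

text \<open>If \<open>d 1 \<le> k - 2\<close>, the sum is at most (n - 1) + (k - 2)(n - 1), the
  degree sum of the windmill sequence. The strict inequality is used in full.\<close>

lemma second_degree_ge:
  assumes E: "realizes E" and n: "2 \<le> n" and s: "(k - 1) * (n - 1) < (\<Sum>i<n. d i)"
  shows "k - 1 \<le> d 1"
proof (rule ccontr)
  assume neg: "\<not> ?thesis"
  have "(\<Sum>i<n. d i) = d 0 + (\<Sum>i\<in>{1..<n}. d i)"
    using n by (simp add: sum.atLeast_Suc_lessThan lessThan_atLeast0)
  also have "(\<Sum>i\<in>{1..<n}. d i) \<le> (\<Sum>i\<in>{1..<n}. k - 2)"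
  proof (rule sum_mono)
    fix i assume "i \<in> {1..<n}"
    then show "d i \<le> k - 2" using mono[of 1 i] neg by auto
  qed
  also have "\<dots> = (k - 2) * (n - 1)" by simp
  also have "d 0 \<le> n - 1" using deg_le[OF E, of 0] n by simp
  finally have "(\<Sum>i<n. d i) \<le> (n - 1) + (k - 2) * (n - 1)" by simp
  also have "\<dots> = (1 + (k - 2)) * (n - 1)" by (simp add: algebra_simps)
  also have "\<dots> = (k - 1) * (n - 1)" using neg by (cases k) auto
  finally show False using s by simp
qed

section \<open>Edge counts for k = 5 and k = 7 with bounded second or third degree\<close>

lemma card_ge_of_clique:
  assumes E: "realizes E" and c: "clique E {..<j}" and j: "j \<le> m"
  shows "j choose 2 \<le> card (E \<inter> edges_on {..<m})"
proof -
  have "edges_on {..<j} \<subseteq> E \<inter> edges_on {..<m}"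
    using c j edges_on_mono[of "{..<j}" "{..<m}"] by (auto simp: clique_def elim!: edges_on_cases)
  then have "card (edges_on {..<j}) \<le> card (E \<inter> edges_on {..<m})"
    using realizes_finite[OF E] by (intro card_mono) auto
  then show ?thesis by (simp add: card_edges_on)
qed

lemma missing_pair_less:
  assumes "\<not> clique E {..<m::nat}"
  obtains u v where "u < v" "v < m" "{u, v} \<notin> E"
proof -
  obtain u v where uv: "u < m" "v < m" "u \<noteq> v" "{u, v} \<notin> E"
    using assms by (auto simp: clique_def)
  then show ?thesis using that[of u v] that[of v u] by (cases "u < v") (auto simp: insert_commute)
qed

text \<open>Only \<open>d 0\<close> may be as large as \<open>n - 1\<close>. Beyond the wanted edges
  present, \<open>d 1 + d 2\<close> contributes at most 9 and \<open>d 3\<close> at most 4, and at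
  most 9 edges lie outside. This leaves at most n + 21 edges where 2n - 1 are required.\<close>

lemma clique_4_step:
  assumes E\<^sub>0: "realizes E\<^sub>0" and n: "24 \<le> n" and s: "4 * (n - 1) < (\<Sum>i<n. d i)"
    and d1: "d 1 \<le> 8" and d3: "3 \<le> d 3"
    and no: "\<And>E. realizes E \<Longrightarrow> \<not> clique_plus 5 E"
  shows "\<exists>E. realizes E \<and> clique E {..<4}"
proof -
  obtain E where M: "maximal (edges_on {..<4}) E" using maximal_exists[OF E\<^sub>0] by blast
  note R = maximal_realizes[OF M]
  have "clique E {..<4}"
  proof (rule ccontr)
    assume "\<not> ?thesis"
    then obtain u v where uv: "u < v" "v < 4" "{u, v} \<notin> E" by (rule missing_pair_less)
    note miss = missing_clique_edge[of 5 E, simplified, OF M _ d3 no[OF R]]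
    have 5: "5 \<le> n" using n by simp
    have m1: "d a \<le> 4 \<or> d b \<le> 4" "d a \<le> 6" if "a < 4" "b < 4" "a \<noteq> b" "{a, b} \<notin> E" for a b
      using miss(1,2)[OF 5 that] by auto
    \<comment> \<open>The case \<open>x = y\<close> gives 8. Otherwise the maximum 9 is taken at q =
      4, where the two closed neighbourhoods coincide.\<close>
    have b: "nbhd_bound 2 3 3 4 (card (E \<inter> edges_on {4..<n}))"
      using miss(3)[OF 5, of u v] uv by simp
    then have "card (E \<inter> edges_on {4..<n}) \<le> 9"
    proof -
      have "q = 2 \<or> q = 3 \<or> q = 4" if "q \<ge> 2" "q \<le> 4" for q :: nat using that by auto
      then show ?thesis using b unfolding nbhd_bound_def
        by (fastforce simp: choose_two)
    qed
    moreover have "(\<Sum>i<4. d i) + card (E \<inter> edges_on {4..<n}) = card E + card (E \<inter> edges_on {..<4})"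
    proof -
      have "{..<4} \<subseteq> {..<n}" "{..<n} - {..<4} = {4..<n}" using n by auto
      then show ?thesis using sum_degrees_split[OF R, of "{..<4}"] by simp
    qed
    moreover have "(\<Sum>i<4. d i) = d 0 + d 1 + d 2 + d 3" by (simp add: eval_nat_numeral)
    moreover have "d 0 \<le> n - 1" using deg_le[OF R, of 0] n by simp
    moreover have "d 2 \<le> 6" using m1(2)[of u v] mono[of u 2] uv n by auto
    moreover have "d 3 \<le> 4" using m1(1)[of u v] mono[of u 3] mono[of v 3] uv n by auto
    moreover have "4 * (n - 1) < 2 * card E" using s sum_degrees[OF R] by simp
    moreover have "d 1 + d 2 \<le> 9 + card (E \<inter> edges_on {..<4})"
    proof -
      consider "d 1 \<ge> 7" | "d 1 \<le> 6" "d 2 \<ge> 5" | "d 1 \<le> 6" "d 2 \<le> 4" by linarith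
      then show ?thesis
      proof cases
        case 1
        \<comment> \<open>The ends of a missing pair have degree at most 6, so only
          \<open>{2, 3}\<close> can be missing. Five edges are present, which exactly balances 8 + 6
          = 9 + 5.\<close>
        have "edges_on {..<4} - {{2, 3::nat}} \<subseteq> E \<inter> edges_on {..<4}"
        proof
          fix e assume e: "e \<in> edges_on {..<4} - {{2, 3::nat}}"
          then have "e \<in> edges_on {..<4}" by simp
          then obtain a b where ab: "e = {a, b}" "a \<in> {..<4}" "b \<in> {..<4}" "a \<noteq> b"
            by (rule edges_on_cases)
          have "e \<in> E"
          proof (rule ccontr)
            assume "e \<notin> E"
            then have "d a \<le> 6" "d b \<le> 6"
              using m1(2)[of a b] m1(2)[of b a] ab by (auto simp: insert_commute)
            then have "1 < a" "1 < b" using 1 mono[of a 1] mono[of b 1] n by linarith+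
            then have "(a = 2 \<and> b = 3) \<or> (a = 3 \<and> b = 2)" using ab by auto
            then show False using e ab by (auto simp: insert_commute)
          qed
          then show "e \<in> E \<inter> edges_on {..<4}" using e by simp
        qed
        then have "card (edges_on {..<4} - {{2, 3::nat}}) \<le> card (E \<inter> edges_on {..<4})"
          using realizes_finite[OF R] by (intro card_mono) auto
        moreover have "card (edges_on {..<4} - {{2, 3::nat}}) = 5"
          by (subst card_Diff_singleton) (auto simp: card_edges_on choose_two)
        ultimately show ?thesis using d1 \<open>d 2 \<le> 6\<close> by linarith
      next
        case 2
        have "clique E {..<3}"
          unfolding clique_def
        proof (intro ballI impI)
          fix a b :: nat assume ab: "a \<in> {..<3}" "b \<in> {..<3}" "a \<noteq> b"
          show "{a, b} \<in> E"
            using m1(1)[of a b] mono[of a 2] mono[of b 2] 2 ab n by fastforce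
        qed
        then show ?thesis using card_ge_of_clique[OF R, of 3 4] 2 d1 \<open>d 2 \<le> 6\<close> by (simp add: choose_two)
      next
        case 3
        show ?thesis
        proof (cases "d 2 \<le> 3")
          case True
          then show ?thesis using 3 by simp
        next
          case False
          \<comment> \<open>Without any wanted edge also \<open>d 0 \<le> 6\<close>, and the first
            four degrees sum to at most 20, far too little for the required number of edges.\<close>
          have "\<not> E \<inter> edges_on {..<4} = {}"
          proof
            assume "E \<inter> edges_on {..<4} = {}"
            then have "{0, 1} \<notin> E" using edges_on_iff[of 0 1 "{..<4}"]
              by (metis IntI empty_iff lessThan_iff one_less_numeral_iff semiring_norm(76) zero_less_numeral zero_neq_one)
            then have "d 0 \<le> 6" using m1(2)[of 0 1] by simp
            then have "(\<Sum>i<4. d i) \<le> 20" using 3 \<open>d 3 \<le> 4\<close> by (simp add: eval_nat_numeral)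
            then show False using \<open>card (E \<inter> edges_on {4..<n}) \<le> 9\<close> n
              \<open>(\<Sum>i<4. d i) + card (E \<inter> edges_on {4..<n}) = card E + card (E \<inter> edges_on {..<4})\<close>
              \<open>4 * (n - 1) < 2 * card E\<close> by linarith
          qed
          then have "card (E \<inter> edges_on {..<4}) \<noteq> 0" using realizes_finite[OF R] by simp
          then show ?thesis using 3 by linarith
        qed
      qed
    qed
    ultimately show False using n by linarith
  qed
  then show ?thesis using R by blast
qed

text \<open>Now \<open>d 0\<close> and \<open>d 1\<close> may both be \<open>n - 1\<close>. Beyond
  the wanted edges present the next four degrees contribute at most 35 + 8, and at most 49 edges lie
  outside: at most 2n + 90 edges, whereas 3n - 2 are required. The contradiction starts exactly at n
  = 93.\<close>

lemma clique_6_step: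
  assumes E\<^sub>0: "realizes E\<^sub>0" and n: "93 \<le> n" and s: "6 * (n - 1) < (\<Sum>i<n. d i)"
    and d2: "d 2 \<le> 14" and d5: "5 \<le> d 5"
    and no: "\<And>E. realizes E \<Longrightarrow> \<not> clique_plus 7 E"
  shows "\<exists>E. realizes E \<and> clique E {..<6}"
proof -
  obtain E where M: "maximal (edges_on {..<6}) E" using maximal_exists[OF E\<^sub>0] by blast
  note R = maximal_realizes[OF M]
  have "clique E {..<6}"
  proof (rule ccontr)
    assume "\<not> ?thesis"
    then obtain u v where uv: "u < v" "v < 6" "{u, v} \<notin> E" by (rule missing_pair_less)
    note miss = missing_clique_edge[of 7 E, simplified, OF M _ d5 no[OF R]]
    have 7: "7 \<le> n" using n by simp
    have m1: "d a \<le> 8 \<or> d b \<le> 8" "d a \<le> 12" if "a < 6" "b < 6" "a \<noteq> b" "{a, b} \<notin> E" for a b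
      using miss(1,2)[OF 7 that] by auto
    have b: "nbhd_bound 6 7 7 8 (card (E \<inter> edges_on {6..<n}))"
      using miss(3)[OF 7, of u v] uv by simp
    then have "card (E \<inter> edges_on {6..<n}) \<le> 49"
    proof -
      have "q = 2 \<or> q = 3 \<or> q = 4 \<or> q = 5 \<or> q = 6 \<or> q = 7 \<or> q = 8" if "q \<ge> 2" "q \<le> 8" for q :: nat
        using that by auto
      then show ?thesis using b unfolding nbhd_bound_def
        by (fastforce simp: choose_two)
    qed
    moreover have "(\<Sum>i<6. d i) + card (E \<inter> edges_on {6..<n}) = card E + card (E \<inter> edges_on {..<6})"
    proof -
      have "{..<6} \<subseteq> {..<n}" "{..<n} - {..<6} = {6..<n}" using n by auto
      then show ?thesis using sum_degrees_split[OF R, of "{..<6}"] by simp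
    qed
    moreover have "(\<Sum>i<6. d i) = d 0 + d 1 + d 2 + d 3 + d 4 + d 5" by (simp add: eval_nat_numeral)
    moreover have "d 0 \<le> n - 1" "d 1 \<le> n - 1" using deg_le[OF R] n by simp_all
    moreover have "d 4 \<le> 12" using m1(2)[of u v] mono[of u 4] uv n by auto
    moreover have "d 5 \<le> 8" using m1(1)[of u v] mono[of u 5] mono[of v 5] uv n by auto
    moreover have "d 3 \<le> d 2" "d 4 \<le> d 3" using mono[of 2 3] mono[of 3 4] n by auto
    moreover have "6 * (n - 1) < 2 * card E" using s sum_degrees[OF R] by simp
    moreover have cl: "clique E {..<j}" if "j \<le> 6" "9 \<le> d (j - 1)" for j
      unfolding clique_def
    proof (intro ballI impI)
      fix a b :: nat assume ab: "a \<in> {..<j}" "b \<in> {..<j}" "a \<noteq> b"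
      then have "d (j - 1) \<le> d a" "d (j - 1) \<le> d b" using mono n that(1) by auto
      then show "{a, b} \<in> E" using m1(1)[of a b] ab that by fastforce
    qed
    \<comment> \<open>A missing pair has an end of degree at most 8. So \<open>d 3 \<ge> 9\<close>
      makes the first four vertices a clique, whose six edges pay for 14 + 14 + 12; otherwise the
      sum is at most 14 + 8 + 8.\<close>
    moreover have "d 2 + d 3 + d 4 \<le> 35 + card (E \<inter> edges_on {..<6})"
    proof -
      consider "d 3 \<ge> 9" | "d 3 \<le> 8" by linarith
      then show ?thesis
      proof cases
        case 1
        then have "6 \<le> card (E \<inter> edges_on {..<6})"
          using card_ge_of_clique[OF R cl[of 4], of 6] by (simp add: choose_two)
        then show ?thesis using d2 \<open>d 4 \<le> 12\<close> \<open>d 3 \<le> d 2\<close> by linarith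
      qed (use d2 \<open>d 4 \<le> d 3\<close> in linarith)
    qed
    ultimately show False using n by linarith
  qed
  then show ?thesis using R by blast
qed

text \<open>The clique on four vertices leaves at most 20 edges outside, 6 inside and n - 4
  crossing: at most n + 22, below the required 2n - 1 exactly from n = 24 on.\<close>

lemma clique_plus_5:
  assumes E\<^sub>0: "realizes E\<^sub>0" and n: "24 \<le> n" and s: "4 * (n - 1) < (\<Sum>i<n. d i)" and d1: "d 1 \<le> 8"
    and d: "4 \<le> d 1" "3 \<le> d 4"
  shows "\<exists>E. realizes E \<and> clique_plus 5 E"
proof (rule ccontr)
  assume "\<not> ?thesis"
  then have no: "\<And>E. realizes E \<Longrightarrow> \<not> clique_plus 5 E" by blast
  have d3: "3 \<le> d 3" using d(2) mono[of 3 4] n by simp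
  obtain E where R: "realizes E" and cl: "clique E {..<4}"
    using clique_4_step[OF E\<^sub>0 n s d1 d3 no] by blast
  obtain e where e: "card E \<le> e + 6 + (n - 4)" and b: "nbhd_bound 4 4 5 5 e"
    using clique_extend[OF R, of 5] cl n d no by (auto simp: choose_two)
  have "q = 2 \<or> q = 3 \<or> q = 4 \<or> q = 5" if "q \<ge> 2" "q \<le> 5" for q :: nat using that by auto
  then have "e \<le> 20" using b unfolding nbhd_bound_def by (fastforce simp: choose_two)
  moreover have "4 * (n - 1) < 2 * card E" using s sum_degrees[OF R] by simp
  ultimately show False using e n by linarith
qed

lemma clique_plus_7:
  assumes E\<^sub>0: "realizes E\<^sub>0" and n: "93 \<le> n" and s: "6 * (n - 1) < (\<Sum>i<n. d i)" and d2: "d 2 \<le> 14"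
    and d: "6 \<le> d 1" "5 \<le> d 5" "4 \<le> d 6"
  shows "\<exists>E. realizes E \<and> clique_plus 7 E"
proof (rule ccontr)
  assume "\<not> ?thesis"
  then have no: "\<And>E. realizes E \<Longrightarrow> \<not> clique_plus 7 E" by blast
  obtain E where R: "realizes E" and cl: "clique E {..<6}"
    using clique_6_step[OF E\<^sub>0 n s d2 d(2) no] by blast
  obtain e where e: "card E \<le> e + 15 + (n - 6)" and b: "nbhd_bound 8 8 9 9 e"
    using clique_extend[OF R, of 7] cl n d no by (auto simp: choose_two)
  have "q = 2 \<or> q = 3 \<or> q = 4 \<or> q = 5 \<or> q = 6 \<or> q = 7 \<or> q = 8 \<or> q = 9" if "q \<ge> 2" "q \<le> 9" for q :: nat
    using that by auto
  then have "e \<le> 100" using b unfolding nbhd_bound_def by (fastforce simp: choose_two)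
  moreover have "6 * (n - 1) < 2 * card E" using s sum_degrees[OF R] by simp
  ultimately show False using e n by linarith
qed

end

section \<open>Vertices of large degree\<close>

definition hub_edges :: "nat \<Rightarrow> nat \<Rightarrow> nat set set" where
  "hub_edges a k = {{i, j} |i j. i < a \<and> j < k \<and> i \<noteq> j}"

lemma hub_edges_iff: "{x, y} \<in> hub_edges a k \<longleftrightarrow> x \<noteq> y \<and> (x < a \<and> y < k \<or> y < a \<and> x < k)"
  by (auto simp: hub_edges_def doubleton_eq_iff)

definition triangle_join_pairs :: "'a set set \<Rightarrow> bool" where
  "triangle_join_pairs E \<longleftrightarrow> (\<exists>C p q r s. finite C \<and> card C = 3 \<and> clique E C \<and> distinct [p, q, r, s] \<and>
     (\<forall>z\<in>{p, q, r, s}. z \<notin> C \<and> (\<forall>c\<in>C. {c, z} \<in> E)) \<and> {p, q} \<in> E \<and> {r, s} \<in> E)"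

lemma triangle_join_pairsI:
  assumes "finite C" "card C = 3" "clique E C" "distinct [p, q, r, s]"
    and "\<And>z. z \<in> {p, q, r, s} \<Longrightarrow> z \<notin> C" "\<And>z c. z \<in> {p, q, r, s} \<Longrightarrow> c \<in> C \<Longrightarrow> {c, z} \<in> E"
    and "{p, q} \<in> E" "{r, s} \<in> E"
  shows "triangle_join_pairs E"
  using assms unfolding triangle_join_pairs_def by blast

definition clique_join_triple :: "'a set set \<Rightarrow> bool" where
  "clique_join_triple E \<longleftrightarrow> (\<exists>C p q r. finite C \<and> card C = 4 \<and> clique E C \<and> distinct [p, q, r] \<and>
     (\<forall>z\<in>{p, q, r}. z \<notin> C \<and> (\<forall>c\<in>C. {c, z} \<in> E)))"

lemma clique_join_tripleI:
  assumes "finite C" "card C = 4" "clique E C" "distinct [p, q, r]"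
    and "\<And>z. z \<in> {p, q, r} \<Longrightarrow> z \<notin> C" "\<And>z c. z \<in> {p, q, r} \<Longrightarrow> c \<in> C \<Longrightarrow> {c, z} \<in> E"
  shows "clique_join_triple E"
  using assms unfolding clique_join_triple_def by blast

definition universal7 :: "'a set set \<Rightarrow> bool" where
  "universal7 E \<longleftrightarrow> clique_plus 7 E \<or> triangle_join_pairs E \<or> clique_join_triple E"

context deg_seq begin

lemma card_closed_nb_le:
  assumes E: "realizes E" and y: "y < n" "d y \<le> c" and S: "S \<subseteq> insert y (nb E y)" "v \<in> insert y (nb E y)" "v \<notin> S"
  shows "card S \<le> c"
proof -
  have "card S \<le> card (insert y (nb E y) - {v})"
    using S realizes_finite_nb[OF E] by (intro card_mono) auto
  also have "\<dots> = card (insert y (nb E y)) - 1" using S(2) by (simp add: card_Diff_singleton)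
  also have "\<dots> \<le> d y"
    using realizes_deg[OF E y(1)] realizes_finite_nb[OF E, of y] by (simp add: card_insert_if)
  finally show ?thesis using y(2) by simp
qed

text \<open>The exchange of two edges puts all outer neighbours of \<open>u\<close> into the closed
  neighbourhood of \<open>y\<close> without \<open>v\<close>, at most 2k - 5 vertices. With at most
  k - 2 inner neighbours this gives \<open>d u\<close> at most 3k - 7; hence the thresholds 9 for k
  = 5 and 15 for k = 7.\<close>

lemma big_not_missing:
  assumes M: "maximal H E" and uv: "{u, v} \<in> H" "{u, v} \<notin> E" "u \<noteq> v" "u < k" "v < k" "k \<le> n" "3 \<le> k"
    and big: "3 * k - 6 \<le> d u" and uH: "\<And>w. k \<le> w \<Longrightarrow> {u, w} \<notin> H"
    and y: "{v, y} \<in> E" "{v, y} \<notin> H" "d y \<le> 2 * k - 5"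
  shows False
proof -
  note R = maximal_realizes[OF M]
  have yn: "y < n" using realizes_edgeD[OF R y(1)] by simp
  have sub: "nb E u - {..<k} \<subseteq> insert y (nb E y)"
  proof
    fix x assume "x \<in> nb E u - {..<k}"
    then show "x \<in> insert y (nb E y)"
      using maximal_two_swap[OF M uv(1-3) _ uH y(1,2), of x] by (auto simp: nb_def insert_commute)
  qed
  have "v \<in> insert y (nb E y)" using y(1) by (simp add: nb_def insert_commute)
  then have 1: "card (nb E u - {..<k}) \<le> 2 * k - 5"
    using card_closed_nb_le[OF R yn y(3) sub] uv by simp
  have "d u \<le> card (nb E u - {..<k}) + (k - 2)"
    by (rule deg_le_outside_missing[OF R uv(4,5,3,2,6)])
  then show False using 1 big uv by linarith
qed

text \<open>
  If \<open>i\<close> were not adjacent to \<open>x\<close>, then exchanging three edges would put the many outer neighbours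
  of \<open>i\<close> into \<open>N[y]\<close>.
\<close>

lemma hub_joined:
  assumes M: "maximal H E" and uv: "{u, v} \<in> H" "{u, v} \<notin> E" "u \<noteq> v" "v < k" "k \<le> n"
    and i: "i < k" "3 * k - 6 \<le> d i" "3 \<le> k" "i \<noteq> x" and iH: "\<And>w. k \<le> w \<Longrightarrow> {i, w} \<notin> H"
    and x: "{u, x} \<in> E" "{u, x} \<notin> H"
    and y: "{v, y} \<in> E" "{v, y} \<notin> H" "d y \<le> 2 * k - 5"
  shows "{i, x} \<in> E"
proof (rule ccontr)
  assume neg: "{i, x} \<notin> E"
  note R = maximal_realizes[OF M]
  have yn: "y < n" using realizes_edgeD[OF R y(1)] by simp
  let ?S = "nb E i - {..<k}"
  have sub: "?S \<subseteq> insert y (nb E y)"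
  proof
    fix w assume w: "w \<in> nb E i - {..<k}"
    then have "{i, w} \<in> E" "{i, w} \<notin> H" using iH by (auto simp: nb_def)
    then show "w \<in> insert y (nb E y)"
      using maximal_three_swap[OF M uv(1-3) x y(1,2), of i w] i neg by (auto simp: nb_def insert_commute)
  qed
  have v: "v \<in> insert y (nb E y)" using y(1) by (simp add: nb_def insert_commute)
  have xy: "x \<in> insert y (nb E y)"
    using maximal_two_swap[OF M uv(1-3) x y(1,2)] by (auto simp: nb_def insert_commute)
  have xv: "x \<noteq> v" using x uv by auto
  have xS: "x \<notin> ?S" using neg by (simp add: nb_def)
  have "card (insert x ?S) \<le> 2 * k - 5"
    using card_closed_nb_le[OF R yn y(3), of "insert x ?S" v] sub xy v xv uv by auto
  then have 1: "Suc (card ?S) \<le> 2 * k - 5"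
    using xS realizes_finite_nb[OF R] by simp
  have "d i \<le> card ?S + (k - 1)" by (rule deg_le_outside_self[OF R i(1) uv(5)])
  then show False using 1 i by linarith
qed

text \<open>As in \<open>clique_plus_of_high_degrees\<close>, a missing edge between two vertices of
  degree at least 2k - 4 leaves k - 2 outer neighbours at each end.\<close>

lemma hub_clique:
  assumes M: "maximal (hub_edges a k) E" and k: "4 \<le> k" "k \<le> n" "a \<le> k"
    and A: "\<And>i. i < a \<Longrightarrow> 2 * k - 4 \<le> d i" and no: "\<not> clique_plus k E"
  shows "clique E {..<a}"
  unfolding clique_def
proof (intro ballI impI, rule ccontr)
  fix u v assume uv: "u \<in> {..<a}" "v \<in> {..<a}" "u \<noteq> v" "{u, v} \<notin> E"
  note R = maximal_realizes[OF M]
  have X: "k - 2 \<le> card (nb E b - {..<k})" if "b < a" "c < a" "b \<noteq> c" "{b, c} \<notin> E" for b c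
  proof -
    have "d b \<le> card (nb E b - {..<k}) + (k - 2)"
      using that k by (intro deg_le_outside_missing[OF R, of b k c]) auto
    then show ?thesis using A[OF that(1)] k by linarith
  qed
  have "{u, v} \<in> hub_edges a k" using uv k by (auto simp: hub_edges_iff)
  moreover have "{v, u} \<notin> E" using uv by (simp add: insert_commute)
  moreover have "\<And>b x. x \<in> nb E b - {..<k} \<Longrightarrow> {b, x} \<notin> hub_edges a k"
    using k by (auto simp: hub_edges_iff)
  moreover have "\<And>x y. x \<in> nb E u - {..<k} \<Longrightarrow> {x, y} \<notin> hub_edges a k"
    using k by (auto simp: hub_edges_iff)
  ultimately have "clique_plus k E"
    using X[of u v] X[of v u] uv
    by (intro maximal_clique_plus[OF M k(1), of u v "nb E u - {..<k}" "nb E v - {..<k}"]) auto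
  then show False using no by simp
qed

text \<open>The situation to be excluded: a large \<open>u\<close> is not joined to a small
  \<open>v\<close>, although \<open>v\<close> has a neighbour \<open>y\<close> that is small as
  well. Then \<open>u\<close> is not among the \<open>m\<close> very large vertices, and these are
  joined to \<open>y\<close> and to all outer neighbours of \<open>u\<close>. Together with
  \<open>u\<close> this dense cluster will contain a target.\<close>

lemma hub_missing:
  assumes M: "maximal (hub_edges a k) E" and k: "4 \<le> k" "k \<le> n" "a \<le> k" "m \<le> a"
    and A: "\<And>i. i < a \<Longrightarrow> 2 * k - 4 \<le> d i" and L: "\<And>i. a \<le> i \<Longrightarrow> i < n \<Longrightarrow> d i \<le> 2 * k - 5"
    and big: "\<And>i. i < m \<Longrightarrow> 3 * k - 6 \<le> d i"
    and uv: "u < a" "a \<le> v" "v < k" "{u, v} \<notin> E" and y: "{v, y} \<in> E" "a \<le> y"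
  shows "m \<le> u" and "k - 2 \<le> card (nb E u - {..<k})"
    and "i < m \<Longrightarrow> {i, y} \<in> E"
    and "x \<in> nb E u - {..<k} \<Longrightarrow> i < m \<Longrightarrow> {i, x} \<in> E"
    and "x \<in> nb E u - {..<k} \<Longrightarrow> x = y \<or> {x, y} \<in> E"
proof -
  note R = maximal_realizes[OF M]
  have yn: "y < n" using realizes_edgeD[OF R y(1)] by simp
  have H: "{u, v} \<in> hub_edges a k" and vy: "{v, y} \<notin> hub_edges a k"
    using uv y by (auto simp: hub_edges_iff)
  have uv': "u \<noteq> v" "u < k" using uv by auto
  have out: "{b, w} \<notin> hub_edges a k" if "k \<le> w" for b w
    using that k by (auto simp: hub_edges_iff)
  have dy: "d y \<le> 2 * k - 5" using L y yn by simp
  show m: "m \<le> u"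
  proof (rule ccontr)
    assume "\<not> ?thesis"
    then show False
      using big_not_missing[OF M H uv(4) uv' uv(3) k(2) _ _ out y(1) vy dy] big k by simp
  qed
  have "d u \<le> card (nb E u - {..<k}) + (k - 2)"
    by (rule deg_le_outside_missing[OF R uv'(2) uv(3) uv'(1) uv(4) k(2)])
  then show X: "k - 2 \<le> card (nb E u - {..<k})" using A[OF uv(1)] k by linarith
  show x: "{i, x} \<in> E" if x: "x \<in> nb E u - {..<k}" "i < m" for x i
  proof -
    have "{u, x} \<in> E" "{u, x} \<notin> hub_edges a k" "i \<noteq> x" "i < k" using x out k by (auto simp: nb_def)
    then show ?thesis
      using hub_joined[OF M H uv(4) uv'(1) uv(3) k(2), of i x y] big[OF x(2)] out y(1) vy dy k by simp
  qed
  show "x = y \<or> {x, y} \<in> E" if x: "x \<in> nb E u - {..<k}" for x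
    using maximal_two_swap[OF M H uv(4) uv'(1) _ _ y(1) vy, of x] x out by (auto simp: nb_def)
  \<comment> \<open>The ends are interchanged: seen from \<open>v\<close>, the vertex to be joined
    is \<open>y\<close>, and an outer neighbour of \<open>u\<close>, also of small degree, takes
    over the part of \<open>y\<close>.\<close>
  show "{i, y} \<in> E" if i: "i < m" for i
  proof -
    have "card (nb E u - {..<k}) \<noteq> 0" using X k by linarith
    then obtain x where x: "x \<in> nb E u - {..<k}" by (metis card.empty ex_in_conv)
    have e: "{u, x} \<in> E" "{u, x} \<notin> hub_edges a k" "i < k" "i \<noteq> y" using x out k y i by (auto simp: nb_def)
    have "x < n" using realizes_edgeD[OF R e(1)] by simp
    then have "d x \<le> 2 * k - 5" using L x k by simp
    moreover have "{v, u} \<in> hub_edges a k" "{v, u} \<notin> E" "v \<noteq> u" using H uv uv' by (simp_all add: insert_commute)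
    ultimately show ?thesis
      using hub_joined[OF M _ _ _ uv'(2) k(2), of v i y x] big[OF i] out y(1) vy e k by simp
  qed
qed

lemma hub_threshold:
  assumes "0 < k" "k \<le> n" "d (k - 1) < c" "m \<le> k" "\<And>i. i < m \<Longrightarrow> c \<le> d i"
  obtains a where "m \<le> a" "a < k" "\<And>i. i < a \<Longrightarrow> c \<le> d i" "\<And>i. a \<le> i \<Longrightarrow> i < n \<Longrightarrow> d i < c"
proof -
  define a where "a = (LEAST i. d i < c)"
  have 1: "d a < c" unfolding a_def by (rule LeastI[of _ "k - 1"]) (rule assms)
  have 2: "c \<le> d i" if "i < a" for i using not_less_Least[of i "\<lambda>i. d i < c"] that by (simp add: a_def)
  have "a \<le> k - 1" unfolding a_def by (rule Least_le) (rule assms)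
  moreover have "m \<le> a" using assms(5)[of a] 1 by (meson not_le)
  moreover have "d i < c" if "a \<le> i" "i < n" for i using mono[OF that] 1 by simp
  ultimately show ?thesis using that[of a] 2 assms(1) by auto
qed

text \<open>With k = 5, \<open>a\<close> counts the degrees of at least 2k - 4 = 6, two of which are
  at least 3k - 6 = 9. The hub edges suffice for a = 3; for a = 4 the first four vertices are the
  clique; for a = 2 one more edge has to be found.\<close>

lemma clique_plus_5_big:
  assumes E\<^sub>0: "realizes E\<^sub>0" and n: "5 \<le> n" and d1: "9 \<le> d 1" and d4: "3 \<le> d 4"
  shows "\<exists>E. realizes E \<and> clique_plus 5 E"
proof (rule ccontr)
  assume "\<not> ?thesis"
  then have no: "\<And>E. realizes E \<Longrightarrow> \<not> clique_plus 5 E" by blast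
  have big: "9 \<le> d i" if "i < 2" for i using mono[of i 1] d1 that n by simp
  have "d 4 < 6"
  proof (rule ccontr)
    assume "\<not> d 4 < 6"
    then show False using clique_plus_of_high_degrees[OF E\<^sub>0, of 5] no n by auto
  qed
  moreover have big6: "6 \<le> d i" if "i < 2" for i using big[OF that] by simp
  ultimately obtain a where a: "2 \<le> a" "a < 5" "\<And>i. i < a \<Longrightarrow> 6 \<le> d i" "\<And>i. a \<le> i \<Longrightarrow> i < n \<Longrightarrow> d i < 6"
    using hub_threshold[of 5 6 2, OF _ n _ _ big6] by auto
  have A: "2 * 5 - 4 \<le> d i" if "i < a" for i using a(3)[OF that] by simp
  have L: "d i \<le> 2 * 5 - 5" if "a \<le> i" "i < n" for i using a(4)[OF that] by simp
  have B: "3 * 5 - 6 \<le> d i" if "i < 2" for i using big[OF that] by simp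
  have k: "4 \<le> (5::nat)" "a \<le> 5" using a by simp_all
  obtain E where M: "maximal (hub_edges a 5) E" using maximal_exists[OF E\<^sub>0] by blast
  note R = maximal_realizes[OF M] and fin = realizes_finite_nb[OF maximal_realizes[OF M]]
  have cl: "clique E {..<a}" by (rule hub_clique[OF M k(1) n k(2) A no[OF R]])
  have dv: "3 \<le> d v" if "v < 5" for v using mono[of v 4] d4 that n by simp
  \<comment> \<open>Otherwise 0, 1, \<open>y\<close> and an outer neighbour \<open>x\<close> of
    \<open>u\<close> form a clique, to which \<open>u\<close> is attached by 0 and 1.\<close>
  have J: "{..<a} \<subseteq> nb E v \<or> nb E v \<subseteq> {..<a}" if v: "a \<le> v" "v < 5" for v
  proof (rule ccontr)
    assume "\<not> ?thesis"
    then obtain u y where "u < a" "u \<notin> nb E v" "y \<in> nb E v" "a \<le> y"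
      by (meson lessThan_iff not_le subsetI)
    then have u: "u < a" "{u, v} \<notin> E" and y: "{v, y} \<in> E" "a \<le> y"
      by (simp_all add: nb_def insert_commute)
    note h = hub_missing[OF M k(1) n k(2) a(1) A L B u(1) v u(2) y]
    have hX: "3 \<le> card (nb E u - {..<5})" and hu: "2 \<le> u" using h(1,2) by simp_all
    have hy: "\<And>i. i < 2 \<Longrightarrow> {i, y} \<in> E"
      and hx: "\<And>x i. x \<in> nb E u - {..<5} \<Longrightarrow> i < 2 \<Longrightarrow> {i, x} \<in> E"
      and hxy: "\<And>x. x \<in> nb E u - {..<5} \<Longrightarrow> x = y \<or> {x, y} \<in> E"
      using h(3-5) by simp_all
    have "\<not> nb E u - {..<5} \<subseteq> {y}" using hX card_mono[of "{y}" "nb E u - {..<5}"] by auto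
    then obtain x where x: "x \<in> nb E u - {..<5}" "x \<noteq> y" by blast
    have u01: "{0, u} \<in> E" "{1, u} \<in> E" "{0, 1} \<in> E"
      using cl u(1) hu a(1) by (auto simp: clique_def)
    have "{0, x} \<in> E" "{1, x} \<in> E" "{0, y} \<in> E" "{1, y} \<in> E" "{x, y} \<in> E"
      using hx[OF x(1), of 0] hx[OF x(1), of 1] hy[of 0] hy[of 1] hxy[OF x(1)] x(2) by simp_all
    then have "clique E {0, 1, x, y}"
      using u01 by (auto simp: clique_def insert_commute)
    then have "clique_plus 5 E"
      using u u01 hu x y a by (intro clique_plusI[of "{0, 1, x, y}" 5 E u 0 1]) (auto simp: insert_commute)
    then show False using no R by blast
  qed
  have J2: "{..<a} \<subseteq> nb E v \<or> 3 \<le> card (nb E v \<inter> {..<a})" if v: "a \<le> v" "v < 5" for v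
    using J[OF v] realizes_deg[OF R, of v] dv[OF v(2)] v n by (auto simp: Int_absorb2)
  have J3: "{..<a} \<subseteq> nb E v" if v: "a \<le> v" "v < 5" "a \<le> 3" for v
    using J2[OF v(1,2)] card_seteq[of "{..<a}" "nb E v \<inter> {..<a}"] v(3) by auto
  consider "a = 2" | "a = 3" | "a = 4" using a by linarith
  then show False
  proof cases
    case 1
    \<comment> \<open>Vertices 0 and 1 are joined to each other and to 2, 3, 4. Any neighbour
      \<open>x\<close> of 2 that is joined to 0 and 1 completes the target. Wanting
      \<open>{2, 3}\<close> either makes 3 such a vertex or lets an exchange supply another
      one.\<close>
    let ?H = "hub_edges a 5 \<union> {{2, 3}}"
    obtain F where MF: "maximal ?H F" and sub: "E \<inter> ?H \<subseteq> F" using maximal_exists[OF R] by blast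
    note RF = maximal_realizes[OF MF]
    have hubF: "hub_edges a 5 \<subseteq> F"
    proof -
      have "{i, j} \<in> E" if "i < a" "j < 5" "i \<noteq> j" for i j
        using that cl J3[of j] 1 by (cases "j < a") (auto simp: clique_def nb_def insert_commute)
      then have "hub_edges a 5 \<subseteq> E" by (auto simp: hub_edges_def)
      then show ?thesis using sub by blast
    qed
    have hF: "{i, j} \<in> F" if "i < 2" "j < 5" "i \<noteq> j" for i j
      using that hubF 1 by (auto simp: hub_edges_iff)
    have *: "clique_plus 5 F" if x: "{0, x} \<in> F" "{1, x} \<in> F" "{2, x} \<in> F" for x
    proof -
      obtain t :: nat where t: "t \<in> {3, 4}" "t \<noteq> x" using that by (cases "x = 3") auto
      have "x \<noteq> 0" "x \<noteq> 1" "x \<noteq> 2" 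
        using realizes_edgeD(3)[OF RF x(1)] realizes_edgeD(3)[OF RF x(2)] realizes_edgeD(3)[OF RF x(3)] by auto
      then show ?thesis
        using t x hF[of 0 1] hF[of 0 2] hF[of 1 2] hF[of 0 t] hF[of 1 t]
        by (intro clique_plusI[of "{0, 1, 2, x}" 5 F t 0 1]) (auto simp: clique_def insert_commute)
    qed
    show False
    proof (cases "{2, 3} \<in> F")
      case True
      then show False using *[of 3] hF[of 0 3] hF[of 1 3] no RF by auto
    next
      case False
      have out: "\<exists>x. {v, x} \<in> F \<and> x \<noteq> 0 \<and> x \<noteq> 1" if "v < 5" for v
      proof (rule ccontr)
        assume "\<not> ?thesis"
        then have "nb F v \<subseteq> {0, 1}" by (auto simp: nb_def)
        then have "card (nb F v) \<le> 2" using card_mono[of "{0, 1}" "nb F v"] by simp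
        then show False using realizes_deg[OF RF, of v] dv[OF that] that n by simp
      qed
      obtain x where x: "{2, x} \<in> F" "x \<noteq> 0" "x \<noteq> 1" using out[of 2] by auto
      obtain y where y: "{3, y} \<in> F" "y \<noteq> 0" "y \<noteq> 1" using out[of 3] by auto
      have "{2, x} \<notin> ?H" "{3, y} \<notin> ?H"
        using x y False 1 by (auto simp: hub_edges_iff doubleton_eq_iff insert_commute)
      moreover have "d y \<le> 5" using a(4)[of y] y realizes_edgeD[OF RF y(1)] 1 by simp
      ultimately have "{i, x} \<in> F" if "i < 2" for i
        using hub_joined[OF MF _ False _ _ _ _ _ _ _ _ x(1) _ y(1), of 5 i] x that n big[of i] 1
        by (auto simp: hub_edges_iff doubleton_eq_iff)
      then show False using *[of x] x no RF by auto
    qed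
  next
    case 2
    then have "{i, j} \<in> E" if "i < 3" "j < 5" "i \<noteq> j" for i j
      using that cl J3[of j] by (cases "j < a") (auto simp: clique_def nb_def insert_commute)
    then have "clique_plus 5 E"
      by (intro clique_plusI[of "{..<4}" 5 E 4 0 1]) (auto simp: clique_def less_Suc_eq numeral_eq_Suc insert_commute)
    then show False using no R by blast
  next
    case 3
    have "2 \<le> card (nb E 4 \<inter> {..<4})"
      using J2[of 4] 3 card_mono[of "nb E 4 \<inter> {..<4}" "{..<4}"] fin by force
    then obtain p q where "p \<in> nb E 4 \<inter> {..<4}" "q \<in> nb E 4 \<inter> {..<4}" "p \<noteq> q"
      by (metis card_le_Suc0_iff_eq fin finite_Int not_less_eq_eq numeral_2_eq_2)
    then have "clique_plus 5 E"
      using cl 3 by (intro clique_plusI[of "{..<4}" 5 E 4 p q]) (auto simp: nb_def)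
    then show False using no R by blast
  qed
qed

end

lemma triangle_join_pairs_012I:
  fixes E :: "nat set set"
  assumes "{0, 1} \<in> E" "{0, 2} \<in> E" "{1, 2} \<in> E" "distinct [p, q, r, s]"
    and "\<And>z. z \<in> {p, q, r, s} \<Longrightarrow> 3 \<le> z \<and> {0, z} \<in> E \<and> {1, z} \<in> E \<and> {2, z} \<in> E"
    and "{p, q} \<in> E" "{r, s} \<in> E"
  shows "triangle_join_pairs E"
proof (rule triangle_join_pairsI[of "{0, 1, 2}" E p q r s])
  show "clique E {0, 1, 2}" using assms(1-3) by (auto simp: clique_def insert_commute)
  show "z \<notin> {0, 1, 2}" if "z \<in> {p, q, r, s}" for z using assms(5)[OF that] by auto
  show "{c, z} \<in> E" if "z \<in> {p, q, r, s}" "c \<in> {0, 1, 2}" for z c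
    using assms(5)[OF that(1)] that(2) by auto
qed (use assms in auto)

lemma clique_join_triple_012I:
  fixes E :: "nat set set"
  assumes "{0, 1} \<in> E" "{0, 2} \<in> E" "{1, 2} \<in> E" "distinct [c, p, q, r]"
    and "\<And>z. z \<in> {c, p, q, r} \<Longrightarrow> 3 \<le> z \<and> {0, z} \<in> E \<and> {1, z} \<in> E \<and> {2, z} \<in> E"
    and "{c, p} \<in> E" "{c, q} \<in> E" "{c, r} \<in> E"
  shows "clique_join_triple E"
proof (rule clique_join_tripleI[of "{0, 1, 2, c}" E p q r])
  have c: "3 \<le> c" "{0, c} \<in> E" "{1, c} \<in> E" "{2, c} \<in> E" using assms(5)[of c] by auto
  then show "card {0, 1, 2, c} = 4" by auto
  show "clique E {0, 1, 2, c}" using assms(1-3) c by (auto simp: clique_def insert_commute)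
  show "z \<notin> {0, 1, 2, c}" if "z \<in> {p, q, r}" for z using assms(5)[of z] assms(4) that by auto
  show "{x, z} \<in> E" if "z \<in> {p, q, r}" "x \<in> {0, 1, 2, c}" for z x
    using assms(5)[of z] assms(6-8) that by auto
qed (use assms in auto)

section \<open>Seven vertices: the triangle 0, 1, 2 and what is joined to it\<close>

context deg_seq begin

text \<open>The premise \<open>step\<close> is what exchanges give for a missing matching edge
  \<open>pq\<close>. Different further neighbours \<open>x\<close> of \<open>p\<close> and
  \<open>y\<close> of \<open>q\<close> would yield the disjoint edges \<open>px\<close>,
  \<open>qy\<close> joined to the triangle. So \<open>p\<close> and \<open>q\<close> share a single
  one, which then serves as the fourth vertex of a clique.\<close>

lemma universal7_of_matching:
  assumes E: "realizes E" and n: "7 \<le> n" and H: "hub_edges 3 7 \<subseteq> E"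
    and d34: "\<And>v. v < 7 \<Longrightarrow> 4 \<le> d v"
    and step: "\<And>p q x y. (p, q) \<in> {(3, 4), (5, 6)} \<Longrightarrow> {p, q} \<notin> E \<Longrightarrow> {p, x} \<in> E \<Longrightarrow> {q, y} \<in> E \<Longrightarrow>
      3 \<le> x \<Longrightarrow> 3 \<le> y \<Longrightarrow> (x = y \<or> {x, y} \<in> E) \<and> (\<forall>i<3. {i, x} \<in> E \<and> {i, y} \<in> E)"
  shows "universal7 E"
proof (rule ccontr)
  assume no: "\<not> ?thesis"
  have h: "{i, j} \<in> E" if "i < 3" "j < 7" "i \<noteq> j" for i j
    using that H by (auto simp: hub_edges_iff)
  have h3: "{0, 1} \<in> E" "{0, 2} \<in> E" "{1, 2} \<in> E" using h[of 0 1] h[of 0 2] h[of 1 2] by auto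
  have hj: "{0, z} \<in> E \<and> {1, z} \<in> E \<and> {2, z} \<in> E" if "3 \<le> z" "z < 7" for z
    using h[of 0 z] h[of 1 z] h[of 2 z] that by auto
  have out: "nb E v - {..<3} \<noteq> {}" if "v < 7" for v
  proof
    assume "nb E v - {..<3} = {}"
    then have "nb E v \<subseteq> {..<3}" by auto
    then have "card (nb E v) \<le> 3" using card_mono[of "{..<3::nat}" "nb E v"] by simp
    then show False using realizes_deg[OF E, of v] d34[OF that] that n by simp
  qed
  have uniq: "\<exists>x. 3 \<le> x \<and> x < 7 \<and> x \<noteq> p \<and> x \<noteq> q \<and> nb E p - {..<3} = {x} \<and> nb E q - {..<3} = {x}"
    if pq: "(p, q) \<in> {(3, 4), (5, 6)}" "{p, q} \<notin> E" for p q
  proof -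
    have pq7: "3 \<le> p" "p < 7" "3 \<le> q" "q < 7" "p \<noteq> q" "p \<le> 6" "q \<le> 6" using pq by auto
    have eq: "x = y" if "x \<in> nb E p - {..<3}" "y \<in> nb E q - {..<3}" for x y
    proof (rule ccontr)
      assume ne: "x \<noteq> y"
      have xy: "{p, x} \<in> E" "{q, y} \<in> E" "3 \<le> x" "3 \<le> y" using that by (auto simp: nb_def)
      have j: "\<forall>i<3. {i, x} \<in> E \<and> {i, y} \<in> E" using step[OF pq xy] by simp
      have "x \<noteq> p" "y \<noteq> q" using realizes_edgeD(3)[OF E xy(1)] realizes_edgeD(3)[OF E xy(2)] by auto
      moreover have "x \<noteq> q" "y \<noteq> p" using xy(1,2) pq(2) by (auto simp: insert_commute)
      ultimately have "triangle_join_pairs E"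
        using j[rule_format, of 0] j[rule_format, of 1] j[rule_format, of 2] pq7 xy hj[of p] hj[of q] ne
        by (intro triangle_join_pairs_012I[OF h3, of p x q y]) auto
      then show False using no by (simp add: universal7_def)
    qed
    obtain x where x: "x \<in> nb E p - {..<3}" using out[of p] pq7 by blast
    obtain y where y: "y \<in> nb E q - {..<3}" using out[of q] pq7 by blast
    have xp: "x \<noteq> p" "x \<noteq> q" using x pq(2) realizes_nb[OF E, of p] by (auto simp: nb_def)
    have "z = x" if "z \<in> nb E p - {..<3}" for z using eq[OF that y] eq[OF x y] by simp
    then have "nb E p - {..<3} \<subseteq> {x}" by auto
    moreover have "z = x" if "z \<in> nb E q - {..<3}" for z using eq[OF x that] by simp
    then have "nb E q - {..<3} \<subseteq> {x}" by auto
    ultimately have s: "nb E p - {..<3} = {x}" "nb E q - {..<3} = {x}"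
      using subset_singletonD[of "nb E p - {..<3}" x] subset_singletonD[of "nb E q - {..<3}" x] x y by auto
    have dp: "d p \<le> 4"
    proof -
      have "nb E p \<subseteq> {0, 1, 2, x}"
      proof
        fix z assume "z \<in> nb E p"
        then have "z < 3 \<or> z \<in> {x}" unfolding s(1)[symmetric] by auto
        moreover have "z = 0 \<or> z = 1 \<or> z = 2" if "z < 3" using that by linarith
        ultimately show "z \<in> {0, 1, 2, x}" by blast
      qed
      then have "card (nb E p) \<le> card {0, 1, 2, x}" by (intro card_mono) auto
      also have "\<dots> \<le> 4" by (simp add: card_insert_if)
      finally show ?thesis using realizes_deg[OF E, of p] pq7 n by simp
    qed
    \<comment> \<open>Otherwise \<open>x\<close> would be adjacent to 0, 1, 2, \<open>p\<close> and
      \<open>q\<close> although it comes after \<open>p\<close>, whose degree is at most 4.\<close>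
    have "x < 7"
    proof (rule ccontr)
      assume "\<not> x < 7"
      have xn: "x < n" using x realizes_nb[OF E, of p] by auto
      have xq: "{p, x} \<in> E" "{q, x} \<in> E" using s by (auto simp: nb_def)
      have "\<forall>i<3. {i, x} \<in> E" using step[OF pq xq] x by auto
      then have "{0, x} \<in> E" "{1, x} \<in> E" "{2, x} \<in> E" by simp_all
      then have "{0, 1, 2, p, q} \<subseteq> nb E x" using xq by (auto simp: nb_def insert_commute)
      then have "card {0, 1, 2, p, q} \<le> card (nb E x)"
        using realizes_finite_nb[OF E] by (intro card_mono)
      moreover have "card {0, 1, 2, p, q} = 5" using pq7 by auto
      ultimately have "5 \<le> d x" using realizes_deg[OF E xn] by simp
      then show False using dp mono[of p x] xn \<open>\<not> x < 7\<close> pq7 by simp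
    qed
    then show ?thesis using s x xp by (intro exI[of _ x]) auto
  qed
  have trip: False if pq: "(p, q, r, s) \<in> {(3, 4, 5, 6), (3, 4, 6, 5), (5, 6, 3, 4), (5, 6, 4, 3)}"
    "nb E p - {..<3} = {r}" "nb E q - {..<3} = {r}" "{r, s} \<in> E" for p q r s :: nat
  proof -
    have "{r, p} \<in> E" "{r, q} \<in> E" using pq(2,3) by (auto simp: nb_def insert_commute)
    then have "clique_join_triple E"
      using pq(1,4) hj by (intro clique_join_triple_012I[OF h3, of r p q s]) auto
    then show False using no by (simp add: universal7_def)
  qed
  have twice: False if "nb E r - {..<3} = {z}" "{p, r} \<in> E" "{q, r} \<in> E" "3 \<le> p" "3 \<le> q" "p \<noteq> q" for p q r z
  proof -
    have "p \<in> nb E r - {..<3}" "q \<in> nb E r - {..<3}"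
      using that(2-5) by (simp_all add: in_nb_iff insert_commute)
    then show False using that(1,6) by simp
  qed
  have matched: "{p, q} \<in> E" if pq: "(p, q, r, s) \<in> {(3, 4, 5, 6), (5, 6, 3, 4)}" for p q r s :: nat
  proof (rule ccontr)
    assume "{p, q} \<notin> E"
    then obtain x where x: "3 \<le> x" "x < 7" "x \<noteq> p" "x \<noteq> q" "nb E p - {..<3} = {x}" "nb E q - {..<3} = {x}"
      using uniq[of p q] pq by auto
    have "x \<in> nb E p - {..<3}" "x \<in> nb E q - {..<3}" unfolding x(5,6) by simp_all
    then have e: "{p, x} \<in> E" "{q, x} \<in> E" by (simp_all add: in_nb_iff)
    have xrs: "x = r \<or> x = s" using x(1-4) pq by auto
    show False
    proof (cases "{r, s} \<in> E")
      case True
      then have "{s, r} \<in> E" by (simp add: insert_commute)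
      have t: "(p, q, r, s) \<in> {(3, 4, 5, 6), (3, 4, 6, 5), (5, 6, 3, 4), (5, 6, 4, 3)}"
        "(p, q, s, r) \<in> {(3, 4, 5, 6), (3, 4, 6, 5), (5, 6, 3, 4), (5, 6, 4, 3)}" using pq by auto
      from xrs show ?thesis
      proof
        assume "x = r"
        then show False using trip[OF t(1)] x(5,6) True by blast
      next
        assume "x = s"
        then show False using trip[OF t(2)] x(5,6) \<open>{s, r} \<in> E\<close> by blast
      qed
    next
      case False
      \<comment> \<open>If \<open>rs\<close> is missing too, \<open>r\<close> and \<open>s\<close>
        have only one neighbour outside the triangle each, but one of them is \<open>x\<close>,
        adjacent to both \<open>p\<close> and \<open>q\<close>.\<close>
      then obtain z where z: "nb E r - {..<3} = {z}" "nb E s - {..<3} = {z}" using uniq[of r s] pq by auto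
      have "3 \<le> p" "3 \<le> q" "p \<noteq> q" using pq by auto
      then show ?thesis using xrs twice[OF z(1)] twice[OF z(2)] e by blast
    qed
  qed
  have "triangle_join_pairs E"
    using hj matched[of 3 4 5 6] matched[of 5 6 3 4]
    by (intro triangle_join_pairs_012I[OF h3, of 3 4 5 6]) auto
  then show False using no by (simp add: universal7_def)
qed

text \<open>Here 15 = 3k - 6 and 10 = 2k - 4, and the number \<open>a\<close> of degrees of at least
  10 selects the target. For a = 3 the hub alone is not enough and a matching on 3, 4, 5, 6 is added
  to the wanted edges.\<close>

lemma universal7_big:
  assumes E\<^sub>0: "realizes E\<^sub>0" and n: "7 \<le> n" and d2: "15 \<le> d 2" and d6: "4 \<le> d 6"
  shows "\<exists>E. realizes E \<and> universal7 E"
proof (rule ccontr)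
  assume "\<not> ?thesis"
  then have no: "\<And>E. realizes E \<Longrightarrow> \<not> universal7 E" by blast
  have no1: "\<not> clique_plus 7 E" and no2: "\<not> triangle_join_pairs E" and no3: "\<not> clique_join_triple E"
    if "realizes E" for E
    using no[OF that] by (auto simp: universal7_def)
  have big: "15 \<le> d i" if "i < 3" for i using mono[of i 2] d2 that n by simp
  have "d 6 < 10"
  proof (rule ccontr)
    assume "\<not> d 6 < 10"
    then show False using clique_plus_of_high_degrees[OF E\<^sub>0, of 7] no1 n by auto
  qed
  moreover have big10: "10 \<le> d i" if "i < 3" for i using big[OF that] by simp
  ultimately obtain a where a: "3 \<le> a" "a < 7" "\<And>i. i < a \<Longrightarrow> 10 \<le> d i" "\<And>i. a \<le> i \<Longrightarrow> i < n \<Longrightarrow> d i < 10"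
    using hub_threshold[of 7 10 3, OF _ n _ _ big10] by auto
  have A: "2 * 7 - 4 \<le> d i" if "i < a" for i using a(3)[OF that] by simp
  have L: "d i \<le> 2 * 7 - 5" if "a \<le> i" "i < n" for i using a(4)[OF that] by simp
  have B: "3 * 7 - 6 \<le> d i" if "i < 3" for i using big[OF that] by simp
  have k: "4 \<le> (7::nat)" "a \<le> 7" using a by simp_all
  obtain E where M: "maximal (hub_edges a 7) E" using maximal_exists[OF E\<^sub>0] by blast
  note R = maximal_realizes[OF M] and fin = realizes_finite_nb[OF maximal_realizes[OF M]]
  have cl: "clique E {..<a}" by (rule hub_clique[OF M k(1) n k(2) A no1[OF R]])
  have clE: "{i, j} \<in> E" if "i < a" "j < a" "i \<noteq> j" for i j using cl that by (simp add: clique_def)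
  have dv: "4 \<le> d v" if "v < 7" for v using mono[of v 6] d6 that n by simp
  have h3: "{0, 1} \<in> E" "{0, 2} \<in> E" "{1, 2} \<in> E" using clE a(1) by auto
  \<comment> \<open>Otherwise the disjoint edges \<open>xy\<close> and \<open>ux'\<close>, with
    \<open>x\<close> and \<open>x'\<close> outer neighbours of \<open>u\<close>, are joined to the
    triangle 0, 1, 2.\<close>
  have J: "{..<a} \<subseteq> nb E v \<or> nb E v \<subseteq> {..<a}" if v: "a \<le> v" "v < 7" for v
  proof (rule ccontr)
    assume "\<not> ?thesis"
    then obtain u y where "u < a" "u \<notin> nb E v" "y \<in> nb E v" "a \<le> y"
      by (meson lessThan_iff not_le subsetI)
    then have u: "u < a" "{u, v} \<notin> E" and y: "{v, y} \<in> E" "a \<le> y"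
      by (simp_all add: nb_def insert_commute)
    note h = hub_missing[OF M k(1) n k(2) a(1) A L B u(1) v u(2) y]
    have hX: "5 \<le> card (nb E u - {..<7})" and hu: "3 \<le> u" using h(1,2) by simp_all
    have hy: "\<And>i. i < 3 \<Longrightarrow> {i, y} \<in> E"
      and hx: "\<And>x i. x \<in> nb E u - {..<7} \<Longrightarrow> i < 3 \<Longrightarrow> {i, x} \<in> E"
      and hxy: "\<And>x. x \<in> nb E u - {..<7} \<Longrightarrow> x = y \<or> {x, y} \<in> E"
      using h(3-5) by simp_all
    have "\<not> nb E u - {..<7} \<subseteq> {y}" using hX card_mono[of "{y}" "nb E u - {..<7}"] by auto
    then obtain x where x: "x \<in> nb E u - {..<7}" "x \<noteq> y" by blast
    have "card {x, y} \<le> 2" by (simp add: card_insert_if)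
    then have "\<not> nb E u - {..<7} \<subseteq> {x, y}" using hX card_mono[of "{x, y}" "nb E u - {..<7}"] by auto
    then obtain x' where x': "x' \<in> nb E u - {..<7}" "x' \<noteq> x" "x' \<noteq> y" by blast
    have "3 \<le> z \<and> {0, z} \<in> E \<and> {1, z} \<in> E \<and> {2, z} \<in> E" if "z \<in> {x, y, u, x'}" for z
      using that hx[OF x(1)] hx[OF x'(1)] hy x x' y a hu clE[OF _ u(1)] by auto
    moreover have "distinct [x, y, u, x']" using x x' u y a by auto
    moreover have "{x, y} \<in> E" "{u, x'} \<in> E" using hxy[OF x(1)] x x' by (auto simp: nb_def)
    ultimately show False using triangle_join_pairs_012I[OF h3] no2[OF R] by blast
  qed
  have J2: "4 \<le> card (nb E v \<inter> {..<a})" if v: "a \<le> v" "v < 7" "4 \<le> a" for v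
    using J[OF v(1,2)] realizes_deg[OF R, of v] dv[OF v(2)] v n by (auto simp: Int_absorb2 Int_absorb1)
  consider "a = 3" | "a = 4" | "a = 5" | "a = 6" using a by linarith
  then show False
  proof cases
    case 1
    let ?H = "hub_edges 3 7 \<union> {{3, 4}, {5, 6}}"
    obtain F where MF: "maximal ?H F" and sub: "E \<inter> ?H \<subseteq> F" using maximal_exists[OF R] by blast
    note RF = maximal_realizes[OF MF]
    have J3: "{..<3} \<subseteq> nb E v" if v: "3 \<le> v" "v < 7" for v
    proof (rule ccontr)
      assume "\<not> ?thesis"
      then have "nb E v \<subseteq> {..<3}" using J[of v] v 1 by auto
      then have "card (nb E v) \<le> 3" using card_mono[of "{..<3}" "nb E v"] by simp
      then show False using realizes_deg[OF R, of v] dv[OF v(2)] v n by simp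
    qed
    have hubF: "hub_edges 3 7 \<subseteq> F"
    proof -
      have "{i, j} \<in> E" if "i < 3" "j < 7" "i \<noteq> j" for i j
        using that clE[of i j] J3[of j] 1 by (cases "j < 3") (auto simp: nb_def insert_commute)
      then have "hub_edges 3 7 \<subseteq> E" by (auto simp: hub_edges_def)
      then show ?thesis using sub by blast
    qed
    have "universal7 F"
    proof (rule universal7_of_matching[OF RF n hubF dv])
      fix p q x y
      assume pq: "(p, q) \<in> {(3, 4), (5, 6)}" "{p, q} \<notin> F" and xy: "{p, x} \<in> F" "{q, y} \<in> F" "3 \<le> x" "3 \<le> y"
      have H: "{p, q} \<in> ?H" "{p, x} \<notin> ?H" "{q, y} \<notin> ?H" "p \<noteq> q" "p < 7" "q < 7"
        using pq xy by (auto simp: hub_edges_iff doubleton_eq_iff insert_commute)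
      have dxy: "d x \<le> 2 * 7 - 5" "d y \<le> 2 * 7 - 5"
        using L[of x] L[of y] xy 1 realizes_edgeD[OF RF xy(1)] realizes_edgeD[OF RF xy(2)] by auto
      have out: "{i, w} \<notin> ?H" if "7 \<le> w" for i w
        using that by (auto simp: hub_edges_iff doubleton_eq_iff)
      have "{i, x} \<in> F" if "i < 3" for i
        using hub_joined[OF MF H(1) pq(2) H(4,6) n _ _ _ _ out xy(1) H(2) xy(2) H(3) dxy(2), of i] that xy B[of i]
        by simp
      moreover have "{i, y} \<in> F" if "i < 3" for i
      proof -
        have "{q, p} \<in> ?H" "{q, p} \<notin> F"
          using H(1) pq(2) unfolding insert_commute[of q p "{}"] by blast+
        then show ?thesis
          using hub_joined[OF MF _ _ _ H(5) n _ _ _ _ out xy(2) H(3) xy(1) H(2) dxy(1), of i] that xy B[of i] H(4)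
          by simp
      qed
      moreover have "x = y \<or> {x, y} \<in> F"
        by (rule maximal_two_swap[OF MF H(1) pq(2) H(4) xy(1) H(2) xy(2) H(3)])
      ultimately show "(x = y \<or> {x, y} \<in> F) \<and> (\<forall>i<3. {i, x} \<in> F \<and> {i, y} \<in> F)" by blast
    qed
    then show False using no RF by blast
  next
    case 2
    have "{..<4} \<subseteq> nb E v" if "4 \<le> v" "v < 7" for v
      using J2[of v] that 2 card_seteq[of "{..<4}" "nb E v \<inter> {..<4}"] by auto
    then have "c \<in> nb E v" if "4 \<le> v" "v < 7" "c < 4" for c v using that by blast
    then have "{c, v} \<in> E" if "4 \<le> v" "v < 7" "c < 4" for c v
      using that by (metis in_nb_iff insert_commute)
    then have "clique_join_triple E"
      using cl 2 by (intro clique_join_tripleI[of "{..<4}" E 4 5 6]) auto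
    then show False using no3 R by blast
  next
    case 3
    have "\<exists>i<5. {..<5} - {i} \<subseteq> nb E v" if "5 \<le> v" "v < 7" for v
    proof -
      have "card ({..<5} - nb E v) \<le> 1"
        using J2[of v] that 3 card_Diff_subset_Int[of "{..<5}" "nb E v"] fin by (simp add: Int_commute)
      then have "{..<5} - nb E v = {} \<or> (\<exists>i. {..<5} - nb E v = {i})"
        by (metis card_0_eq card_1_singletonE finite_Diff finite_lessThan le_SucE One_nat_def le_zero_eq)
      then show ?thesis
      proof
        assume "{..<5} - nb E v = {}"
        then show ?thesis by (intro exI[of _ 0]) auto
      next
        assume "\<exists>i. {..<5} - nb E v = {i}"
        then show ?thesis by blast
      qed
    qed
    from this[of 5] this[of 6] obtain i j
      where i: "i < 5" "{..<5} - {i} \<subseteq> nb E 5" and j: "j < 5" "{..<5} - {j} \<subseteq> nb E 6" by auto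
    have e5: "{c, 5} \<in> E" if "c < 5" "c \<noteq> i" for c
    proof -
      have "c \<in> nb E 5" using i(2) that by auto
      then show ?thesis by (simp add: in_nb_iff insert_commute)
    qed
    have e6: "{c, 6} \<in> E" if "c < 5" "c \<noteq> j" for c
    proof -
      have "c \<in> nb E 6" using j(2) that by auto
      then show ?thesis by (simp add: in_nb_iff insert_commute)
    qed
    \<comment> \<open>Vertices 5 and 6 miss at most one vertex each of the clique on five vertices.
      If both miss \<open>i\<close>, the other four are joined to 5, 6 and \<open>i\<close>; if they
      miss different ones, 5 is paired with \<open>j\<close> and 6 with \<open>i\<close>.\<close>
    show False
    proof (cases "i = j")
      case True
      have "card ({..<5} - {i}) = 4" using i by simp
      then have "clique_join_triple E"
        using cl 3 True e5 e6 clE i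
        by (intro clique_join_tripleI[of "{..<5} - {i}" E 5 6 i]) (auto simp: clique_def)
      then show False using no3 R by blast
    next
      case False
      have "card ({..<5} - {i, j}) = 3" using i j False by (simp add: card_Diff_subset)
      then have "triangle_join_pairs E"
        using cl 3 False e5 e6 clE i j
        by (intro triangle_join_pairsI[of "{..<5} - {i, j}" E 5 j 6 i]) (auto simp: clique_def insert_commute)
      then show False using no2 R by blast
    qed
  next
    case 4
    have "\<not> card (nb E 6 \<inter> {..<6}) \<le> Suc 0" using J2[of 6] 4 by simp
    then obtain p q where "p \<in> nb E 6 \<inter> {..<6}" "q \<in> nb E 6 \<inter> {..<6}" "p \<noteq> q"
      by (metis card_le_Suc0_iff_eq fin finite_Int)
    then have "clique_plus 7 E"
      using cl 4 by (intro clique_plusI[of "{..<6}" 7 E 6 p q]) (auto simp: nb_def)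
    then show False using no1 R by blast
  qed
qed

text \<open>By the exchange of three edges in both orientations, an unwanted edge meets the closed
  neighbourhood of \<open>x\<close> or lies inside that of \<open>y\<close>. The former has at most
  five vertices, each with at most four edges; inside the latter half of the degree sum counts, 4(d
  y + 1)/2.\<close>

lemma low_edge_count:
  assumes M: "maximal H E" and uv: "{u, v} \<in> H" "{u, v} \<notin> E" "u \<noteq> v"
    and x: "{u, x} \<in> E" "{u, x} \<notin> H" "d x \<le> 4" and y: "{v, y} \<in> E" "{v, y} \<notin> H"
    and low: "\<And>z. m \<le> z \<Longrightarrow> z < n \<Longrightarrow> d z \<le> 4"
  shows "card (E \<inter> edges_on {m..<n} - H) \<le> 20 + 2 * (d y + 1)"
proof -
  note R = maximal_realizes[OF M]
  have fin: "finite (nb E z)" for z by (rule realizes_finite_nb[OF R])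
  let ?P = "{m..<n}"
  define F where "F = E \<inter> edges_on ?P - H"
  have F: "F \<subseteq> edges_on ?P" by (auto simp: F_def)
  have finF: "finite F" using realizes_finite[OF R] by (simp add: F_def)
  have deg: "card (nb F z) \<le> 4" if "z \<in> ?P" for z
  proof -
    have "card (nb F z) \<le> card (nb E z)" using fin by (intro card_mono) (auto simp: F_def nb_def)
    then show ?thesis using realizes_deg[OF R, of z] low[of z] that by simp
  qed
  define S where "S = insert x (nb E x) \<inter> ?P"
  define T where "T = insert y (nb E y) \<inter> ?P"
  have xn: "x < n" and yn: "y < n" using realizes_edgeD[OF R x(1)] realizes_edgeD[OF R y(1)] by auto
  have c: "card (insert z (nb E z) \<inter> ?P) \<le> d z + 1" if "z < n" for z
  proof -
    have "card (insert z (nb E z) \<inter> ?P) \<le> card (insert z (nb E z))" using fin by (intro card_mono) auto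
    also have "\<dots> \<le> d z + 1" using realizes_deg[OF R that] fin by (simp add: card_insert_if)
    finally show ?thesis .
  qed
  have cS: "card S \<le> 5" using c[OF xn] x(3) by (simp add: S_def)
  have cT: "card T \<le> d y + 1" using c[OF yn] by (simp add: T_def)
  have ST: "finite S" "S \<subseteq> ?P" "finite T" "T \<subseteq> ?P" by (auto simp: S_def T_def)
  have "F \<subseteq> {e \<in> F. e \<inter> S \<noteq> {}} \<union> (F \<inter> edges_on T)"
  proof
    fix e assume e: "e \<in> F"
    then have "e \<in> edges_on ?P" using F by blast
    then obtain p q where pq: "e = {p, q}" "p \<in> ?P" "q \<in> ?P" "p \<noteq> q" by (rule edges_on_cases)
    have E: "{p, q} \<in> E" "{p, q} \<notin> H" "{q, p} \<in> E" "{q, p} \<notin> H"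
      using e pq(1) by (auto simp: F_def insert_commute)
    have "p \<in> insert x (nb E x) \<or> q \<in> insert y (nb E y)"
      using maximal_three_swap[OF M uv x(1,2) y E(1,2)] by (auto simp: nb_def)
    moreover have "q \<in> insert x (nb E x) \<or> p \<in> insert y (nb E y)"
      using maximal_three_swap[OF M uv x(1,2) y E(3,4)] by (auto simp: nb_def)
    ultimately have "p \<in> S \<or> q \<in> S \<or> (p \<in> T \<and> q \<in> T)"
      using pq unfolding S_def T_def by blast
    then show "e \<in> {e \<in> F. e \<inter> S \<noteq> {}} \<union> (F \<inter> edges_on T)"
      using e pq by auto
  qed
  then have "card F \<le> card ({e \<in> F. e \<inter> S \<noteq> {}} \<union> (F \<inter> edges_on T))"
    using finF by (intro card_mono) auto
  also have "\<dots> \<le> card {e \<in> F. e \<inter> S \<noteq> {}} + card (F \<inter> edges_on T)" by (rule card_Un_le)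
  finally have 1: "card F \<le> card {e \<in> F. e \<inter> S \<noteq> {}} + card (F \<inter> edges_on T)" .
  have 2: "card {e \<in> F. e \<inter> S \<noteq> {}} \<le> card S * 4"
    by (rule card_edges_touching[OF F _ ST(1,2) deg]) auto
  have "2 * card (F \<inter> edges_on T) \<le> card T * 4"
    by (rule card_edges_within[OF F _ ST(3,4) deg]) auto
  then have 3: "card (F \<inter> edges_on T) \<le> 2 * card T" by simp
  have "card F \<le> card S * 4 + 2 * card T"
    by (rule order_trans[OF 1 add_mono[OF 2 3]])
  also have "\<dots> \<le> 5 * 4 + 2 * (d y + 1)"
    by (rule add_mono[OF mult_right_mono[OF cS] mult_left_mono[OF cT]]) simp_all
  finally show ?thesis unfolding F_def by simp
qed

text \<open>Counting replaces the very large degrees: 51 edges avoid the first five vertices, while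
  a missing hub edge allows only 20 + 2 * 15 = 50.\<close>

lemma universal7_low:
  assumes E\<^sub>0: "realizes E\<^sub>0" and n: "93 \<le> n" and s: "6 * (n - 1) < (\<Sum>i<n. d i)"
    and d: "6 \<le> d 2" "d 2 \<le> 14" "d 5 \<le> 4" "4 \<le> d 6"
  shows "\<exists>E. realizes E \<and> universal7 E"
proof -
  have low: "d z \<le> 4" if "5 \<le> z" "z < n" for z using mono[OF that] d(3) by simp
  have mid: "d z \<le> 14" if "2 \<le> z" "z < n" for z using mono[OF that] d(2) by simp
  have dv: "4 \<le> d v" if "v < 7" for v using mono[of v 6] d(4) that n by simp
  \<comment> \<open>Of at least 3n - 2 edges at most 2(n - 1) + 3 * 14 meet the first five vertices.
    The remaining n - 42 are 51 for n = 93, again just enough.\<close>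
  have many: "51 \<le> card (E \<inter> edges_on {5..<n})" if R: "realizes E" for E
  proof -
    have "{..<5} \<subseteq> {..<n}" "{..<n} - {..<5} = {5..<n}" using n by auto
    then have "(\<Sum>i<5. d i) + card (E \<inter> edges_on {5..<n}) = card E + card (E \<inter> edges_on {..<5})"
      using sum_degrees_split[OF R, of "{..<5}"] by simp
    moreover have "(\<Sum>i<5. d i) = d 0 + d 1 + d 2 + d 3 + d 4" by (simp add: eval_nat_numeral)
    moreover have "d 0 \<le> n - 1" "d 1 \<le> n - 1" using deg_le[OF R] n by simp_all
    moreover have "d 2 \<le> 14" "d 3 \<le> 14" "d 4 \<le> 14" using mid n by simp_all
    moreover have "6 * (n - 1) < 2 * card E" using s sum_degrees[OF R] by simp
    ultimately show ?thesis using n by linarith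
  qed
  obtain E where M: "maximal (hub_edges 3 7) E" using maximal_exists[OF E\<^sub>0] by blast
  note R = maximal_realizes[OF M]
  have dis: "E' \<inter> edges_on {5..<n} - hub_edges 3 7 = E' \<inter> edges_on {5..<n}" for E'
    by (auto simp: hub_edges_def edges_on_def doubleton_eq_iff)
  have outer: "\<exists>x\<ge>7. {u, x} \<in> E" if "u < 3" "v < 7" "u \<noteq> v" "{u, v} \<notin> E" for u v
  proof -
    have "d u \<le> card (nb E u - {..<7}) + (7 - 2)"
      using that n by (intro deg_le_outside_missing[OF R, of u 7 v]) auto
    moreover have "6 \<le> d u" using mono[of u 2] d(1) that n by simp
    ultimately have "card (nb E u - {..<7}) \<noteq> 0" by linarith
    then obtain x where "x \<in> nb E u - {..<7}" by (metis card.empty ex_in_conv)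
    then show ?thesis by (auto simp: nb_def not_less)
  qed
  have hub: "{u, v} \<in> E" if uv: "u < 3" "v < 7" "u \<noteq> v" for u v
  proof (rule ccontr)
    assume neg: "{u, v} \<notin> E"
    obtain x where x: "7 \<le> x" "{u, x} \<in> E" using outer[OF uv neg] by blast
    have "\<exists>y. {v, y} \<in> E \<and> {v, y} \<notin> hub_edges 3 7 \<and> 3 \<le> y"
    proof (cases "v < 3")
      case True
      then obtain y where "7 \<le> y" "{v, y} \<in> E"
        using outer[of v u] uv neg by (auto simp: insert_commute)
      then show ?thesis by (intro exI[of _ y]) (auto simp: hub_edges_iff)
    next
      case False
      have "nb E v \<inter> {..<3} \<subseteq> {..<3} - {u}" using neg by (auto simp: nb_def insert_commute)
      then have "d v \<le> card (nb E v - {..<3}) + card ({..<3} - {u})"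
        using uv n by (intro deg_le_outside[OF R]) auto
      moreover have "card ({..<3} - {u}) = 2" using uv by simp
      ultimately have "card (nb E v - {..<3}) \<noteq> 0" using dv[OF uv(2)] by linarith
      then obtain y where "y \<in> nb E v - {..<3}" by (metis card.empty ex_in_conv)
      then show ?thesis using False by (intro exI[of _ y]) (auto simp: hub_edges_iff nb_def)
    qed
    then obtain y where y: "{v, y} \<in> E" "{v, y} \<notin> hub_edges 3 7" "3 \<le> y" by blast
    have H: "{u, v} \<in> hub_edges 3 7" "{u, x} \<notin> hub_edges 3 7" using uv x by (auto simp: hub_edges_iff)
    have "d x \<le> 4" "d y \<le> 14"
      using low[of x] mid[of y] x y realizes_edgeD[OF R x(2)] realizes_edgeD[OF R y(1)] by auto
    then show False
      using low_edge_count[where m = 5, OF M H(1) neg uv(3) x(2) H(2) _ y(1,2) low] many[OF R] dis[of E] by simp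
  qed
  let ?H = "hub_edges 3 7 \<union> {{3, 4}, {5, 6}}"
  obtain F where MF: "maximal ?H F" and sub: "E \<inter> ?H \<subseteq> F" using maximal_exists[OF R] by blast
  note RF = maximal_realizes[OF MF]
  have hubF: "hub_edges 3 7 \<subseteq> F"
  proof -
    have "hub_edges 3 7 \<subseteq> E" using hub by (auto simp: hub_edges_def)
    then show ?thesis using sub by blast
  qed
  \<comment> \<open>The only wanted edge in the counted set is \<open>{5, 6}\<close>. If
    \<open>{3, 4}\<close> is the missing edge, it may add one to the count, but then
    \<open>y\<close> has degree at most 4; if it is missing itself, it adds nothing.\<close>
  have cnt: False if H: "{p, q} \<in> ?H" "{p, q} \<notin> F" "p \<noteq> q" and x: "{p, x} \<in> F" "{p, x} \<notin> ?H" "5 \<le> x"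
    and y: "{q, y} \<in> F" "{q, y} \<notin> ?H" and y3: "3 \<le> y" and y5: "{p, q} = {3, 4} \<Longrightarrow> 5 \<le> y" and pq: "{p, q} = {3, 4} \<or> {p, q} = {5, 6}"
    for p q x y
  proof -
    have "x < n" "y < n" using realizes_edgeD[OF RF x(1)] realizes_edgeD[OF RF y(1)] by auto
    then have dx: "d x \<le> 4" and dy: "d y \<le> 14" "5 \<le> y \<Longrightarrow> d y \<le> 4"
      using low[of x] mid[of y] low[of y] x(3) y3 by simp_all
    have c: "card (F \<inter> edges_on {5..<n} - ?H) \<le> 20 + 2 * (d y + 1)"
      by (rule low_edge_count[OF MF H x(1,2) dx y low])
    have "F \<inter> edges_on {5..<n} \<subseteq> (F \<inter> edges_on {5..<n} - ?H) \<union> (F \<inter> {{5, 6}})"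
    proof -
      have "{3, 4} \<notin> edges_on {5..<n}" by simp
      then show ?thesis using dis[of F] by blast
    qed
    then have "card (F \<inter> edges_on {5..<n}) \<le> card ((F \<inter> edges_on {5..<n} - ?H) \<union> (F \<inter> {{5, 6}}))"
      using realizes_finite[OF RF] by (intro card_mono) auto
    also have "\<dots> \<le> card (F \<inter> edges_on {5..<n} - ?H) + card (F \<inter> {{5, 6}})" by (rule card_Un_le)
    finally have c2: "51 \<le> card (F \<inter> edges_on {5..<n} - ?H) + card (F \<inter> {{5, 6}})"
      using many[OF RF] by linarith
    show False
    proof (cases "{p, q} = {3, 4}")
      case True
      have "card (F \<inter> {{5, 6}}) \<le> card {{5, 6::nat}}" by (intro card_mono) auto
      then show False using c c2 dy(2)[OF y5[OF True]] by simp
    next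
      case False
      then have "F \<inter> {{5, 6}} = {}" using pq H(2) by auto
      then show False using c c2 dy(1) by simp
    qed
  qed
  have "universal7 F"
  proof (rule universal7_of_matching[OF RF _ hubF dv])
    show "7 \<le> n" using n by simp
    fix p q x y
    assume pq: "(p, q) \<in> {(3, 4), (5, 6)}" "{p, q} \<notin> F" and xy: "{p, x} \<in> F" "{q, y} \<in> F" "3 \<le> x" "3 \<le> y"
    have H: "{p, q} \<in> ?H" "{p, x} \<notin> ?H" "{q, y} \<notin> ?H" "p \<noteq> q"
      using pq xy by (auto simp: hub_edges_iff doubleton_eq_iff insert_commute)
    have qp: "{q, p} = {p, q}" by auto
    have ne: "x \<noteq> p" "x \<noteq> q" "y \<noteq> p" "y \<noteq> q"
      using realizes_edgeD(3)[OF RF xy(1)] realizes_edgeD(3)[OF RF xy(2)] pq(2) xy(1,2) qp by auto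
    have or: "{p, q} = {3, 4} \<or> {p, q} = {5, 6}" using pq(1) by auto
    have five: "5 \<le> x \<and> 5 \<le> y" if eq: "{p, q} = {3, 4}"
    proof -
      have "p = 3 \<and> q = 4 \<or> p = 4 \<and> q = 3" using eq by (simp only: doubleton_eq_iff)
      then show ?thesis using ne xy(3,4) by linarith
    qed
    \<comment> \<open>A missing \<open>{3, 4}\<close> is thereby refuted altogether. For a missing
      \<open>{5, 6}\<close> both \<open>x\<close> and \<open>y\<close> must be 3 or 4, whose edges
      to 0, 1, 2 are hub edges.\<close>
    have "\<not> 5 \<le> x"
    proof
      assume "5 \<le> x"
      then show False
        by (rule cnt[OF H(1) pq(2) H(4) xy(1) H(2) _ xy(2) H(3) xy(4) conjunct2[OF five] or])
    qed
    moreover have "\<not> 5 \<le> y"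
    proof
      assume y5: "5 \<le> y"
      show False
        by (rule cnt[of q p y x, unfolded qp, OF H(1) pq(2) not_sym[OF H(4)] xy(2) H(3) y5 xy(1) H(2) xy(3)
          conjunct1[OF five] or])
    qed
    ultimately have "x < 7" "y < 7" by simp_all
    then have "\<forall>i<3. {i, x} \<in> F \<and> {i, y} \<in> F"
      using hubF xy(3,4) by (auto simp: hub_edges_iff subset_iff)
    moreover have "x = y \<or> {x, y} \<in> F"
      by (rule maximal_two_swap[OF MF H(1) pq(2) H(4) xy(1) H(2) xy(2) H(3)])
    ultimately show "(x = y \<or> {x, y} \<in> F) \<and> (\<forall>i<3. {i, x} \<in> F \<and> {i, y} \<in> F)" by blast
  qed
  then show ?thesis using RF by blast
qed

section \<open>Choosing the regime for k = 7 and k = 5\<close>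

lemma universal7_exists:
  assumes E: "realizes E" and n: "93 \<le> n" and s: "6 * (n - 1) < (\<Sum>i<n. d i)"
  shows "\<exists>E. realizes E \<and> universal7 E"
proof -
  have d6: "4 \<le> d 6"
  proof (rule ccontr)
    assume "\<not> 4 \<le> d 6"
    then have "(\<Sum>i<n. d i) \<le> 6 * 5 + 2 * 3 * (n - 6)"
      using sum_degrees_le[OF E, of 7 3] n by simp
    then show False using s n by simp
  qed
  have d1: "6 \<le> d 1" using second_degree_ge[OF E, of 7] s n by simp
  consider "15 \<le> d 2" | "d 2 \<le> 14" "5 \<le> d 5" | "d 2 \<le> 14" "d 5 \<le> 4" by linarith
  then show ?thesis
  proof cases
    case 1
    have "7 \<le> n" using n by simp
    then show ?thesis by (rule universal7_big[OF E _ 1 d6])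
  next
    case 2
    show ?thesis
      using clique_plus_7[OF E n s 2(1) d1 2(2) d6] unfolding universal7_def by blast
  next
    case 3
    \<comment> \<open>Otherwise the sum would be at most 2(n - 1) + 3 * 5 + 4(n - 5) = 6n -
      7.\<close>
    have "6 \<le> d 2"
    proof (rule ccontr)
      assume neg: "\<not> ?thesis"
      have "(\<Sum>i<n. d i) = (\<Sum>i<5. d i) + (\<Sum>i=5..<n. d i)"
        using n by (simp add: lessThan_atLeast0 sum.atLeastLessThan_concat)
      also have "(\<Sum>i=5..<n. d i) \<le> (\<Sum>i=5..<n. 4)"
      proof (rule sum_mono)
        fix i assume "i \<in> {5..<n}"
        then show "d i \<le> 4" using mono[of 5 i] 3(2) by simp
      qed
      also have "(\<Sum>i<5. d i) = d 0 + d 1 + d 2 + d 3 + d 4" by (simp add: eval_nat_numeral)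
      finally have "(\<Sum>i<n. d i) \<le> d 0 + d 1 + d 2 + d 3 + d 4 + 4 * (n - 5)" by simp
      moreover have "d 0 \<le> n - 1" "d 1 \<le> n - 1" using deg_le[OF E] n by simp_all
      moreover have "d 3 \<le> d 2" "d 4 \<le> d 2" using mono n by simp_all
      ultimately show False using s neg n by linarith
    qed
    then show ?thesis by (rule universal7_low[OF E n s _ 3 d6])
  qed
qed

lemma clique_plus_5_exists:
  assumes E: "realizes E" and n: "24 \<le> n" and s: "4 * (n - 1) < (\<Sum>i<n. d i)"
  shows "\<exists>E. realizes E \<and> clique_plus 5 E"
proof -
  have d4: "3 \<le> d 4"
  proof (rule ccontr)
    assume "\<not> 3 \<le> d 4"
    then have "(\<Sum>i<n. d i) \<le> 4 * 3 + 2 * 2 * (n - 4)"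
      using sum_degrees_le[OF E, of 5 2] n by simp
    then show False using s n by simp
  qed
  have d1: "4 \<le> d 1" using second_degree_ge[OF E, of 5] s n by simp
  show ?thesis
  proof (cases "9 \<le> d 1")
    case True
    have "5 \<le> n" using n by simp
    then show ?thesis by (rule clique_plus_5_big[OF E _ True d4])
  next
    case False
    then have "d 1 \<le> 8" by simp
    then show ?thesis by (rule clique_plus_5[OF E n s _ d1 d4])
  qed
qed

section \<open>Three and four vertices\<close>

text \<open>
  Since \<open>d x \<le> d t\<close>, some neighbour of \<open>t\<close> is not in \<open>N[x]\<close>; exchanging it against \<open>u\<close> would add the
  wanted edge \<open>ut\<close>, unless it is reached by the other wanted edge at \<open>t\<close>.
\<close>

lemma exchange_twins:
  assumes M: "maximal H E" and H: "H = edges_on {..<t} \<union> {{u, t}, {u', t}}"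
    and t: "t < n" "u \<noteq> t" "u < t" and ut: "{u, t} \<notin> E" and x: "{u, x} \<in> E" "t < x"
  shows "nb E t - insert x (nb E x) = {u'}" and "nb E x - insert t (nb E t) = {u}"
proof -
  note R = maximal_realizes[OF M]
  have fin: "finite (nb E z)" for z by (rule realizes_finite_nb[OF R])
  let ?T = "nb E t - insert x (nb E x)" and ?X = "nb E x - insert t (nb E t)"
  have xn: "x < n" using realizes_edgeD[OF R x(1)] by simp
  have irr: "z \<notin> nb E z" for z using realizes_nb[OF R, of z] by auto
  have sym: "x \<in> nb E t \<longleftrightarrow> t \<in> nb E x" by (rule nb_sym)
  have T: "?T \<subseteq> {u'}"
  proof
    fix s assume s: "s \<in> ?T"
    then have e: "{t, s} \<in> E" by (simp add: nb_def)
    have "{t, s} \<in> H"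
    proof (rule ccontr)
      assume neg: "{t, s} \<notin> H"
      have "{u, t} \<in> H" "{u, x} \<notin> H" using H x t by (auto simp: doubleton_eq_iff)
      then have "x = s \<or> {x, s} \<in> E" using maximal_two_swap[OF M _ ut t(2) x(1) _ e neg] by simp
      then show False using s by (auto simp: nb_def)
    qed
    then have "s = u \<or> s = u'" using H t by (auto simp: doubleton_eq_iff)
    moreover have "s \<noteq> u" using e ut by (auto simp: insert_commute)
    ultimately show "s \<in> {u'}" by simp
  qed
  have dt: "card (nb E t - {x}) = card ?T + card (nb E t \<inter> nb E x)"
  proof -
    have "nb E t - {x} = ?T \<union> (nb E t \<inter> nb E x)" using irr by auto
    then show ?thesis using fin card_Un_disjoint[of ?T "nb E t \<inter> nb E x"] by auto
  qed
  have dx: "card (nb E x - {t}) = card ?X + card (nb E t \<inter> nb E x)"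
  proof -
    have "nb E x - {t} = ?X \<union> (nb E t \<inter> nb E x)" using irr by auto
    then show ?thesis using fin card_Un_disjoint[of ?X "nb E t \<inter> nb E x"] by auto
  qed
  have "d x \<le> d t" using mono[of t x] x(2) xn by simp
  then have "card (nb E x - {t}) \<le> card (nb E t - {x})"
    using realizes_deg[OF R t(1)] realizes_deg[OF R xn] sym fin
    by (cases "x \<in> nb E t") (auto simp: card_Diff_singleton)
  then have le: "card ?X \<le> card ?T" using dt dx by linarith
  have uX: "u \<in> ?X" using x ut t by (auto simp: nb_def insert_commute)
  then have "1 \<le> card ?X" using fin card_gt_0_iff[of ?X] by (metis One_nat_def Suc_leI empty_iff finite_Diff)
  moreover have "card ?T \<le> 1" using T card_mono[of "{u'}" ?T] by simp
  ultimately have 1: "card ?T = 1" "card ?X = 1" using le by linarith+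
  show "?T = {u'}" using T 1(1) by (metis card.empty subset_singletonD zero_neq_one)
  show "?X = {u}" using uX 1(2) by (metis card_1_singletonE singletonD)
qed

text \<open>The general bounds give \<open>d 2 \<le> 2\<close> and \<open>d 1 = 3\<close>, so the
  degree sum forces \<open>d 0 = n - 1\<close> and the missing pair is \<open>{1, 2}\<close>. A
  neighbour \<open>y\<close> of 2 other than 0 then has neighbours 0 and 2 only, and the exchange
  leaves 0 and \<open>y\<close> as the only possible neighbours of 1.\<close>

lemma clique_3_step:
  assumes E\<^sub>0: "realizes E\<^sub>0" and n: "5 \<le> n" and s: "3 * (n - 1) < (\<Sum>i<n. d i)"
    and d: "3 \<le> d 1" "2 \<le> d 3" and no: "\<And>E. realizes E \<Longrightarrow> \<not> clique_plus 4 E"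
  shows "\<exists>E. realizes E \<and> clique E {..<3}"
proof -
  obtain E where M: "maximal (edges_on {..<3}) E" using maximal_exists[OF E\<^sub>0] by blast
  note R = maximal_realizes[OF M]
  have fin: "finite (nb E z)" for z by (rule realizes_finite_nb[OF R])
  have d2: "2 \<le> d 2" using d(2) mono[of 2 3] n by simp
  have "clique E {..<3}"
  proof (rule ccontr)
    assume "\<not> ?thesis"
    then obtain u v where uv: "u < v" "v < 3" "{u, v} \<notin> E" by (rule missing_pair_less)
    have 4: "4 \<le> n" using n by simp
    note miss = missing_clique_edge[of 4 E, simplified, OF M 4 d2 no[OF R]]
    have small: "d 2 \<le> 2" using miss(1)[of u v] uv mono[of u 2] mono[of v 2] n by auto
    have du: "d u \<le> 3" using miss(2)[of u v] uv by simp
    have d1: "d 1 = 3" using du mono[of u 1] uv n d(1) by simp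
    have low: "d i \<le> 2" if "2 \<le> i" "i < n" for i using mono[OF that] small by simp
    have sum: "(\<Sum>i<n. d i) \<le> d 0 + 3 + 2 * (n - 2)"
    proof -
      have "(\<Sum>i<n. d i) = (\<Sum>i<2. d i) + (\<Sum>i=2..<n. d i)"
        using n by (simp add: lessThan_atLeast0 sum.atLeastLessThan_concat)
      also have "(\<Sum>i<2. d i) = d 0 + d 1" by (simp add: eval_nat_numeral)
      also have "(\<Sum>i=2..<n. d i) \<le> (\<Sum>i=2..<n. 2)" using low by (intro sum_mono) auto
      finally show ?thesis using d1 by simp
    qed
    have "u \<noteq> 0"
    proof
      assume "u = 0"
      then show False using du sum s n by simp
    qed
    then have uv12: "u = 1" "v = 2" using uv by auto
    have "d 0 = n - 1" using sum s n deg_le[OF R, of 0] by simp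
    then have nb0: "nb E 0 = {..<n} - {0}"
      using realizes_deg[OF R, of 0] realizes_nb[OF R, of 0] n by (intro card_seteq) auto
    have "\<not> nb E 2 \<subseteq> {0}" using card_mono[of "{0}" "nb E 2"] realizes_deg[OF R, of 2] d2 n by auto
    then obtain y where y: "{2, y} \<in> E" "y \<noteq> 0" by (auto simp: nb_def)
    have "y \<noteq> 1" "y \<noteq> 2"
      using y uv(3) uv12 realizes_edgeD(3)[OF R y(1)] by (auto simp: insert_commute)
    then have y3: "3 \<le> y" using y(2) by linarith
    have yn: "y < n" using realizes_edgeD[OF R y(1)] by simp
    have "y \<in> nb E 0" unfolding nb0 using y(2) yn by simp
    then have "{0, 2} \<subseteq> nb E y" using y(1) by (simp add: in_nb_iff insert_commute)
    then have nby: "nb E y = {0, 2}"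
      using card_seteq[of "nb E y" "{0, 2}"] realizes_deg[OF R yn] low[of y] y3 yn fin by simp
    have *: "x = y" if x: "{1, x} \<in> E" "x \<noteq> 0" for x
    proof -
      have x3: "x \<noteq> 1" "x \<noteq> 2" using x(1) uv(3) uv12 realizes_edgeD(3)[OF R x(1)] by auto
      have "{1, x} \<notin> edges_on {..<3}" "{2, y} \<notin> edges_on {..<3}" using x3 x(2) y3 by auto
      then have "x = y \<or> {x, y} \<in> E"
        using maximal_two_swap[OF M, of 1 2 x y] uv uv12 x y by simp
      then have "x = y \<or> x \<in> nb E y" by (auto simp: nb_def insert_commute)
      then show ?thesis using nby x3 x(2) by auto
    qed
    have "nb E 1 \<subseteq> {0, y}" using * by (auto simp: nb_def)
    then have "card (nb E 1) \<le> card {0, y}" by (intro card_mono) auto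
    also have "\<dots> \<le> 2" by (simp add: card_insert_if)
    finally show False using realizes_deg[OF R, of 1] d1 n by simp
  qed
  then show ?thesis using R by blast
qed

text \<open>The count used for k = 5 and k = 7 would allow up to n + 6 edges and is too weak near n
  = 7. Instead the neighbourhoods around the missing edge are determined exactly, until at most nine
  edges remain where ten are required.\<close>

lemma clique_plus_4_exists:
  assumes E\<^sub>0: "realizes E\<^sub>0" and n: "7 \<le> n" and s: "3 * (n - 1) < (\<Sum>i<n. d i)"
  shows "\<exists>E. realizes E \<and> clique_plus 4 E"
proof (rule ccontr)
  assume "\<not> ?thesis"
  then have no: "\<And>E. realizes E \<Longrightarrow> \<not> clique_plus 4 E" by blast
  have d3: "2 \<le> d 3"
  proof (rule ccontr)
    assume "\<not> 2 \<le> d 3"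
    then have "(\<Sum>i<n. d i) \<le> 3 * 2 + 2 * 1 * (n - 3)"
      using sum_degrees_le[OF E\<^sub>0, of 4 1] n by simp
    then show False using s n by simp
  qed
  have d1: "3 \<le> d 1" using second_degree_ge[OF E\<^sub>0, of 4] s n by simp
  obtain E1 where R1: "realizes E1" and cl1: "clique E1 {..<3}"
    using clique_3_step[OF E\<^sub>0 _ s d1 d3 no] n by auto
  define H :: "nat set set" where "H = edges_on {..<3} \<union> {{0, 3}, {1, 3}}"
  obtain E where M: "maximal H E" and sub: "E1 \<inter> H \<subseteq> E"
    using maximal_exists[OF R1] by blast
  note R = maximal_realizes[OF M] and noE = no[OF maximal_realizes[OF M]]
  have fin: "finite (nb E z)" for z by (rule realizes_finite_nb[OF R])
  have cl: "clique E {..<3}" using cl1 sub unfolding clique_def H_def by auto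
  have diamond: False if "{a, b} \<in> E" "{a, c} \<in> E" "{b, c} \<in> E" "{z, a} \<in> E" "{z, b} \<in> E" "z \<noteq> c" for a b c z
  proof -
    have "a \<noteq> b" "a \<noteq> c" "b \<noteq> c" "z \<noteq> a" "z \<noteq> b"
      using realizes_edgeD(3)[OF R that(1)] realizes_edgeD(3)[OF R that(2)] realizes_edgeD(3)[OF R that(3)]
        realizes_edgeD(3)[OF R that(4)] realizes_edgeD(3)[OF R that(5)] by auto
    then have "clique_plus 4 E"
      using that by (intro clique_plusI[of "{a, b, c}" 4 E z a b]) (auto simp: clique_def insert_commute)
    then show False using noE by simp
  qed
  have two: False if z: "3 \<le> z" "{z, a} \<in> E" "{z, b} \<in> E" "a < 3" "b < 3" "a \<noteq> b" for z a b
  proof -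
    have "clique_plus 4 E"
      using that cl by (intro clique_plusI[of "{..<3}" 4 E z a b]) auto
    then show False using noE by simp
  qed
  have one: "card (nb E z \<inter> {..<3}) \<le> 1" if "z \<in> {3..<n}" for z
  proof (rule ccontr)
    assume "\<not> ?thesis"
    then obtain a b where "a \<in> nb E z \<inter> {..<3}" "b \<in> nb E z \<inter> {..<3}" "a \<noteq> b"
      by (metis One_nat_def card_le_Suc0_iff_eq fin finite_Int)
    then show False using two[of z a b] that by (auto simp: nb_def)
  qed
  have "{0, 3} \<notin> E \<or> {1, 3} \<notin> E" using two[of 3 0 1] by (auto simp: insert_commute)
  then obtain u u' :: nat where u: "u < 2" "u' < 2" "u \<noteq> u'" "{u, 3} \<notin> E"
    using that[of 0 1] that[of 1 0] by auto
  have H: "H = edges_on {..<3} \<union> {{u, 3}, {u', 3}}"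
    using u by (auto simp: H_def less_2_cases_iff)
  have uH: "{u, 3} \<in> H" "u \<noteq> 3" "u < 3" using H u by auto
  have tw: "nb E 3 - insert x (nb E x) = {u'}" "nb E x - insert 3 (nb E 3) = {u}"
    if "{u, x} \<in> E" "3 < x" for x
    using exchange_twins[OF M H _ uH(2,3) u(4) that] n by auto
  have "d u \<le> card (nb E u - {..<3}) + (3 - 1)"
    using uH n by (intro deg_le_outside_self[OF R]) auto
  moreover have "3 \<le> d u" using d1 mono[of u 1] u n by simp
  ultimately have "card (nb E u - {..<3}) \<noteq> 0" by linarith
  then obtain x where "x \<in> nb E u - {..<3}" by (metis card.empty ex_in_conv)
  then have ux: "{u, x} \<in> E" and "3 \<le> x" "x \<noteq> 3" using u(4) by (auto simp: nb_def)
  then have x: "3 < x" by simp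
  note twx = tw[OF ux x]
  have uxH: "{u, x} \<notin> H" using x uH(2) by (auto simp: H doubleton_eq_iff)
  have u't: "{3, u'} \<in> E" and u'x: "u' \<notin> nb E x"
  proof -
    have "u' \<in> nb E 3 - insert x (nb E x)" unfolding twx(1) by simp
    then show "{3, u'} \<in> E" "u' \<notin> nb E x" by (auto simp: nb_def)
  qed
  have big: "3 < f" if f: "{3, f} \<in> E" "f \<noteq> u'" for f
  proof (rule ccontr)
    assume "\<not> 3 < f"
    then show False using two[of 3 f u'] f u't u realizes_edgeD(3)[OF R f(1)] by auto
  qed
  have fH: "{3, f} \<notin> H" if "3 < f" for f using that u by (auto simp: H doubleton_eq_iff)
  \<comment> \<open>Otherwise the sum would be at most 6 + (n - 3) + 2(n - 3) = 3(n - 1).\<close>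
  have d3': "3 \<le> d 3"
  proof (rule ccontr)
    assume neg: "\<not> ?thesis"
    have "(\<Sum>i<3. d i) \<le> 3 * (3 - 1) + (n - 3)"
      by (rule edges_outside_clique(2)[OF R _ cl one]) (use n in auto)
    moreover have "(\<Sum>i=3..<n. d i) \<le> (\<Sum>i=3..<n. 2)"
    proof (rule sum_mono)
      fix i assume "i \<in> {3..<n}"
      then show "d i \<le> 2" using mono[of 3 i] neg by simp
    qed
    moreover have "(\<Sum>i<n. d i) = (\<Sum>i<3. d i) + (\<Sum>i=3..<n. d i)"
      using n by (simp add: lessThan_atLeast0 sum.atLeastLessThan_concat)
    ultimately show False using s n by simp
  qed
  have dt: "card (nb E 3) = d 3" using realizes_deg[OF R, of 3] n by simp
  have common: "{x, f} \<in> E" if "{3, f} \<in> E" "f \<noteq> u'" "f \<noteq> x" for f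
    using twx(1) that by (auto simp: nb_def)
  show False
  proof (cases "{3, x} \<in> E")
    case False
    have "\<not> card (nb E 3 - {u'}) \<le> 1" using dt d3' u't by (simp add: card_Diff_singleton nb_def)
    then obtain f g where "f \<in> nb E 3 - {u'}" "g \<in> nb E 3 - {u'}" and ne: "f \<noteq> g"
      by (metis One_nat_def card_le_Suc0_iff_eq fin finite_Diff)
    then have f: "{3, f} \<in> E" "f \<noteq> u'" and g: "{3, g} \<in> E" "g \<noteq> u'" by (auto simp: nb_def)
    have fx: "{x, f} \<in> E" "{x, g} \<in> E" using common f g False by auto
    have x3: "3 \<noteq> x" "{x, 3} \<notin> E" using x False by (auto simp: insert_commute)
    \<comment> \<open>A degenerate exchange of three edges: two of those removed,
      \<open>{3, g}\<close> and \<open>{3, f}\<close>, share vertex 3, which gains \<open>u\<close>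
      and \<open>x\<close>.\<close>
    have "f = g \<or> {g, f} \<in> E"
      by (rule maximal_three_swap[OF M uH(1) u(4) uH(2) ux uxH g(1) fH[OF big[OF g]] f(1) fH[OF big[OF f]] x3])
    then have gf: "{f, g} \<in> E" using ne by (auto simp: insert_commute)
    show False
      by (rule diamond[of f g 3 x]) (use gf f g fx x in \<open>auto simp: insert_commute\<close>)
  next
    case True
    have xu': "x \<noteq> u'" using x u by auto
    have "card (nb E 3 - {u'} - {x}) = d 3 - 2"
      using dt u't True xu' fin by (simp add: card_Diff_singleton nb_def)
    then have "nb E 3 - {u'} - {x} \<noteq> {}" using d3' by (metis card.empty numeral_3_eq_3 numeral_2_eq_2 diff_is_0_eq not_less_eq_eq le_refl)
    then obtain f where f: "{3, f} \<in> E" "f \<noteq> u'" "f \<noteq> x" by (auto simp: nb_def)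
    have fx: "{x, f} \<in> E" by (rule common[OF f])
    have nbt: "nb E 3 = {u', x, f}"
    proof -
      have "g = f" if g: "{3, g} \<in> E" "g \<noteq> u'" "g \<noteq> x" for g
      proof (rule ccontr)
        assume "g \<noteq> f"
        moreover have "{g, 3} \<in> E" "{g, x} \<in> E"
          using g(1) common[OF g] by (simp_all add: insert_commute)
        ultimately show False using diamond[OF True f(1) fx] by blast
      qed
      then have "nb E 3 \<subseteq> {u', x, f}" by (auto simp: in_nb_iff)
      moreover have "{u', x, f} \<subseteq> nb E 3" using u't True f(1) by (simp add: in_nb_iff)
      ultimately show ?thesis by (rule equalityI)
    qed
    have f3: "3 < f" by (rule big[OF f(1,2)])
    have nbx: "nb E x = {u, 3, f}"
    proof
      show "nb E x \<subseteq> {u, 3, f}"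
      proof
        fix z assume z: "z \<in> nb E x"
        show "z \<in> {u, 3, f}"
        proof (cases "z \<in> insert 3 (nb E 3)")
          case True
          moreover have "z \<noteq> u'" using z u'x by blast
          moreover have "z \<noteq> x" using z realizes_nb[OF R, of x] by blast
          ultimately show ?thesis unfolding nbt by simp
        next
          case False
          then have "z \<in> {u}" using z unfolding twx(2)[symmetric] by simp
          then show ?thesis by simp
        qed
      qed
      show "{u, 3, f} \<subseteq> nb E x" using ux True fx by (simp add: in_nb_iff insert_commute)
    qed
    have fn: "f < n" using realizes_edgeD[OF R fx] by simp
    have "d 3 = 3" using dt nbt xu' f by auto
    then have df: "d f \<le> 3" using mono[of 3 f] f3 fn by simp
    have nbu: "nb E u \<subseteq> {..<3} \<union> {x}"
    proof
      fix z assume z: "z \<in> nb E u"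
      show "z \<in> {..<3} \<union> {x}"
      proof (rule ccontr)
        assume neg: "z \<notin> {..<3} \<union> {x}"
        have uz: "{u, z} \<in> E" "z \<noteq> x" "3 \<le> z" using z neg by (auto simp: in_nb_iff)
        then have z3: "3 < z" using u(4) by (cases "z = 3") auto
        have "x \<in> nb E 3" using nbt by simp
        then have "x \<in> insert z (nb E z)" using tw(1)[OF uz(1) z3] xu' by blast
        then have "z \<in> nb E x" using uz(2) by (simp add: in_nb_iff insert_commute)
        then have "z = f" unfolding nbx using z3 u(1) by simp
        then have "{u, f} \<in> E" using uz(1) by simp
        moreover have "{f, u} \<in> E" "{3, f} \<in> E" "{x, u} \<in> E"
          using calculation f(1) ux by (simp_all add: insert_commute)
        ultimately show False
          using diamond[OF fx, of u 3] True f(1) uH(2) by simp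
      qed
    qed
    have g: "card (nb E f - {3, x}) \<le> 1"
    proof -
      have "{3, x} \<subseteq> nb E f" using f(1) fx by (simp add: in_nb_iff insert_commute)
      then have "card (nb E f - {3, x}) = card (nb E f) - card {3, x}" by (intro card_Diff_subset) auto
      then show ?thesis using realizes_deg[OF R fn] df x by simp
    qed
    \<comment> \<open>If \<open>f\<close> has a neighbour besides 3 and \<open>x\<close>, and this
      is the third vertex of the first triangle, these nine edges form the triangular prism, the
      obstruction on six vertices.\<close>
    define C where "C = edges_on {..<3} \<union> {{u', 3}, {u, x}, {3, x}, {3, f}, {x, f}} \<union> (\<lambda>g. {f, g}) ` (nb E f - {3, x})"
    have memC: "{u', 3} \<in> C" "{u, x} \<in> C" "{3, x} \<in> C" "{3, f} \<in> C" "{x, f} \<in> C"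
      and memC': "g \<in> nb E f - {3, x} \<Longrightarrow> {f, g} \<in> C" for g
      unfolding C_def by blast+
    have comm: "{p, q} = {q, p}" for p q :: nat by (rule insert_commute)
    have cover: "E \<subseteq> C"
    proof
      fix e assume e: "e \<in> E"
      then have "e \<in> edges_on {..<n}" using realizes_edges[OF R] by blast
      then obtain a b where ab: "e = {a, b}" "a \<noteq> b" by (rule edges_on_cases)
      have inc: "{p, q} \<in> C" if p: "p \<in> {u, 3, x, f}" and pq: "{p, q} \<in> E" "{p, q} \<notin> H" for p q
      proof -
        have q: "q \<in> nb E p" using pq(1) by (simp add: nb_def)
        consider "p = u" | "p = 3" | "p = x" | "p = f" using p by blast
        then show ?thesis
        proof cases
          case 1
          have "q \<in> {..<3} \<union> {x}" using q nbu 1 by blast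
          moreover have "\<not> q < 3" using pq(2) 1 uH(3) realizes_edgeD(3)[OF R pq(1)] by (auto simp: H)
          ultimately have "q = x" by simp
          then show ?thesis using 1 memC by simp
        next
          case 2
          then have "q = u' \<or> q = x \<or> q = f" using q nbt by simp
          then show ?thesis using 2 memC comm[of 3 u'] by fastforce
        next
          case 3
          then have "q = u \<or> q = 3 \<or> q = f" using q nbx by simp
          then show ?thesis using 3 memC comm[of x u] comm[of x 3] by fastforce
        next
          case 4
          show ?thesis
          proof (cases "q \<in> {3, x}")
            case True
            then show ?thesis using 4 memC comm[of f 3] comm[of f x] by fastforce
          next
            case False
            then show ?thesis using q 4 memC' by simp
          qed
        qed
      qed
      show "e \<in> C"
      proof (cases "e \<in> H")
        case True
        then have "e \<in> edges_on {..<3} \<or> e = {u, 3} \<or> e = {u', 3}" unfolding H by blast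
        then show ?thesis using u(4) e memC(1) by (auto simp: C_def)
      next
        case False
        have e1: "{a, b} \<in> E" "{a, b} \<notin> H" "{b, a} \<in> E" "{b, a} \<notin> H"
          using e False ab by (auto simp: insert_commute)
        have "a \<in> {u, 3, x, f} \<or> b \<in> {u, 3, x, f}"
        proof (rule ccontr)
          assume neg: "\<not> ?thesis"
          have "p \<in> nb E f - {3, x}" if "{q, p} \<in> E" "{q, p} \<notin> H" "q \<notin> {u, 3, x, f}" "p \<notin> {u, 3, x, f}" for p q
          proof -
            have "{x, q} \<notin> E" using nbx that(3) by (auto simp: nb_def)
            then have "p = f \<or> {f, p} \<in> E"
              using maximal_three_swap[OF M uH(1) u(4) uH(2) ux uxH f(1) fH[OF f3] that(1,2)] that(3) by auto
            then show ?thesis using that(4) by (auto simp: nb_def)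
          qed
          then have "a \<in> nb E f - {3, x}" "b \<in> nb E f - {3, x}" using neg e1 by blast+
          then show False using g ab(2) fin by (metis One_nat_def card_le_Suc0_iff_eq finite_Diff)
        qed
        then show ?thesis using inc[of a b] inc[of b a] e1 ab(1) by (metis insert_commute)
      qed
    qed
    have "card C \<le> 9"
    proof -
      let ?A = "edges_on {..<3::nat}" and ?B = "{{u', 3}, {u, x}, {3, x}, {3, f}, {x, f}}"
        and ?D = "(\<lambda>g. {f, g}) ` (nb E f - {3, x})"
      have "card ?A = 3" by (simp add: card_edges_on choose_two)
      moreover have "card ?B \<le> 5" by (simp add: card_insert_if)
      moreover have "card ?D \<le> 1"
        by (rule order_trans[OF card_image_le g]) (use fin in simp)
      moreover have "card C \<le> card (?A \<union> ?B) + card ?D" unfolding C_def by (rule card_Un_le)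
      moreover have "card (?A \<union> ?B) \<le> card ?A + card ?B" by (rule card_Un_le)
      ultimately show ?thesis by linarith
    qed
    moreover have "card E \<le> card C"
      using cover fin by (intro card_mono) (auto simp: C_def intro: finite_edges_on)
    ultimately show False using s sum_degrees[OF R] n by simp
  qed
qed

text \<open>Here \<open>clique_plus 3\<close> is a triangle, and being triangle-free confines all
  edges to a cycle of length 4 or 5 around the missing edge, against at least n edges.\<close>

lemma clique_plus_3_exists:
  assumes E\<^sub>0: "realizes E\<^sub>0" and n: "6 \<le> n" and s: "2 * (n - 1) < (\<Sum>i<n. d i)"
  shows "\<exists>E. realizes E \<and> clique_plus 3 E"
proof (rule ccontr)
  assume "\<not> ?thesis"
  then have no: "\<And>E. realizes E \<Longrightarrow> \<not> clique_plus 3 E" by blast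
  have triangle: False if R: "realizes E" and abc: "{a, b} \<in> E" "{a, c} \<in> E" "{b, c} \<in> E" for E a b c
  proof -
    have "a \<noteq> b" "a \<noteq> c" "b \<noteq> c"
      using realizes_edgeD(3)[OF R abc(1)] realizes_edgeD(3)[OF R abc(2)] realizes_edgeD(3)[OF R abc(3)] by auto
    then have "clique_plus 3 E"
      using abc by (intro clique_plusI[of "{a, b}" 3 E c a b]) (auto simp: clique_def insert_commute)
    then show False using no[OF R] by simp
  qed
  have d2: "2 \<le> d 2"
  proof (rule ccontr)
    assume "\<not> 2 \<le> d 2"
    then have "(\<Sum>i<n. d i) \<le> 2 * 1 + 2 * 1 * (n - 2)"
      using sum_degrees_le[OF E\<^sub>0, of 3 1] n by simp
    then show False using s n by simp
  qed
  have dv: "2 \<le> d v" if "v < 3" for v using mono[of v 2] d2 that n by simp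
  obtain E1 where M1: "maximal {{0, 1}} E1" using maximal_exists[OF E\<^sub>0] by blast
  note R1 = maximal_realizes[OF M1]
  have fin1: "finite (nb E1 z)" for z by (rule realizes_finite_nb[OF R1])
  have e01: "{0, 1} \<in> E1"
  proof (rule ccontr)
    assume neg: "{0, 1} \<notin> E1"
    have c: "\<exists>a b. {v, a} \<in> E1 \<and> {v, b} \<in> E1 \<and> a \<noteq> b" if "v < 3" for v
    proof -
      have "\<not> card (nb E1 v) \<le> Suc 0" using dv[OF that] realizes_deg[OF R1, of v] that n by simp
      then obtain a b where "a \<in> nb E1 v" "b \<in> nb E1 v" "a \<noteq> b"
        using card_le_Suc0_iff_eq[OF fin1, of v] by blast
      then show ?thesis unfolding in_nb_iff by blast
    qed
    have "(0::nat) < 3" "(1::nat) < 3" by simp_all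
    note c0 = c[OF this(1)] and c1 = c[OF this(2)]
    \<comment> \<open>Two neighbours of 0 and two of 1 are non-adjacent pairs by triangle-freeness,
      so the exchange of three edges applies as in \<open>maximal_clique_plus\<close>.\<close>
    obtain a b where ab: "{0, a} \<in> E1" "{0, b} \<in> E1" "a \<noteq> b" using c0 by blast
    obtain p q where pq: "{1, p} \<in> E1" "{1, q} \<in> E1" "p \<noteq> q" using c1 by blast
    have H: "{0, z} \<notin> {{0, 1}}" if "{0, z} \<in> E1" for z using that neg by (metis singletonD)
    have H': "{1, z} \<notin> {{0, 1}}" if "{1, z} \<in> E1" for z using that neg by (metis singletonD)
    have S: "x = y \<or> {x, y} \<in> E1" if "{0, x} \<in> E1" "{1, y} \<in> E1" for x y
      using maximal_two_swap[OF M1 _ neg _ that(1) H[OF that(1)] that(2) H'[OF that(2)]] by simp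
    have nab: "{a, b} \<notin> E1" using triangle[OF R1 ab(1,2)] by blast
    have npq: "{p, q} \<notin> E1" using triangle[OF R1 pq(1,2)] by blast
    have "b \<noteq> q"
    proof
      assume "b = q"
      then have "{a, b} \<in> E1" using S[OF ab(1) pq(2)] ab(3) by simp
      then show False using nab by simp
    qed
    then have bq: "{b, q} \<in> E1" using S[OF ab(2) pq(2)] by simp
    have "b \<noteq> 0" "b \<noteq> 1" using realizes_edgeD(3)[OF R1 ab(2)] ab(2) neg by metis+
    then have "{b, q} \<notin> {{0, 1}}" by (auto simp: doubleton_eq_iff)
    then have "q = p \<or> {p, q} \<in> E1"
      using maximal_three_swap[OF M1 _ neg _ ab(1) H[OF ab(1)] pq(1) H'[OF pq(1)] bq] ab(3) nab by simp
    then show False using npq pq(3) by simp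
  qed
  define H :: "nat set set" where "H = edges_on {..<2} \<union> {{0, 2}, {1, 2}}"
  have two: "edges_on {..<2::nat} = {{0, 1}}"
    by (auto simp: edges_on_def less_2_cases_iff insert_commute)
  obtain E where M: "maximal H E" and sub: "E1 \<inter> H \<subseteq> E"
    using maximal_exists[OF R1] by blast
  note R = maximal_realizes[OF M]
  note tri = triangle[OF R]
  have fin: "finite (nb E z)" for z by (rule realizes_finite_nb[OF R])
  have e01: "{0, 1} \<in> E" using sub e01 two by (auto simp: H_def)
  have "{0, 2} \<notin> E \<or> {1, 2} \<notin> E" using tri[OF e01, of 2] by blast
  then obtain u u' :: nat where u: "u < 2" "u' < 2" "u \<noteq> u'" "{u, 2} \<notin> E"
    using that[of 0 1] that[of 1 0] by auto
  have uu: "{u, u'} = {0, 1}" using u by (auto simp: less_2_cases_iff)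
  have H: "H = edges_on {..<2} \<union> {{u, 2}, {u', 2}}"
    using u by (auto simp: H_def less_2_cases_iff)
  have uH: "{u, 2} \<in> H" "u \<noteq> 2" "u < 2" using H u by auto
  have tw: "nb E 2 - insert x (nb E x) = {u'}" "nb E x - insert 2 (nb E 2) = {u}"
    if "{u, x} \<in> E" "2 < x" for x
    using exchange_twins[OF M H _ uH(2,3) u(4) that] n by auto
  have nbu': "z = u' \<or> 2 < z" if "{u, z} \<in> E" for z
  proof -
    have "z \<noteq> u" "z \<noteq> 2" using realizes_edgeD(3)[OF R that] that u(4) by auto
    then show ?thesis using u by linarith
  qed
  have "\<not> nb E u \<subseteq> {u'}"
    using card_mono[of "{u'}" "nb E u"] realizes_deg[OF R, of u] dv[of u] uH n by auto
  then obtain x where ux: "{u, x} \<in> E" "x \<noteq> u'" unfolding subset_iff in_nb_iff by blast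
  have x: "2 < x" using nbu'[OF ux(1)] ux(2) by simp
  note twx = tw[OF ux(1) x]
  have uxH: "{u, x} \<notin> H" using x uH(2,3) by (auto simp: H doubleton_eq_iff)
  have "u' \<in> nb E 2 - insert x (nb E x)" unfolding twx(1) by simp
  then have u't: "{2, u'} \<in> E" and u'x: "u' \<notin> nb E x" by (auto simp: in_nb_iff)
  have eH: "e = {u, u'} \<or> e = {2, u'}" if "e \<in> H" "e \<in> E" for e
  proof -
    have "e = {u, u'} \<or> e = {u, 2} \<or> e = {u', 2}" using that(1) unfolding H two uu by blast
    then show ?thesis using that(2) u(4) by (auto simp: insert_commute)
  qed
  have fH: "{2, f} \<notin> H" if "{2, f} \<in> E" "f \<noteq> u'" for f
    using eH[of "{2, f}"] that u by (auto simp: doubleton_eq_iff)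
  have common: "{x, f} \<in> E" if "{2, f} \<in> E" "f \<noteq> u'" "f \<noteq> x" for f
  proof (rule ccontr)
    assume "{x, f} \<notin> E"
    then have "f \<in> nb E 2 - insert x (nb E x)" using that by (simp add: in_nb_iff)
    then show False using that(2) twx(1) by simp
  qed
  have nbx: "z = u \<or> z = 2 \<or> {2, z} \<in> E \<and> z \<noteq> u'" if "{x, z} \<in> E" for z
  proof (cases "z \<in> insert 2 (nb E 2)")
    case True
    then show ?thesis using that u'x by (auto simp: in_nb_iff)
  next
    case False
    then have "z \<in> nb E x - insert 2 (nb E 2)" using that by (simp add: in_nb_iff)
    then show ?thesis using twx(2) by simp
  qed
  have en: "n \<le> card E" using s sum_degrees[OF R] n by simp
  have cover: "card E \<le> card C"
    if C: "finite C" "{u, u'} \<in> C" "{2, u'} \<in> C"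
    and S: "\<And>p q. p \<in> S \<Longrightarrow> {p, q} \<in> E \<Longrightarrow> {p, q} \<in> C"
    and out: "\<And>a b. {a, b} \<in> E \<Longrightarrow> {a, b} \<notin> H \<Longrightarrow> a \<in> S \<or> b \<in> S" for C S
  proof (rule card_mono[OF C(1)], rule subsetI)
    fix e assume e: "e \<in> E"
    then have "e \<in> edges_on {..<n}" using realizes_edges[OF R] by blast
    then obtain a b where ab: "e = {a, b}" "a \<noteq> b" by (rule edges_on_cases)
    show "e \<in> C"
    proof (cases "e \<in> H")
      case True
      then show ?thesis using eH[OF _ e] C by blast
    next
      case False
      have ba: "e = {b, a}" using ab by (simp add: insert_commute)
      consider "a \<in> S" | "b \<in> S" using out[of a b] e False ab(1) by blast
      then show ?thesis
      proof cases
        case 1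
        then show ?thesis using S[of a b] e ab(1) by simp
      next
        case 2
        then show ?thesis using S[of b a] e unfolding ba by simp
      qed
    qed
  qed
  have comm: "{p, q} = {q, p}" for p q :: nat by (rule insert_commute)
  show False
  proof (cases "{2, x} \<in> E")
    case True
    have nbt: "z = u' \<or> z = x" if "{2, z} \<in> E" for z
      using common[OF that] tri[OF True that] by blast
    have nbx': "z = u \<or> z = 2" if "{x, z} \<in> E" for z
      using nbx[OF that] nbt[of z] realizes_edgeD(3)[OF R that] by auto
    have nbu: "z = u' \<or> z = x" if z: "{u, z} \<in> E" for z
    proof (rule ccontr)
      assume neg: "\<not> ?thesis"
      then have z2: "2 < z" using nbu'[OF z] by simp
      have "x \<in> nb E 2" using True by (simp add: in_nb_iff)
      then have "x \<in> insert z (nb E z)" using tw(1)[OF z z2] ux(2) by blast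
      then have "{x, z} \<in> E" using neg by (simp add: in_nb_iff insert_commute)
      then show False using nbx'[of z] z2 u by auto
    qed
    \<comment> \<open>The 4-cycle \<open>u\<close>, \<open>u'\<close>, 2, \<open>x\<close>.\<close>
    define C where "C = {{u, u'}, {2, u'}, {u, x}, {2, x}}"
    have C: "finite C" "{u, u'} \<in> C" "{2, u'} \<in> C" "{u, x} \<in> C" "{2, x} \<in> C" by (simp_all add: C_def)
    have "card E \<le> card C"
    proof (rule cover[OF C(1-3), of "{x, u, 2}"])
      show "{p, q} \<in> C" if pS: "p \<in> {x, u, 2}" and pq: "{p, q} \<in> E" for p q
      proof -
        consider "p = x" | "p = u" | "p = 2" using pS by blast
        then show ?thesis
        proof cases
          case 1
          then show ?thesis using nbx'[of q] pq C comm[of x u] comm[of x 2] by auto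
        next
          case 2
          then show ?thesis using nbu[of q] pq C by auto
        next
          case 3
          then show ?thesis using nbt[of q] pq C by auto
        qed
      qed
      show "a \<in> {x, u, 2} \<or> b \<in> {x, u, 2}" if ab': "{a, b} \<in> E" "{a, b} \<notin> H" for a b
      proof (rule ccontr)
        assume neg: "\<not> ?thesis"
        have xa: "a \<noteq> x" "{x, a} \<notin> E" using neg nbx'[of a] by auto
        have "b = x \<or> {x, b} \<in> E"
          by (rule maximal_three_swap[OF M uH(1) u(4) uH(2) ux(1) uxH True fH[OF True ux(2)] ab' xa])
        then show False using neg nbx'[of b] by auto
      qed
    qed
    also have "\<dots> \<le> 4" by (simp add: C_def card_insert_if)
    finally show False using en n by simp
  next
    case False
    have "\<not> nb E 2 \<subseteq> {u'}"
      using card_mono[of "{u'}" "nb E 2"] realizes_deg[OF R, of 2] d2 n by auto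
    then obtain f where f: "{2, f} \<in> E" "f \<noteq> u'" unfolding subset_iff in_nb_iff by blast
    have fx: "{x, f} \<in> E" using common[OF f] f False by auto
    have x2: "2 \<noteq> x" "{x, 2} \<notin> E" using x False by (auto simp: insert_commute)
    have nbt: "z = u' \<or> z = f" if z: "{2, z} \<in> E" for z
    proof (rule ccontr)
      assume neg: "\<not> ?thesis"
      then have zu': "z \<noteq> u'" by simp
      have "f = z \<or> {z, f} \<in> E"
        by (rule maximal_three_swap[OF M uH(1) u(4) uH(2) ux(1) uxH z fH[OF z zu'] f(1) fH[OF f] x2])
      then show False using neg tri[OF z f(1)] by auto
    qed
    have "nb E 2 \<subseteq> {u', f}"
    proof
      fix z assume "z \<in> nb E 2"
      then show "z \<in> {u', f}" using nbt[of z] by (simp add: in_nb_iff)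
    qed
    then have "card (nb E 2) \<le> card {u', f}" by (intro card_mono) auto
    also have "\<dots> \<le> 2" by (simp add: card_insert_if)
    finally have "d 2 \<le> 2" using realizes_deg[OF R, of 2] n by simp
    moreover have f3: "2 < f"
    proof -
      have "f \<noteq> u" "f \<noteq> 2" using f u(4) realizes_edgeD(3)[OF R f(1)] by (auto simp: insert_commute)
      then show ?thesis using f(2) u by linarith
    qed
    moreover have fn: "f < n" using realizes_edgeD[OF R f(1)] by simp
    ultimately have "card (nb E f) \<le> 2" using mono[of 2 f] realizes_deg[OF R fn] by simp
    moreover have "{2, x} \<subseteq> nb E f" using f(1) fx by (simp add: in_nb_iff insert_commute)
    ultimately have nbf: "{2, x} = nb E f"
      using card_seteq[of "nb E f" "{2, x}"] fin x by simp
    have nbf': "z = 2 \<or> z = x" if "{f, z} \<in> E" for z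
    proof -
      have "z \<in> nb E f" using that by (simp add: in_nb_iff)
      then show ?thesis unfolding nbf[symmetric] by simp
    qed
    have nbx': "z = u \<or> z = f" if "{x, z} \<in> E" for z
      using nbx[OF that] nbt[of z] x2 that by auto
    have nbu: "z = u' \<or> z = x" if z: "{u, z} \<in> E" for z
    proof (rule ccontr)
      assume neg: "\<not> ?thesis"
      then have z2: "2 < z" using nbu'[OF z] by simp
      have "f \<in> nb E 2" using f by (simp add: in_nb_iff)
      then have "f \<in> insert z (nb E z)" using tw(1)[OF z z2] f(2) by blast
      then have "f = z \<or> {f, z} \<in> E" by (auto simp: in_nb_iff insert_commute)
      then show False
      proof
        assume "f = z"
        then have "{f, u} \<in> E" using z by (simp add: insert_commute)
        then show False using nbf'[of u] uH x by auto
      next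
        assume "{f, z} \<in> E"
        then show False using nbf'[of z] neg z2 by auto
      qed
    qed
    \<comment> \<open>The 5-cycle \<open>u\<close>, \<open>u'\<close>, 2, \<open>f\<close>,
      \<open>x\<close>, the obstruction on five vertices.\<close>
    define C where "C = {{u, u'}, {2, u'}, {u, x}, {2, f}, {x, f}}"
    have C: "finite C" "{u, u'} \<in> C" "{2, u'} \<in> C" "{u, x} \<in> C" "{2, f} \<in> C" "{x, f} \<in> C"
      by (simp_all add: C_def)
    have "card E \<le> card C"
    proof (rule cover[OF C(1-3), of "{x, u, f, 2}"])
      show "{p, q} \<in> C" if pS: "p \<in> {x, u, f, 2}" and pq: "{p, q} \<in> E" for p q
      proof -
        consider "p = x" | "p = u" | "p = f" | "p = 2" using pS by blast
        then show ?thesis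
        proof cases
          case 1
          then show ?thesis using nbx'[of q] pq C comm[of x u] by auto
        next
          case 2
          then show ?thesis using nbu[of q] pq C by auto
        next
          case 3
          then show ?thesis using nbf'[of q] pq C comm[of f 2] comm[of f x] by auto
        next
          case 4
          then show ?thesis using nbt[of q] pq C by auto
        qed
      qed
      show "a \<in> {x, u, f, 2} \<or> b \<in> {x, u, f, 2}" if ab': "{a, b} \<in> E" "{a, b} \<notin> H" for a b
      proof (rule ccontr)
        assume neg: "\<not> ?thesis"
        have xa: "a \<noteq> x" "{x, a} \<notin> E" using neg nbx'[of a] by auto
        have "b = f \<or> {f, b} \<in> E"
          by (rule maximal_three_swap[OF M uH(1) u(4) uH(2) ux(1) uxH f(1) fH[OF f] ab' xa])
        then show False using neg nbf'[of b] by auto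
      qed
    qed
    also have "\<dots> \<le> 5" by (simp add: C_def card_insert_if)
    finally show False using en n by simp
  qed
qed

end

section \<open>Embedding 2-trees\<close>

text \<open>For embeddings only the pairs of adjacent vertices matter. Forgetting the arcs and
  replacing deletion by attachment of a fresh vertex gives a convenient induction.\<close>

inductive two_tree_rel :: "'a set \<Rightarrow> ('a \<times> 'a) set \<Rightarrow> bool" where
  base: "finite V \<Longrightarrow> card V = 3 \<Longrightarrow> two_tree_rel V {(x, y). x \<in> V \<and> y \<in> V \<and> x \<noteq> y}"
| step: "two_tree_rel V A \<Longrightarrow> v \<notin> V \<Longrightarrow> (u, w) \<in> A \<Longrightarrow>
    two_tree_rel (insert v V) (A \<union> {(v, u), (u, v), (v, w), (w, v)})"

lemma two_tree_graph: "two_tree G \<Longrightarrow> graph G"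
  by (induction rule: two_tree.cases) (auto simp: complete_digraph_def)

lemma arcs_ends_del_vert:
  "arcs_ends (pre_digraph.del_vert G v) = {(x, y) \<in> arcs_ends G. x \<noteq> v \<and> y \<noteq> v}"
  by (auto simp: arcs_ends_def arc_to_ends_def pre_digraph.del_vert_simps)

lemma graph_out_neighbours:
  assumes "graph G" "out_degree G v = 2" "(v, u) \<in> arcs_ends G" "(v, w) \<in> arcs_ends G" "u \<noteq> w"
  shows "(v, x) \<in> arcs_ends G \<longleftrightarrow> x = u \<or> x = w"
proof -
  interpret graph G by fact
  have inj: "inj_on (head G) (out_arcs G v)"
    by (auto simp: inj_on_def arc_to_ends_def intro!: no_multi_arcs)
  have img: "head G ` out_arcs G v = {x. (v, x) \<in> arcs_ends G}"
    by (auto simp: arcs_ends_def arc_to_ends_def image_iff)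
  have fin: "finite {x. (v, x) \<in> arcs_ends G}" unfolding img[symmetric] by auto
  have "card {x. (v, x) \<in> arcs_ends G} = 2"
    using card_image[OF inj] assms(2) by (simp add: img out_degree_def)
  then have "{u, w} = {x. (v, x) \<in> arcs_ends G}"
    using assms(3-5) fin by (intro card_seteq) auto
  then show ?thesis by blast
qed

lemma two_tree_imp_rel: "two_tree G \<Longrightarrow> two_tree_rel (verts G) (arcs_ends G)"
proof (induction rule: two_tree.induct)
  case (triangle G)
  then have "finite (verts G)" "card (verts G) = 3"
    "arcs_ends G = {(x, y). x \<in> verts G \<and> y \<in> verts G \<and> x \<noteq> y}"
    by (auto simp: complete_digraph_def card_eq_0_iff intro: card_ge_0_finite)
  then show ?case using two_tree_rel.base[of "verts G"] by simp
next
  case (attach G v u w)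
  interpret graph G by fact
  let ?D = "pre_digraph.del_vert G v"
  have nbv: "(v, x) \<in> arcs_ends G \<longleftrightarrow> x = u \<or> x = w" for x
    using graph_out_neighbours[OF attach(1,3,4,5,6)] .
  have sym: "(x, y) \<in> arcs_ends G \<longleftrightarrow> (y, x) \<in> arcs_ends G" for x y
    using sym_arcs by (auto simp: symmetric_def sym_def)
  have irr: "(x, x) \<notin> arcs_ends G" for x
    using no_loops by (auto simp: arcs_ends_def arc_to_ends_def)
  have "(u, w) \<in> arcs_ends ?D"
    using attach(4,5,7) irr by (auto simp: arcs_ends_del_vert)
  moreover have "v \<notin> verts ?D" by (simp add: pre_digraph.del_vert_simps)
  ultimately have "two_tree_rel (insert v (verts ?D)) (arcs_ends ?D \<union> {(v, u), (u, v), (v, w), (w, v)})"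
    using attach.IH by (intro two_tree_rel.step)
  moreover have "insert v (verts ?D) = verts G"
    using attach(2) by (auto simp: pre_digraph.del_vert_simps)
  moreover have "arcs_ends ?D \<union> {(v, u), (u, v), (v, w), (w, v)} = arcs_ends G"
    unfolding arcs_ends_del_vert using nbv sym by auto
  ultimately show ?case by simp
qed

text \<open>The arc count doubles the 2 |V| - 3 edges. The last conjunct, that no vertex is
  isolated, later places the image of an edge-preserving map inside the host graph.\<close>

lemma two_tree_rel_facts:
  assumes "two_tree_rel V A"
  shows "finite V \<and> finite A \<and> 3 \<le> card V \<and> card A + 6 = 4 * card V \<and> A \<subseteq> V \<times> V \<and> sym A \<and> irrefl A \<and> V \<subseteq> fst ` A"
  using assms
proof induction
  case (base V)
  have "{(x, y). x \<in> V \<and> y \<in> V \<and> x \<noteq> y} = V \<times> V - Id_on V" by auto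
  then have "card {(x, y). x \<in> V \<and> y \<in> V \<and> x \<noteq> y} = card (V \<times> V) - card (Id_on V)"
    using base by (simp add: card_Diff_subset finite_subset[of "Id_on V" "V \<times> V"] Id_on_subset_Times)
  moreover have "Id_on V = (\<lambda>x. (x, x)) ` V" by auto
  then have "card (Id_on V) = card V" by (simp add: card_image inj_on_def)
  moreover have "\<exists>y\<in>V. x \<noteq> y" if "x \<in> V" for x
  proof (rule ccontr)
    assume "\<not> ?thesis"
    then have "V \<subseteq> {x}" by auto
    then show False using card_mono[of "{x}" V] base by simp
  qed
  then have "V \<subseteq> fst ` {(x, y). x \<in> V \<and> y \<in> V \<and> x \<noteq> y}" by force
  ultimately show ?case
    using base by (auto simp: card_cartesian_product sym_def irrefl_def
        intro: finite_subset[of _ "V \<times> V"])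
next
  case (step V A v u w)
  have uw: "u \<in> V" "w \<in> V" "u \<noteq> w" using step by (auto simp: irrefl_def)
  then have ne: "v \<noteq> u" "v \<noteq> w" using step(2) by auto
  have "A \<inter> {(v, u), (u, v), (v, w), (w, v)} = {}" using step by auto
  then have "card (A \<union> {(v, u), (u, v), (v, w), (w, v)}) = card A + card {(v, u), (u, v), (v, w), (w, v)}"
    using step by (intro card_Un_disjoint) auto
  also have "card {(v, u), (u, v), (v, w), (w, v)} = 4" using ne uw by auto
  finally show ?case
    using step uw by (auto simp: sym_def irrefl_def image_iff)
qed

text \<open>The vertex attached last has only two neighbours, too few for a clique on four
  vertices.\<close>

lemma two_tree_rel_no_K4:
  assumes "two_tree_rel V A" "S \<subseteq> V" "card S = 4"
  shows "\<exists>a\<in>S. \<exists>b\<in>S. a \<noteq> b \<and> (a, b) \<notin> A"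
  using assms
proof (induction arbitrary: S)
  case (base V)
  then show ?case using card_mono[of V S] by simp
next
  case (step V A v u w)
  have A: "A \<subseteq> V \<times> V" using two_tree_rel_facts[OF step(1)] by blast
  show ?case
  proof (cases "v \<in> S")
    case True
    have "card {u, w, v} \<le> 3" by (simp add: card_insert_if)
    then have "\<not> S \<subseteq> {u, w, v}" using card_mono[of "{u, w, v}" S] step.prems by auto
    then obtain b where "b \<in> S" "b \<noteq> u" "b \<noteq> w" "b \<noteq> v" by auto
    then have "(v, b) \<notin> A \<union> {(v, u), (u, v), (v, w), (w, v)}" using A step(2) by auto
    then show ?thesis using True \<open>b \<in> S\<close> \<open>b \<noteq> v\<close> by metis
  next
    case False
    then have "S \<subseteq> V" using step.prems by auto
    then obtain a b where "a \<in> S" "b \<in> S" "a \<noteq> b" "(a, b) \<notin> A" using step.IH step.prems by blast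
    then show ?thesis using False by (intro bexI[of _ a] bexI[of _ b]) auto
  qed
qed

lemma two_tree_rel_leaf:
  assumes "two_tree_rel V A" "4 \<le> card V"
  obtains v u w where "v \<in> V" "u \<in> V" "w \<in> V" "v \<noteq> u" "v \<noteq> w" "u \<noteq> w" "(u, w) \<in> A"
    "\<And>x. (v, x) \<in> A \<longleftrightarrow> x = u \<or> x = w"
  using assms(1)
proof cases
  case base
  then show ?thesis using assms(2) by simp
next
  case (step V' A' v u w)
  have A: "A' \<subseteq> V' \<times> V'" "irrefl A'" using two_tree_rel_facts[OF step(3)] by blast+
  then have uw: "u \<in> V'" "w \<in> V'" "u \<noteq> w" using step(5) by (auto simp: irrefl_def)
  have "v \<noteq> u" "v \<noteq> w" using uw step(4) by auto
  moreover have "(v, x) \<in> A \<longleftrightarrow> x = u \<or> x = w" for x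
    using A(1) step(2,4) calculation by auto
  ultimately show ?thesis using that[of v u w] uw step by auto
qed

text \<open>
  The 4-cycle in the complement comes from counting arcs. Let \<open>v\<close> be a vertex of degree two, \<open>u\<close> and \<open>w\<close>
  its neighbours and \<open>Z\<close> the other four vertices. Without such a cycle each vertex of \<open>Z\<close> has two
  neighbours in \<open>Z\<close>, and \<open>u\<close> and \<open>w\<close> have three; this gives 26 arcs, but a 2-tree on seven vertices
  has 22.
\<close>

lemma two_tree_rel_7:
  assumes T: "two_tree_rel V A" "card V = 7"
  shows "\<exists>a b c. {a, b, c} \<subseteq> V \<and> distinct [a, b, c] \<and> (\<forall>x\<in>{a, b, c}. \<forall>y\<in>{a, b, c}. (x, y) \<notin> A)"
    and "\<exists>a b c d. {a, b, c, d} \<subseteq> V \<and> distinct [a, b, c, d] \<and>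
      (\<forall>x\<in>{a, b}. \<forall>y\<in>{c, d}. (x, y) \<notin> A \<and> (y, x) \<notin> A)"
proof -
  have fV: "finite V" and fA: "finite A" and cA: "card A = 22" and AV: "A \<subseteq> V \<times> V"
    and sym: "\<And>x y. (x, y) \<in> A \<longleftrightarrow> (y, x) \<in> A" and irr: "\<And>x. (x, x) \<notin> A"
    using two_tree_rel_facts[OF T(1)] T(2) by (auto simp: sym_def irrefl_def)
  obtain v u w where l: "v \<in> V" "u \<in> V" "w \<in> V" "v \<noteq> u" "v \<noteq> w" "u \<noteq> w" "(u, w) \<in> A"
    and nbv: "\<And>x. (v, x) \<in> A \<longleftrightarrow> x = u \<or> x = w"
    using two_tree_rel_leaf[OF T(1)] T(2) by auto
  define Z where "Z = V - {v, u, w}"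
  have cZ: "card Z = 4" unfolding Z_def using l T(2) fV by (simp add: card_Diff_subset)
  have fZ: "finite Z" using fV by (simp add: Z_def)
  have vZ: "(v, z) \<notin> A" "(z, v) \<notin> A" "z \<in> V" "z \<noteq> v" "z \<noteq> u" "z \<noteq> w" if "z \<in> Z" for z
    using that nbv[of z] sym[of z v] by (auto simp: Z_def)
  \<comment> \<open>A non-adjacent pair in \<open>Z\<close> together with \<open>v\<close>, which
    has no neighbour in \<open>Z\<close>, is the triangle in the complement.\<close>
  obtain b c where bc: "b \<in> Z" "c \<in> Z" "b \<noteq> c" "(b, c) \<notin> A"
    using two_tree_rel_no_K4[OF T(1), of Z] cZ by (auto simp: Z_def)
  show "\<exists>a b c. {a, b, c} \<subseteq> V \<and> distinct [a, b, c] \<and> (\<forall>x\<in>{a, b, c}. \<forall>y\<in>{a, b, c}. (x, y) \<notin> A)"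
    using bc vZ[OF bc(1)] vZ[OF bc(2)] l(1) irr sym[of c b]
    by (intro exI[of _ v] exI[of _ b] exI[of _ c]) auto
  show "\<exists>a b c d. {a, b, c, d} \<subseteq> V \<and> distinct [a, b, c, d] \<and>
      (\<forall>x\<in>{a, b}. \<forall>y\<in>{c, d}. (x, y) \<notin> A \<and> (y, x) \<notin> A)"
  proof (rule ccontr)
    assume neg: "\<not> ?thesis"
    \<comment> \<open>Two non-neighbours \<open>c\<close>, \<open>d\<close> of \<open>b\<close> in
      \<open>Z\<close> are also non-neighbours of \<open>v\<close>, so \<open>v\<close>,
      \<open>c\<close>, \<open>b\<close>, \<open>d\<close> is a 4-cycle in the complement.\<close>
    have few: "card {z \<in> Z - {b}. (b, z) \<notin> A} \<le> 1" if b: "b \<in> V" "b \<noteq> v" for b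
    proof (rule ccontr)
      assume "\<not> ?thesis"
      then obtain c d where cd: "c \<in> Z - {b}" "(b, c) \<notin> A" "d \<in> Z - {b}" "(b, d) \<notin> A" "c \<noteq> d"
        using card_le_Suc0_iff_eq[of "{z \<in> Z - {b}. (b, z) \<notin> A}"] fZ by auto
      then have "{v, b, c, d} \<subseteq> V \<and> distinct [v, b, c, d] \<and>
          (\<forall>x\<in>{v, b}. \<forall>y\<in>{c, d}. (x, y) \<notin> A \<and> (y, x) \<notin> A)"
        using b l(1) vZ[of c] vZ[of d] sym[of c b] sym[of d b] by auto
      then show False using neg by blast
    qed
    have many: "card (Z - {b}) - 1 \<le> card {z \<in> Z. (b, z) \<in> A}" if b: "b \<in> V" "b \<noteq> v" for b
    proof -
      have "Z - {b} = {z \<in> Z. (b, z) \<in> A} \<union> {z \<in> Z - {b}. (b, z) \<notin> A}" using irr by auto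
      then have "card (Z - {b}) \<le> card {z \<in> Z. (b, z) \<in> A} + card {z \<in> Z - {b}. (b, z) \<notin> A}"
        by (metis (no_types, lifting) card_Un_le)
      then show ?thesis using few[OF b] by linarith
    qed
    let ?S1 = "SIGMA z:Z. {z' \<in> Z. (z, z') \<in> A}"
    let ?N = "\<lambda>b. {z \<in> Z. (b, z) \<in> A}"
    have S1: "8 \<le> card ?S1"
    proof -
      have "(\<Sum>z\<in>Z. 2) \<le> (\<Sum>z\<in>Z. card (?N z))"
      proof (rule sum_mono)
        fix z assume z: "z \<in> Z"
        then have "card (Z - {z}) = 3" using cZ by simp
        then show "2 \<le> card (?N z)" using many[of z] vZ[OF z] by simp
      qed
      then show ?thesis using cZ fZ by simp
    qed
    have N: "3 \<le> card (?N u)" "3 \<le> card (?N w)"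
    proof -
      have "Z - {u} = Z" "Z - {w} = Z" by (auto simp: Z_def)
      then show "3 \<le> card (?N u)" "3 \<le> card (?N w)" using many[of u] many[of w] l cZ by auto
    qed
    let ?S2 = "Pair u ` ?N u" and ?S3 = "Pair w ` ?N w"
    let ?S4 = "(\<lambda>z. (z, u)) ` ?N u" and ?S5 = "(\<lambda>z. (z, w)) ` ?N w"
    let ?S6 = "{(v, u), (u, v), (v, w), (w, v), (u, w), (w, u)}"
    have c: "card ?S2 = card (?N u)" "card ?S3 = card (?N w)" "card ?S4 = card (?N u)" "card ?S5 = card (?N w)"
      by (simp_all add: card_image inj_on_def)
    have c6: "card ?S6 = 6" using l by auto
    have fin: "finite ?S1" "finite ?S2" "finite ?S3" "finite ?S4" "finite ?S5" "finite ?S6" using fZ by auto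
    have uwZ: "u \<notin> Z" "w \<notin> Z" "v \<notin> Z" by (auto simp: Z_def)
    have "card (?S1 \<union> ?S2 \<union> ?S3 \<union> ?S4 \<union> ?S5 \<union> ?S6) =
        card ?S1 + card ?S2 + card ?S3 + card ?S4 + card ?S5 + card ?S6"
      using fin uwZ l by (subst card_Un_disjoint; (force | simp))+
    moreover have "?S1 \<union> ?S2 \<union> ?S3 \<union> ?S4 \<union> ?S5 \<union> ?S6 \<subseteq> A"
      using nbv sym l(7) by auto
    then have "card (?S1 \<union> ?S2 \<union> ?S3 \<union> ?S4 \<union> ?S5 \<union> ?S6) \<le> card A"
      using fA by (intro card_mono)
    ultimately show False using S1 N c c6 cA by linarith
  qed
qed

text \<open>A vertex of degree two goes to \<open>t\<close>, its neighbours to \<open>a\<close> and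
  \<open>b\<close>, and all others anywhere into the clique. For k = 3 the target itself is a
  triangle.\<close>

lemma clique_plus_embeds:
  assumes T: "two_tree_rel V A" "card V = k" and E: "clique_plus k E" "\<And>a. {a} \<notin> E"
  shows "\<exists>f. inj_on f V \<and> (\<forall>(x, y)\<in>A. {f x, f y} \<in> E)"
proof -
  note F = two_tree_rel_facts[OF T(1)]
  obtain C t a b where C: "finite C" "card C = k - 1" "clique E C" "t \<notin> C" "a \<in> C" "b \<in> C" "a \<noteq> b"
    "{t, a} \<in> E" "{t, b} \<in> E"
    using E(1) unfolding clique_plus_def by blast
  show ?thesis
  proof (cases "k = 3")
    case True
    then have "C = {a, b}" using card_seteq[OF C(1), of "{a, b}"] C by auto
    then have cl: "clique E (insert t C)" using C by (auto simp: clique_def insert_commute)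
    have "card (insert t C) = card V" using C T True by simp
    then obtain f where f: "bij_betw f V (insert t C)"
      using F C(1) finite_same_card_bij by (metis finite_insert)
    have "{f x, f y} \<in> E" if "(x, y) \<in> A" for x y
    proof -
      have "x \<in> V" "y \<in> V" "x \<noteq> y" using F that by (auto simp: irrefl_def)
      then have "f x \<in> insert t C" "f y \<in> insert t C" "f x \<noteq> f y"
        using f by (auto simp: bij_betw_def inj_on_def)
      then show ?thesis using cl by (auto simp: clique_def)
    qed
    then show ?thesis using f by (auto simp: bij_betw_def)
  next
    case False
    then have "4 \<le> card V" using F T(2) by simp
    then obtain v u w where l: "v \<in> V" "u \<in> V" "w \<in> V" "v \<noteq> u" "v \<noteq> w" "u \<noteq> w" "(u, w) \<in> A"
      and nbv: "\<And>x. (v, x) \<in> A \<longleftrightarrow> x = u \<or> x = w"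
      using two_tree_rel_leaf[OF T(1)] by blast
    have "card (V - {v, u, w}) = card (C - {a, b})"
      using l F C T(2) by (simp add: card_Diff_subset)
    then obtain g where g: "bij_betw g (V - {v, u, w}) (C - {a, b})"
      using F C(1) finite_same_card_bij[of "V - {v, u, w}" "C - {a, b}"] by auto
    define f where "f = (g(u := a))(w := b, v := t)"
    have fv: "f v = t" "f u = a" "f w = b" using l by (auto simp: f_def)
    have fg: "f x \<in> C - {a, b}" "f x = g x" if "x \<in> V - {v, u, w}" for x
      using that g by (auto simp: f_def bij_betw_def)
    have inj: "inj_on f V"
    proof (rule inj_onI)
      fix x y assume xy: "x \<in> V" "y \<in> V" "f x = f y"
      have gi: "inj_on g (V - {v, u, w})" using g by (simp add: bij_betw_def)
      show "x = y"
        using xy fv fg[of x] fg[of y] C(4-7) inj_onD[OF gi, of x y]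
        by (cases "x \<in> {v, u, w}"; cases "y \<in> {v, u, w}") auto
    qed
    have fC: "f x \<in> C" if "x \<in> V" "x \<noteq> v" for x
      using fg(1)[of x] fv C(5,6) that by (cases "x \<in> {u, w}") auto
    have "{f x, f y} \<in> E" if "(x, y) \<in> A" for x y
    proof -
      have xy: "x \<in> V" "y \<in> V" "x \<noteq> y" "(y, x) \<in> A" using F that by (auto simp: irrefl_def sym_def)
      consider "x = v" | "y = v" | "x \<noteq> v" "y \<noteq> v" by blast
      then show ?thesis
      proof cases
        case 1
        then show ?thesis using that nbv fv C(8,9) by auto
      next
        case 2
        then show ?thesis using xy(4) nbv fv C(8,9) by (auto simp: insert_commute)
      next
        case 3
        have "f x \<noteq> f y" using inj xy by (auto simp: inj_on_def)
        then show ?thesis using fC[OF xy(1) 3(1)] fC[OF xy(2) 3(2)] C(3) by (simp add: clique_def)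
      qed
    qed
    then show ?thesis using inj by blast
  qed
qed

text \<open>Only arcs inside \<open>X\<close> constrain \<open>g\<close>: any other pair has an end
  mapped into the clique, which is joined to everything in the image.\<close>

lemma clique_join_embeds:
  assumes A: "A \<subseteq> V \<times> V" "irrefl A" "sym A" and V: "finite V" "card V = card C + card X" "X \<subseteq> V"
    and C: "finite C" "clique E C" and g: "inj_on g X" "g ` X \<inter> C = {}"
    and join: "\<And>x c. x \<in> X \<Longrightarrow> c \<in> C \<Longrightarrow> {c, g x} \<in> E"
    and X: "\<And>x y. x \<in> X \<Longrightarrow> y \<in> X \<Longrightarrow> (x, y) \<in> A \<Longrightarrow> {g x, g y} \<in> E"
  shows "\<exists>f. inj_on f V \<and> (\<forall>(x, y)\<in>A. {f x, f y} \<in> E)"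
proof -
  have "card (V - X) = card C" using V finite_subset[OF V(3,1)] by (simp add: card_Diff_subset)
  then obtain h where h: "bij_betw h (V - X) C"
    using V C(1) finite_same_card_bij[of "V - X" C] by auto
  define f where "f x = (if x \<in> X then g x else h x)" for x
  have hC: "h x \<in> C" if "x \<in> V" "x \<notin> X" for x using h that by (auto simp: bij_betw_def)
  have hi: "inj_on h (V - X)" using h by (simp add: bij_betw_def)
  have inj: "inj_on f V"
  proof (rule inj_onI)
    fix x y assume xy: "x \<in> V" "y \<in> V" "f x = f y"
    show "x = y"
      using xy g(2) hC[of x] hC[of y] inj_onD[OF g(1), of x y] inj_onD[OF hi, of x y]
      by (cases "x \<in> X"; cases "y \<in> X") (auto simp: f_def)
  qed
  have "{f x, f y} \<in> E" if xy: "(x, y) \<in> A" for x y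
  proof -
    have V: "x \<in> V" "y \<in> V" "x \<noteq> y" using A xy by (auto simp: irrefl_def)
    then have "f x \<noteq> f y" using inj by (auto simp: inj_on_def)
    then show ?thesis
      using V xy X join[of x "h y"] join[of y "h x"] hC[of x] hC[of y] C(2)
      by (cases "x \<in> X"; cases "y \<in> X") (auto simp: f_def clique_def insert_commute)
  qed
  then show ?thesis using inj by blast
qed

lemma universal7_embeds:
  assumes T: "two_tree_rel V A" "card V = 7" and E: "universal7 E" "\<And>a. {a} \<notin> E"
  shows "\<exists>f. inj_on f V \<and> (\<forall>(x, y)\<in>A. {f x, f y} \<in> E)"
proof -
  note F = two_tree_rel_facts[OF T(1)]
  consider "clique_plus 7 E" | "triangle_join_pairs E" | "clique_join_triple E"
    using E(1) by (auto simp: universal7_def)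
  then show ?thesis
  proof cases
    case 1
    then show ?thesis using clique_plus_embeds[OF T _ E(2)] by blast
  next
    case 2
    then obtain C p q r s where C: "finite C" "card C = 3" "clique E C" "distinct [p, q, r, s]"
      "\<And>z. z \<in> {p, q, r, s} \<Longrightarrow> z \<notin> C \<and> (\<forall>c\<in>C. {c, z} \<in> E)" "{p, q} \<in> E" "{r, s} \<in> E"
      unfolding triangle_join_pairs_def by blast
    obtain a b c d where X: "{a, b, c, d} \<subseteq> V" "distinct [a, b, c, d]"
      "\<forall>x\<in>{a, b}. \<forall>y\<in>{c, d}. (x, y) \<notin> A \<and> (y, x) \<notin> A"
      using two_tree_rel_7(2)[OF T] by blast
    define g where "g x = (if x = a then p else if x = b then q else if x = c then r else s)" for x
    have g: "g a = p" "g b = q" "g c = r" "g d = s" using X(2) by (auto simp: g_def)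
    have gX: "g x \<in> {p, q, r, s}" for x by (simp add: g_def)
    show ?thesis
    proof (rule clique_join_embeds[of A V C "{a, b, c, d}" E g])
      show "card V = card C + card {a, b, c, d}" using T(2) C(2) X(2) by simp
      show "inj_on g {a, b, c, d}" using g C(4) by (auto simp: inj_on_def)
      show "g ` {a, b, c, d} \<inter> C = {}" using gX C(5) by blast
      show "{z, g x} \<in> E" if "z \<in> C" for x z using gX C(5) that by blast
      show "{g x, g y} \<in> E" if "x \<in> {a, b, c, d}" "y \<in> {a, b, c, d}" "(x, y) \<in> A" for x y
      proof -
        have "x \<noteq> y" using that F by (auto simp: irrefl_def)
        then have "{x, y} = {a, b} \<or> {x, y} = {c, d}" using that X(3) by auto
        then show ?thesis using g C(6,7) by (auto simp: doubleton_eq_iff insert_commute)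
      qed
    qed (use F C X in auto)
  next
    case 3
    then obtain C p q r where C: "finite C" "card C = 4" "clique E C" "distinct [p, q, r]"
      "\<And>z. z \<in> {p, q, r} \<Longrightarrow> z \<notin> C \<and> (\<forall>c\<in>C. {c, z} \<in> E)"
      unfolding clique_join_triple_def by blast
    obtain a b c where X: "{a, b, c} \<subseteq> V" "distinct [a, b, c]"
      "\<forall>x\<in>{a, b, c}. \<forall>y\<in>{a, b, c}. (x, y) \<notin> A"
      using two_tree_rel_7(1)[OF T] by blast
    define g where "g x = (if x = a then p else if x = b then q else r)" for x
    have g: "g a = p" "g b = q" "g c = r" using X(2) by (auto simp: g_def)
    have gX: "g x \<in> {p, q, r}" for x by (simp add: g_def)
    show ?thesis
    proof (rule clique_join_embeds[of A V C "{a, b, c}" E g])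
      show "card V = card C + card {a, b, c}" using T(2) C(2) X(2) by simp
      show "inj_on g {a, b, c}" using g C(4) by (auto simp: inj_on_def)
      show "g ` {a, b, c} \<inter> C = {}" using gX C(5) by blast
      show "{z, g x} \<in> E" if "z \<in> C" for x z using gX C(5) that by blast
      show "{g x, g y} \<in> E" if "x \<in> {a, b, c}" "y \<in> {a, b, c}" "(x, y) \<in> A" for x y
        using that X(3) by blast
    qed (use F C X in auto)
  qed
qed

section \<open>Realizations as digraphs\<close>

definition graph_on :: "nat \<Rightarrow> nat set set \<Rightarrow> nat pair_pre_digraph" where
  "graph_on n E = \<lparr>pverts = {..<n}, parcs = {(a, b). {a, b} \<in> E}\<rparr>"

lemma pair_graph_graph_on:
  assumes E: "E \<subseteq> edges_on {..<n}"
  shows "pair_graph (graph_on n E)"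
proof
  have mem: "a < n" "b < n" "a \<noteq> b" if "{a, b} \<in> E" for a b using subsetD[OF E that] by auto
  show "fst e \<in> pverts (graph_on n E)" if "e \<in> parcs (graph_on n E)" for e
    using that mem by (auto simp: graph_on_def)
  show "snd e \<in> pverts (graph_on n E)" if "e \<in> parcs (graph_on n E)" for e
    using that mem by (auto simp: graph_on_def)
  show "finite (pverts (graph_on n E))" by (simp add: graph_on_def)
  have "parcs (graph_on n E) \<subseteq> {..<n} \<times> {..<n}" using mem by (auto simp: graph_on_def)
  then show "finite (parcs (graph_on n E))" using finite_subset by blast
  show "fst e \<noteq> snd e" if "e \<in> parcs (graph_on n E)" for e
    using that mem by (auto simp: graph_on_def)
  show "symmetric (with_proj (graph_on n E))"
    by (auto simp: symmetric_def sym_def graph_on_def insert_commute)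
qed

lemma out_degree_with_proj: "out_degree (with_proj G) v = card {w. (v, w) \<in> parcs G}"
proof -
  have "out_arcs (with_proj G) v = Pair v ` {w. (v, w) \<in> parcs G}"
    by (auto simp: out_arcs_def)
  then show ?thesis by (simp add: out_degree_def card_image inj_on_def)
qed

lemma out_degree_graph_on: "out_degree (with_proj (graph_on n E)) v = card (nb E v)"
  by (simp add: out_degree_with_proj graph_on_def nb_def)

lemma (in deg_seq) realization_graph_on:
  assumes E: "realizes E" and ds: "length ds = n" "\<And>i. i < n \<Longrightarrow> ds ! i = d i"
  shows "realization (graph_on n E) ds"
proof -
  have "image_mset (out_degree (with_proj (graph_on n E))) (mset_set (pverts (graph_on n E))) =
      image_mset (\<lambda>i. ds ! i) (mset_set {..<n})"
  proof -
    have "pverts (graph_on n E) = {..<n}" by (simp add: graph_on_def)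
    then show ?thesis
      using realizes_deg[OF E] ds(2) by (auto simp: out_degree_graph_on intro: image_mset_cong)
  qed
  also have "\<dots> = mset (map ((!) ds) [0..<n])"
    by (simp add: lessThan_atLeast0 flip: mset_upt mset_map)
  also have "map ((!) ds) [0..<n] = ds" using ds(1) by (metis map_nth)
  finally show ?thesis
    using pair_graph_graph_on[OF realizes_edges[OF E]] by (simp add: realization_def)
qed

text \<open>This numbers the vertices of a realization in such a way that the i-th vertex has the
  i-th degree of the sequence.\<close>

lemma image_mset_eq_mset:
  assumes "image_mset f M = mset ys"
  shows "\<exists>xs. mset xs = M \<and> map f xs = ys"
  using assms
proof (induction ys arbitrary: M)
  case (Cons y ys)
  then have "y \<in># image_mset f M" by simp
  then obtain x where x: "x \<in># M" "f x = y" by auto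
  then obtain N where N: "M = add_mset x N" by (metis multi_member_split)
  then obtain xs where "mset xs = N" "map f xs = ys" using Cons x by auto
  then show ?case using N x by (intro exI[of _ "x # xs"]) auto
qed simp

lemma (in deg_seq) realizes_of_realization:
  assumes G: "realization G ds" and ds: "length ds = n" "\<And>i. i < n \<Longrightarrow> ds ! i = d i"
  shows "\<exists>E. realizes E"
proof -
  interpret pair_graph G using G by (simp add: realization_def)
  obtain xs where xs: "mset xs = mset_set (pverts G)" "map (out_degree (with_proj G)) xs = ds"
    using G image_mset_eq_mset unfolding realization_def by blast
  have set: "set xs = pverts G"
    using xs(1) pair_finite_verts by (metis finite_set_mset_mset_set set_mset_mset)
  have dist: "distinct xs"
    using xs(1) pair_finite_verts by (metis count_mset_set(1) count_mset_set(3) distinct_count_atmost_1 set mset_set_set)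
  have len: "length xs = n" using xs(2) ds(1) by auto
  have sym: "(a, b) \<in> parcs G \<Longrightarrow> (b, a) \<in> parcs G" for a b by (rule arcs_symmetric)
  define E where "E = {{i, j} |i j. i < n \<and> j < n \<and> (xs ! i, xs ! j) \<in> parcs G}"
  have E: "{i, j} \<in> E \<longleftrightarrow> i < n \<and> j < n \<and> (xs ! i, xs ! j) \<in> parcs G" for i j
    using sym by (auto simp: E_def doubleton_eq_iff)
  have "E \<subseteq> edges_on {..<n}"
  proof
    fix e assume "e \<in> E"
    then obtain i j where ij: "e = {i, j}" "i < n" "j < n" "(xs ! i, xs ! j) \<in> parcs G"
      unfolding E_def by blast
    then have "i \<noteq> j" using no_loops' by blast
    then show "e \<in> edges_on {..<n}" using ij by simp
  qed
  moreover have "card (nb E i) = d i" if i: "i < n" for i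
  proof -
    have "bij_betw ((!) xs) (nb E i) {w. (xs ! i, w) \<in> parcs G}"
    proof (rule bij_betwI')
      fix a b assume "a \<in> nb E i" "b \<in> nb E i"
      then show "(xs ! a = xs ! b) = (a = b)"
        using dist len by (auto simp: in_nb_iff E nth_eq_iff_index_eq)
    next
      fix a assume "a \<in> nb E i"
      then show "xs ! a \<in> {w. (xs ! i, w) \<in> parcs G}" by (simp add: in_nb_iff E)
    next
      fix w assume w: "w \<in> {w. (xs ! i, w) \<in> parcs G}"
      then have "w \<in> set xs" using set in_arcsD2 by blast
      then obtain a where "a < n" "xs ! a = w" using len by (metis in_set_conv_nth)
      then show "\<exists>a\<in>nb E i. w = xs ! a" using w i by (intro bexI[of _ a]) (auto simp: in_nb_iff E)
    qed
    then have "card (nb E i) = out_degree (with_proj G) (xs ! i)"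
      using bij_betw_same_card by (auto simp: out_degree_with_proj)
    also have "\<dots> = ds ! i" using xs(2) len i by auto
    finally show ?thesis using ds(2) i by simp
  qed
  ultimately show ?thesis unfolding realizes_def by blast
qed

lemma containsI:
  assumes G: "pair_graph G" and T: "pair_wf_digraph T" and f: "inj_on f (pverts T)" "f ` pverts T \<subseteq> pverts G"
    and arcs: "\<And>x y. (x, y) \<in> parcs T \<Longrightarrow> (f x, f y) \<in> parcs G"
  shows "contains G T"
proof -
  interpret T: pair_wf_digraph T by fact
  interpret G: pair_graph G by fact
  define S where "S = \<lparr>pverts = f ` pverts T, parcs = (\<lambda>(x, y). (f x, f y)) ` parcs T\<rparr>"
  have wfS: "pair_wf_digraph S"
    by unfold_locales (auto simp: S_def dest: T.wellformed')
  have sub: "subgraph (with_proj S) (with_proj G)"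
    using f(2) arcs wfS G.pair_wf_digraph
    by (auto simp: subgraph_def S_def wf_digraph_wp_iff)
  have "digraph_iso (with_proj T) (with_proj S)"
  proof -
    let ?h = "\<lparr>iso_verts = f, iso_arcs = (\<lambda>(x, y). (f x, f y)), iso_head = snd, iso_tail = fst\<rparr>"
    have "inj_on (\<lambda>(x, y). (f x, f y)) (parcs T)"
    proof -
      have "parcs T \<subseteq> pverts T \<times> pverts T" using T.wellformed' by auto
      then have "inj_on (map_prod f f) (parcs T)"
        by (rule inj_on_subset[OF map_prod_inj_on[OF f(1) f(1)]])
      then show ?thesis by (simp add: map_prod_def)
    qed
    then have "pre_digraph.digraph_isomorphism (with_proj T) ?h"
      using T f(1) by (auto simp: pre_digraph.digraph_isomorphism_def wf_digraph_wp_iff)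
    moreover have "with_proj S = app_iso ?h (with_proj T)"
      by (simp add: app_iso_def S_def with_proj_def)
    ultimately show ?thesis unfolding digraph_iso_def by blast
  qed
  moreover have "wf_digraph (with_proj T)" using T by (simp add: wf_digraph_wp_iff)
  ultimately have "digraph_iso (with_proj S) (with_proj T)" by (rule digraph_iso_swap[rotated])
  then show ?thesis using sub unfolding contains_def by blast
qed

lemma containsE:
  assumes "contains G T"
  obtains f where "inj_on f (pverts T)" "f ` pverts T \<subseteq> pverts G"
    "\<And>x y. (x, y) \<in> parcs T \<Longrightarrow> (f x, f y) \<in> parcs G"
proof -
  obtain S where S: "subgraph (with_proj S) (with_proj G)" "digraph_iso (with_proj S) (with_proj T)"
    using assms unfolding contains_def by blast
  have "wf_digraph (with_proj S)" using S(1) by (simp add: subgraph_def)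
  then have "digraph_iso (with_proj T) (with_proj S)" using digraph_iso_swap S(2) by blast
  then obtain h where h: "pre_digraph.digraph_isomorphism (with_proj T) h" "with_proj S = app_iso h (with_proj T)"
    unfolding digraph_iso_def by blast
  have hv: "pverts S = iso_verts h ` pverts T" and ha: "parcs S = iso_arcs h ` parcs T"
    and ht: "iso_tail h = fst" and hh: "iso_head h = snd"
    using arg_cong[OF h(2), of verts] arg_cong[OF h(2), of arcs] arg_cong[OF h(2), of tail]
      arg_cong[OF h(2), of head] by simp_all
  have sub: "pverts S \<subseteq> pverts G" "parcs S \<subseteq> parcs G" using S(1) by (simp_all add: subgraph_def)
  show ?thesis
  proof (rule that[of "iso_verts h"])
    show "inj_on (iso_verts h) (pverts T)" using h(1) by (simp add: pre_digraph.digraph_isomorphism_def)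
    show "iso_verts h ` pverts T \<subseteq> pverts G" using hv sub(1) by simp
    fix x y assume xy: "(x, y) \<in> parcs T"
    then have "iso_arcs h (x, y) = (iso_verts h x, iso_verts h y)"
      using h(1) ht hh by (auto simp: pre_digraph.digraph_isomorphism_def prod_eq_iff)
    then show "(iso_verts h x, iso_verts h y) \<in> parcs G" using xy ha sub(2) by force
  qed
qed

lemma contains_all_two_treesI:
  assumes E: "E \<subseteq> edges_on {..<n}"
    and emb: "\<And>V A. two_tree_rel (V :: nat set) A \<Longrightarrow> card V = k \<Longrightarrow> \<exists>f. inj_on f V \<and> (\<forall>(x, y)\<in>A. {f x, f y} \<in> E)"
  shows "contains_all_two_trees k (graph_on n E)"
  unfolding contains_all_two_trees_def
proof (intro allI impI)
  fix T :: "nat pair_pre_digraph"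
  assume T: "two_tree (with_proj T) \<and> card (pverts T) = k"
  then have rel: "two_tree_rel (pverts T) (parcs T)" using two_tree_imp_rel[of "with_proj T"] by simp
  obtain f where f: "inj_on f (pverts T)" "\<And>x y. (x, y) \<in> parcs T \<Longrightarrow> {f x, f y} \<in> E"
    using emb[OF rel] T by blast
  have "f ` pverts T \<subseteq> {..<n}"
  proof
    fix z assume "z \<in> f ` pverts T"
    then obtain x where x: "x \<in> pverts T" "z = f x" by blast
    then obtain y where "(x, y) \<in> parcs T" using two_tree_rel_facts[OF rel] by force
    then have "{z, f y} \<in> edges_on {..<n}" using f(2) x(2) E by blast
    then show "z \<in> {..<n}" by simp
  qed
  moreover have "pair_graph T" using pair_graphI_graph[OF two_tree_graph] T by blast
  then interpret T: pair_graph T .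
  have "pair_wf_digraph T" by (rule T.pair_wf_digraph)
  ultimately show "contains (graph_on n E) T"
    using f by (intro containsI[OF pair_graph_graph_on[OF E], of T f]) (auto simp: graph_on_def)
qed

section \<open>Sharpness\<close>

text \<open>The spine is \<open>{0, 1}\<close>. Deleting the last vertex leaves the next smaller
  book, as the induction over \<open>two_tree\<close> requires.\<close>

definition book :: "nat \<Rightarrow> nat pair_pre_digraph" where
  "book k = \<lparr>pverts = {..<k}, parcs = {(i, j). i < k \<and> j < k \<and> i \<noteq> j \<and> (i < 2 \<or> j < 2)}\<rparr>"

lemma graph_book: "graph (with_proj (book k))"
proof -
  have "finite (parcs (book k))"
    by (rule finite_subset[of _ "{..<k} \<times> {..<k}"]) (auto simp: book_def)
  then interpret pair_graph "book k"
    by unfold_locales (auto simp: book_def symmetric_def sym_def)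
  show ?thesis by (rule pair_graphD_graph)
qed

lemma two_tree_book: "3 \<le> k \<Longrightarrow> two_tree (with_proj (book k))"
proof (induction k rule: dec_induct)
  case base
  have "parcs (book 3) = {(u, v). (u, v) \<in> {..<3} \<times> {..<3} \<and> u \<noteq> v}" by (auto simp: book_def)
  then show ?case
    using graph_book[of 3] by (intro two_tree.triangle) (simp add: complete_digraph_def book_def)
next
  case (step k)
  have del: "pre_digraph.del_vert (with_proj (book (Suc k))) k = with_proj (book k)"
    using step(1) by (auto simp: pre_digraph.del_vert_def book_def with_proj_def less_Suc_eq)
  have "{w. (k, w) \<in> parcs (book (Suc k))} = {0, 1}"
    using step(1) by (auto simp: book_def)
  then have deg: "out_degree (with_proj (book (Suc k))) k = 2" by (simp add: out_degree_with_proj)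
  show ?case
  proof (rule two_tree.attach[of _ k 0 1])
    show "two_tree (pre_digraph.del_vert (with_proj (book (Suc k))) k)" unfolding del by (rule step.IH)
  qed (use step(1) graph_book deg in \<open>simp_all add: book_def\<close>)
qed

lemma contains_book_imp_degrees:
  assumes "contains G (book k)" "pair_graph G" "2 \<le> k"
  obtains a b where "a \<in> pverts G" "b \<in> pverts G" "a \<noteq> b"
    "k - 1 \<le> out_degree (with_proj G) a" "k - 1 \<le> out_degree (with_proj G) b"
proof -
  interpret pair_graph G by fact
  obtain f where f: "inj_on f (pverts (book k))" "f ` pverts (book k) \<subseteq> pverts G"
    "\<And>x y. (x, y) \<in> parcs (book k) \<Longrightarrow> (f x, f y) \<in> parcs G"
    using containsE[OF assms(1)] by blast
  have inj: "inj_on f {..<k}" using f(1) by (simp add: book_def)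
  have deg: "k - 1 \<le> out_degree (with_proj G) (f i)" if i: "i < 2" for i
  proof -
    have "f ` ({..<k} - {i}) \<subseteq> {w. (f i, w) \<in> parcs G}"
      using f(3) i assms(3) by (auto simp: book_def)
    moreover have "finite {w. (f i, w) \<in> parcs G}"
      by (rule finite_subset[of _ "pverts G"]) (auto simp: pair_finite_verts dest: in_arcsD2)
    ultimately have "card (f ` ({..<k} - {i})) \<le> card {w. (f i, w) \<in> parcs G}"
      by (intro card_mono)
    moreover have "card (f ` ({..<k} - {i})) = k - 1"
      using inj i assms(3) by (subst card_image) (auto intro: inj_on_subset)
    ultimately show ?thesis by (simp add: out_degree_with_proj)
  qed
  have "f 0 \<noteq> f 1" using inj_onD[OF inj, of 0 1] assms(3) by auto
  moreover have "f 0 \<in> pverts G" "f 1 \<in> pverts G" using f(2) assms(3) by (auto simp: book_def)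
  ultimately show ?thesis using that[of "f 0" "f 1"] deg[of 0] deg[of 1] by simp
qed

text \<open>The centre 0 is joined to \<open>m\<close> complete blocks of k - 2 consecutive
  vertices; \<open>B i\<close> is the block number of vertex \<open>i\<close>. A block vertex has k
  - 3 neighbours in its block, and the centre.\<close>

lemma windmill_realization:
  assumes k: "3 \<le> k" and n_def: "n = 1 + m * (k - 2)"
  shows "\<exists>G. realization G ((n - 1) # replicate (n - 1) (k - 2))"
proof (cases "m = 0")
  case True
  have e: "{..<Suc 0} = {0::nat}" by auto
  have "realization (graph_on 1 {}) [0]"
    using pair_graph_graph_on[of "{}" 1]
    by (auto simp: realization_def graph_on_def out_degree_with_proj e)
  then show ?thesis using True by (auto simp: n_def)
next
  case False
  let ?ds = "(n - 1) # replicate (n - 1) (k - 2)"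
  have kn: "k - 2 \<le> n - 1" using False by (cases m) (auto simp: n_def)
  interpret deg_seq n "(!) ?ds"
  proof
    fix i j assume "i \<le> j" "j < n"
    then show "?ds ! j \<le> ?ds ! i" using kn by (cases i; cases j) auto
  qed
  define B where "B i = (i - 1) div (k - 2)" for i
  define E where "E = {{i, j} |i j. i < j \<and> j < n \<and> (i = 0 \<or> B i = B j)}"
  have E: "{i, j} \<in> E \<longleftrightarrow> i \<noteq> j \<and> i < n \<and> j < n \<and> (i = 0 \<or> j = 0 \<or> B i = B j)" for i j
    unfolding E_def by (auto simp: doubleton_eq_iff) (metis nat_neq_iff)+
  have "realizes E"
    unfolding realizes_def
  proof (intro conjI allI impI)
    show "E \<subseteq> edges_on {..<n}" by (auto simp: E_def)
    fix i assume i: "i < n"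
    show "card (nb E i) = ?ds ! i"
    proof (cases "i = 0")
      case True
      have "nb E 0 = {..<n} - {0}" using E[of 0 0] by (auto simp: in_nb_iff E n_def)
      then show ?thesis using True by (simp add: n_def)
    next
      case False
      define q where "q = B i"
      have q: "q < m" using i False k by (auto simp: q_def B_def n_def less_mult_imp_div_less)
      have blk: "{j. 0 < j \<and> B j = q} = {q * (k - 2) + 1..<q * (k - 2) + 1 + (k - 2)}"
      proof (intro set_eqI iffI)
        fix j assume "j \<in> {j. 0 < j \<and> B j = q}"
        then have j: "0 < j" "(j - 1) div (k - 2) = q" by (auto simp: B_def)
        have "q * (k - 2) \<le> j - 1" using j(2) div_times_less_eq_dividend by blast
        moreover have "j - 1 < q * (k - 2) + (k - 2)"
          using j(2) k dividend_less_div_times[of "k - 2" "j - 1"] by (simp add: add.commute)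
        ultimately show "j \<in> {q * (k - 2) + 1..<q * (k - 2) + 1 + (k - 2)}" using j(1) by auto
      next
        fix j assume "j \<in> {q * (k - 2) + 1..<q * (k - 2) + 1 + (k - 2)}"
        then have j: "0 < j" "q * (k - 2) \<le> j - 1" "j - 1 < q * (k - 2) + (k - 2)" by auto
        then have "(j - 1) div (k - 2) = q"
          by (intro div_nat_eqI) (simp_all add: mult.commute add.commute)
        then show "j \<in> {j. 0 < j \<and> B j = q}" using j(1) by (simp add: B_def)
      qed
      have "Suc q * (k - 2) \<le> m * (k - 2)" using q by (intro mult_right_mono) auto
      then have le: "q * (k - 2) + 1 + (k - 2) \<le> n" by (simp add: n_def)
      have sub: "{j. 0 < j \<and> B j = q} \<subseteq> {..<n}" unfolding blk using le by auto
      have "nb E i = insert 0 ({j. 0 < j \<and> B j = q} - {i})"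
        using sub i False E[of i i] by (auto simp: in_nb_iff E q_def)
      moreover have "finite {j. 0 < j \<and> B j = q}" unfolding blk by simp
      moreover have "card {j. 0 < j \<and> B j = q} = k - 2" unfolding blk by simp
      moreover have "i \<in> {j. 0 < j \<and> B j = q}" using False by (simp add: q_def)
      ultimately have "card (nb E i) = k - 2" using k by (simp add: card_Diff_singleton)
      then show ?thesis using False i by (cases i) auto
    qed
  qed
  then have "realization (graph_on n E) ?ds"
    by (rule realization_graph_on) (auto simp: n_def)
  then show ?thesis by blast
qed

lemma no_realization_contains_book:
  assumes k: "3 \<le> k" and G: "realization G ((n - 1) # replicate (n - 1) (k - 2))"
  shows "\<not> contains_all_two_trees k G"
proof
  assume all: "contains_all_two_trees k G"
  have pg: "pair_graph G" using G by (simp add: realization_def)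
  then interpret pair_graph G .
  have "card (pverts (book k)) = k" by (simp add: book_def)
  then have "contains G (book k)"
    using all two_tree_book[OF k] unfolding contains_all_two_trees_def by blast
  then obtain a b where ab: "a \<in> pverts G" "b \<in> pverts G" "a \<noteq> b"
    "k - 1 \<le> out_degree (with_proj G) a" "k - 1 \<le> out_degree (with_proj G) b"
    by (rule contains_book_imp_degrees[OF _ pg]) (use k in auto)
  \<comment> \<open>The number of vertices of degree at least k - 1 is the same in all realizations
    and can be read off the list, where only the first entry can reach k - 1.\<close>
  let ?P = "\<lambda>x. k - 1 \<le> x"
  have "card {a, b} \<le> card {v \<in> pverts G. ?P (out_degree (with_proj G) v)}"
    using ab pair_finite_verts by (intro card_mono) auto
  also have "\<dots> = size (filter_mset ?P (image_mset (out_degree (with_proj G)) (mset_set (pverts G))))"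
    using pair_finite_verts by (simp add: filter_mset_image_mset filter_mset_mset_set)
  also have "\<dots> = length (filter ?P ((n - 1) # replicate (n - 1) (k - 2)))"
    using G unfolding realization_def by (metis mset_filter size_mset)
  also have "\<dots> \<le> 1"
    using k by (simp add: filter_replicate)
  finally show False using ab(3) by simp
qed

theorem theorem1p4:
  fixes k N :: nat
  assumes "(k, N) \<in> {(3, 6), (4, 7), (5, 24), (7, 93)}"
  shows "(\<forall>(n::nat) (d::nat list).
            n \<ge> N \<and> graphic d \<and> length d = n \<and> sum_list d > (k - 1) * (n - 1) \<longrightarrow>
            (\<exists>G. realization G d \<and> contains_all_two_trees k G)) \<and>
         infinite {n::nat. \<exists>d::nat list.
            graphic d \<and> length d = n \<and> sum_list d = (k - 1) * (n - 1) \<and>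
            \<not> (\<exists>G. realization G d \<and> contains_all_two_trees k G)}"
proof (intro conjI allI impI)
  fix n :: nat and d :: "nat list"
  assume a: "n \<ge> N \<and> graphic d \<and> length d = n \<and> sum_list d > (k - 1) * (n - 1)"
  interpret deg_seq n "(!) d"
  proof
    fix i j assume ij: "i \<le> j" "j < n"
    have "sorted_wrt (\<ge>) d" using a by (simp add: graphic_def)
    then show "d ! j \<le> d ! i" using ij a by (cases "i = j") (auto simp: sorted_wrt_iff_nth_less)
  qed
  obtain E\<^sub>0 where E0: "realizes E\<^sub>0"
    using a realizes_of_realization unfolding graphic_def by blast
  have s: "(k - 1) * (n - 1) < (\<Sum>i<n. d ! i)"
  proof -
    have "length d = n" "(k - 1) * (n - 1) < sum_list d" using a by simp_all
    then show ?thesis by (simp add: sum_list_sum_nth lessThan_atLeast0)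
  qed
  have "\<exists>E. realizes E \<and> (clique_plus k E \<or> (k = 7 \<and> universal7 E))"
  proof -
    consider "k = 3" "6 \<le> n" | "k = 4" "7 \<le> n" | "k = 5" "24 \<le> n" | "k = 7" "93 \<le> n"
      using assms a by auto
    then show ?thesis
    proof cases
      case 1
      then show ?thesis using clique_plus_3_exists[OF E0] s by simp
    next
      case 2
      then show ?thesis using clique_plus_4_exists[OF E0] s by simp
    next
      case 3
      then show ?thesis using clique_plus_5_exists[OF E0] s by simp
    next
      case 4
      then show ?thesis using universal7_exists[OF E0] s by auto
    qed
  qed
  then obtain E where R: "realizes E" and E: "clique_plus k E \<or> (k = 7 \<and> universal7 E)" by blast
  have irr: "{x} \<notin> E" for x using realizes_edgeD(3)[OF R, of x x] by auto
  have "contains_all_two_trees k (graph_on n E)"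
    using contains_all_two_treesI[OF realizes_edges[OF R]] clique_plus_embeds[OF _ _ _ irr]
      universal7_embeds[OF _ _ _ irr] E by metis
  then show "\<exists>G. realization G d \<and> contains_all_two_trees k G"
    using realization_graph_on[OF R] a by blast
next
  let ?S = "{n::nat. \<exists>d::nat list. graphic d \<and> length d = n \<and> sum_list d = (k - 1) * (n - 1) \<and>
            \<not> (\<exists>G. realization G d \<and> contains_all_two_trees k G)}"
  have k: "3 \<le> k" using assms by auto
  \<comment> \<open>The windmill requires k - 2 to divide n - 1. Using \<open>Suc m\<close>
    guarantees a block, so the first entry is not below the others.\<close>
  let ?n = "\<lambda>m. 1 + Suc m * (k - 2)"
  have "?n m \<in> ?S" for m
  proof -
    define n where "n = ?n m"
    let ?d = "(n - 1) # replicate (n - 1) (k - 2)"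
    have "k - 2 \<le> n - 1" by (simp add: n_def)
    then have "sorted_wrt (\<ge>) ?d" by (auto simp: sorted_wrt_iff_nth_less nth_Cons split: nat.splits)
    then have "graphic ?d"
      using windmill_realization[OF k n_def] unfolding graphic_def by blast
    moreover have "length ?d = n" by (simp add: n_def)
    moreover have "sum_list ?d = (k - 1) * (n - 1)"
    proof -
      have "sum_list ?d = (1 + (k - 2)) * (n - 1)" by (simp only: sum_list.Cons sum_list_replicate) simp
      moreover have "1 + (k - 2) = k - 1" using k by simp
      ultimately show ?thesis by (simp only:)
    qed
    moreover have "\<not> (\<exists>G. realization G ?d \<and> contains_all_two_trees k G)"
      using no_realization_contains_book[OF k] by blast
    ultimately show ?thesis unfolding n_def[symmetric] by blast
  qed
  then have "range ?n \<subseteq> ?S" by blast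
  moreover have "infinite (range ?n)"
  proof (intro range_inj_infinite injI)
    fix x y assume "?n x = ?n y"
    moreover have "k - 2 \<noteq> 0" using k by simp
    ultimately show "x = y" by (simp only: add_left_cancel mult_cancel2 nat.inject simp_thms)
  qed
  ultimately show "infinite ?S" using finite_subset by blast
qed

end
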